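(* Let $\Omega=\mathbb{R}^{2}$ and let $\omega\subset\Omega$ be a bounded subset of positive measure. Let $\mathbf{F}\in L^{2}(\Omega)$ be a rank-two tensor. Then for any $\boldsymbol{\mu}\in\mathbb{R}^{2}$, there exists a weak solution $\boldsymbol{u}\in\dot{H}_{\sigma}^{1}(\Omega)$ of the stationary Navier--Stokes equations in $\Omega$ with source term $\boldsymbol{f}=\boldsymbol{\nabla}\cdot\mathbf{F}$ such that $\frac{1}{|\omega|}\int_{\omega}\boldsymbol{u}=\boldsymbol{\mu}$. Moreover, \[ \|\boldsymbol{\nabla}\boldsymbol{u}\|_{L^{2}(\Omega)}^{2}\leq\langle\mathbf{F},\boldsymbol{\nabla}\boldsymbol{u}\rangle_{L^{2}(\Omega)}, \] so $\|\boldsymbol{\nabla}\boldsymbol{u}\|_{L^{2}(\Omega)}\leq\|\mathbf{F}\|_{L^{2}(\Omega)}$.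
   Context: The stationary Navier--Stokes equations are $\Delta\boldsymbol{u}-\boldsymbol{\nabla}p=\boldsymbol{u}\cdot\boldsymbol{\nabla}\boldsymbol{u}+\boldsymbol{f}$, $\boldsymbol{\nabla}\cdot\boldsymbol{u}=0$, where $(\boldsymbol{u}\cdot\boldsymbol{\nabla}\boldsymbol{v})_i=\sum_j u_j\partial_j v_i$. For $\Omega=\mathbb{R}^2$: $\dot{H}^{1}(\Omega)$ is the linear space of vector fields $\{\boldsymbol{u}\in L^1_{\mathrm{loc}}(\Omega):\boldsymbol{\nabla}\boldsymbol{u}\in L^2(\Omega)\}$ with the semi-norm $\|\boldsymbol{u}\|_{\dot H^1(\Omega)}=\|\boldsymbol{\nabla}\boldsymbol{u}\|_{L^2(\Omega)}$; $\dot{H}^1_\sigma(\Omega)$ is its subspace of weakly divergence-free vector fields; $C_{0,\sigma}^{\infty}(\Omega)$ is the space of smooth divergence-free vector fields with compact support in $\Omega$. The bracket $\langle\cdot,\cdot\rangle_{L^2(\Omega)}$ denotes the integral over $\Omega$ of the pointwise Euclidean (or Frobenius) inner product. Definition (weak solution in $\Omega=\mathbb{R}^2$): given a rank-two tensor $\mathbf{F}\in L^2(\Omega)$, a vector field $\boldsymbol{u}:\Omega\to\mathbb{R}^2$ is a weak solution of the Navier--Stokes equations in $\Omega$ with $\boldsymbol{f}=\boldsymbol{\nabla}\cdot\mathbf{F}$ if $\boldsymbol{u}\in\dot{H}^1_\sigma(\Omega)$ and \[ \langle\boldsymbol{\nabla}\boldsymbol{u},\boldsymbol{\nabla}\boldsymbol{\varphi}\rangle_{L^{2}(\Omega)}+\langle\boldsymbol{u}\cdot\boldsymbol{\nabla}\boldsymbol{u},\boldsymbol{\varphi}\rangle_{L^{2}(\Omega)}=\langle\mathbf{F},\boldsymbol{\nabla}\boldsymbol{\varphi}\rangle_{L^{2}(\Omega)}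 \] for all $\boldsymbol{\varphi}\in C_{0,\sigma}^{\infty}(\Omega)$. *)

theory Defs
  imports "HOL-Analysis.Analysis"
begin

definition partial_deriv ::
    "'n::finite \<Rightarrow> (real^'n \<Rightarrow> 'b::real_normed_vector) \<Rightarrow> real^'n \<Rightarrow> 'b" where
  "partial_deriv j f x = frechet_derivative f (at x) (axis j 1)"

primrec Ck :: "nat \<Rightarrow> (real^'n::finite \<Rightarrow> 'b::real_normed_vector) \<Rightarrow> bool" where
  "Ck 0 f \<longleftrightarrow> continuous_on UNIV f"
| "Ck (Suc k) f \<longleftrightarrow> f differentiable_on UNIV \<and> (\<forall>j. Ck k (partial_deriv j f))"

definition test_functions :: "(real^'n::finite \<Rightarrow> 'b::real_normed_vector) set" where
  "test_functions = {\<phi>. (\<forall>k. Ck k \<phi>) \<and> compact (closure {x. \<phi> x \<noteq> 0})}"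

text \<open>Gradients of vector fields are Jacobian matrices, with entry \<open>\<partial>\<^sub>j v\<^sub>i\<close> in row \<open>i\<close> and
  column \<open>j\<close>. The inner product and norm of the type \<open>real^2^2\<close> are the Frobenius ones.\<close>

definition gradient :: "(real^2 \<Rightarrow> real^2) \<Rightarrow> real^2 \<Rightarrow> real^2^2" where
  "gradient v x = jacobian v (at x)"

definition divergence :: "(real^2 \<Rightarrow> real^2) \<Rightarrow> real^2 \<Rightarrow> real" where
  "divergence v x = trace (gradient v x)"

definition solenoidal_test_functions :: "(real^2 \<Rightarrow> real^2) set" where
  "solenoidal_test_functions = {\<phi> \<in> test_functions. \<forall>x. divergence \<phi> x = 0}"

definition locally_integrable :: "(real^2 \<Rightarrow> 'b::euclidean_space) \<Rightarrow> bool" where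
  "locally_integrable f \<longleftrightarrow> (\<forall>K. compact K \<longrightarrow> set_integrable lebesgue K f)"

definition L2 :: "(real^2 \<Rightarrow> 'b::euclidean_space) set" where
  "L2 = {f \<in> borel_measurable lebesgue. integrable lebesgue (\<lambda>x. (norm (f x))\<^sup>2)}"

definition L2_inner ::
    "(real^2 \<Rightarrow> 'b::euclidean_space) \<Rightarrow> (real^2 \<Rightarrow> 'b) \<Rightarrow> real" where
  "L2_inner f g = (LINT x|lebesgue. f x \<bullet> g x)"

definition L2_norm :: "(real^2 \<Rightarrow> 'b::euclidean_space) \<Rightarrow> real" where
  "L2_norm f = sqrt (LINT x|lebesgue. (norm (f x))\<^sup>2)"

definition has_weak_gradient :: "(real^2 \<Rightarrow> real^2) \<Rightarrow> (real^2 \<Rightarrow> real^2^2) \<Rightarrow> bool" where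
  "has_weak_gradient u G \<longleftrightarrow> locally_integrable u \<and> locally_integrable G \<and>
     (\<forall>\<phi>\<in>test_functions. \<forall>i j.
        (LINT x|lebesgue. u x $ i * partial_deriv j \<phi> x) = - (LINT x|lebesgue. G x $ i $ j * \<phi> x))"

text \<open>A weak gradient is determined only up to a null set; \<open>weak_gradient\<close> picks one representative.\<close>

definition weak_gradient :: "(real^2 \<Rightarrow> real^2) \<Rightarrow> real^2 \<Rightarrow> real^2^2" where
  "weak_gradient u = (SOME G. has_weak_gradient u G)"

definition H1_dot :: "(real^2 \<Rightarrow> real^2) set" where
  "H1_dot = {u. locally_integrable u \<and> (\<exists>G\<in>L2. has_weak_gradient u G)}"

definition weakly_divergence_free :: "(real^2 \<Rightarrow> real^2) \<Rightarrow> bool" where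
  "weakly_divergence_free u \<longleftrightarrow>
     (\<forall>\<phi>\<in>test_functions. (LINT x|lebesgue. (\<Sum>j\<in>UNIV. u x $ j * partial_deriv j \<phi> x)) = 0)"

definition H1_dot_sigma :: "(real^2 \<Rightarrow> real^2) set" where
  "H1_dot_sigma = {u \<in> H1_dot. weakly_divergence_free u}"

text \<open>The product \<open>\<nabla>u *v u\<close> has components \<open>\<Sum>\<^sub>j u\<^sub>j \<partial>\<^sub>j u\<^sub>i\<close>, that is, it is \<open>u \<cdot> \<nabla>u\<close>.\<close>

definition weak_solution :: "(real^2 \<Rightarrow> real^2^2) \<Rightarrow> (real^2 \<Rightarrow> real^2) \<Rightarrow> bool" where
  "weak_solution F u \<longleftrightarrow> u \<in> H1_dot_sigma \<and>
     (\<forall>\<phi>\<in>solenoidal_test_functions.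
        L2_inner (weak_gradient u) (gradient \<phi>) + L2_inner (\<lambda>x. weak_gradient u x *v u x) \<phi>
        = L2_inner F (gradient \<phi>))"

end

theory Submission
  imports Defs "HOL-Homology.Homology"
begin

text \<open>A Galerkin scheme on spans of finitely many solenoidal test functions, where the approximate
  velocity \<open>\<mu> + \<Sum>\<^sub>k c\<^sub>k (\<phi>\<^sub>k - m\<^sub>k)\<close> subtracts the averages \<open>m\<^sub>k\<close> of \<open>\<phi>\<^sub>k\<close> over \<open>\<omega>\<close>, so that its
  average is always \<open>\<mu>\<close>. Convection does not contribute to the energy balance, hence a zero of
  the coercive Galerkin map exists (spheres are not contractible) and its gradient is bounded in
  \<open>L\<^sup>2\<close> by \<open>F\<close>. Poincare inequalities on small squares show that velocities with bounded gradients
  are close in \<open>L\<^sup>2\<^sub>l\<^sub>o\<^sub>c\<close> as soon as finitely many of their averages over squares are close. Tychonoff's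
  theorem then yields limits of all these averages and of \<open>\<langle>F, \<nabla>w\<rangle>\<close> that can be approached by
  approximate solutions for any prescribed test function. Among the admissible fields whose
  averages approach these limits, those of nearly minimal gradient norm converge: the fields in
  \<open>L\<^sup>2\<^sub>l\<^sub>o\<^sub>c\<close> and, by the parallelogram identity, the gradients strongly in \<open>L\<^sup>2\<close>. Their limit is \<open>u\<close>; the
  equation, integrated by parts so that it involves no derivative of \<open>u\<close>, only needs the
  convergence in \<open>L\<^sup>2\<^sub>l\<^sub>o\<^sub>c\<close>.\<close>

section \<open>Zeros of coercive maps in finite dimension\<close>

text \<open>In the plane a square-integrable gradient gives no decay at infinity, and constants have
  zero seminorm; the average over \<omega> is the only handle on the constant. Hence approximate
  velocities are constant instead of zero near infinity, while the energy balance tests the equation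
  with their compactly supported part, which has the same gradient.

  The residual is quadratic in the velocity. Its smallness does not survive midpoints, so it cannot
  be imposed on the convex classes in which near-minimisers are taken, and the minimising sequence
  need not consist of approximate solutions. For each test function another sequence in the same
  classes has vanishing residuals. Both sequences converge on balls to the same field, and after
  integration by parts the limit of the residuals depends on that field alone, so it is 0 for the
  minimising sequence as well. There the gradients converge strongly, which brings back the form of
  the equation that contains the gradient of the limit.\<close>

lemma coercive_has_zero:
  fixes P :: "(nat \<Rightarrow> real) \<Rightarrow> nat \<Rightarrow> real"
  assumes cont: "\<And>i. i \<le> p \<Longrightarrow> continuous_on UNIV (\<lambda>c. P c i)" and "r > 0"
    and coercive: "\<And>c. (\<Sum>i\<le>p. (c i)\<^sup>2) = r\<^sup>2 \<Longrightarrow> (\<Sum>i\<le>p. P c i * c i) > 0"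
  shows "\<exists>c. \<forall>i\<le>p. P c i = 0"
proof (rule ccontr)
  assume "\<not> ?thesis"
  then have nz: "\<exists>i\<le>p. P c i \<noteq> 0" for c by blast
  define S where "S = {x::nat \<Rightarrow> real. (\<Sum>i\<le>p. x i ^ 2) = 1 \<and> (\<forall>i>p. x i = 0)}"
  have nsp: "nsphere p = top_of_set S"
    by (simp add: nsphere S_def euclidean_product_topology)
  define normalise where "normalise v = (\<lambda>i. if i \<le> p then v i / sqrt (\<Sum>j\<le>p. (v j)\<^sup>2) else 0)"
    for v :: "nat \<Rightarrow> real"
  have pos: "(\<Sum>j\<le>p. (v j)\<^sup>2) > 0" if "\<exists>i\<le>p. v i \<noteq> 0" for v :: "nat \<Rightarrow> real"
  proof -
    from that obtain i where "i \<le> p" "v i \<noteq> 0" by blast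
    then show ?thesis by (intro sum_pos2[where i = i]) auto
  qed
  have normalise_in: "normalise v \<in> S" if "\<exists>i\<le>p. v i \<noteq> 0" for v
  proof -
    have "(\<Sum>i\<le>p. (normalise v i)\<^sup>2) = (\<Sum>i\<le>p. (v i)\<^sup>2 / (\<Sum>j\<le>p. (v j)\<^sup>2))"
      using pos[OF that] by (intro sum.cong) (auto simp: normalise_def power_divide)
    also have "\<dots> = 1"
      using pos[OF that] by (simp flip: sum_divide_distrib)
    finally show ?thesis by (simp add: S_def normalise_def)
  qed
  have cont_normalise: "continuous_on A (\<lambda>x. normalise (v x))"
    if "\<And>i. i \<le> p \<Longrightarrow> continuous_on A (\<lambda>x. v x i)" and "\<And>x. x \<in> A \<Longrightarrow> \<exists>i\<le>p. v x i \<noteq> 0"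
    for v :: "'b::topological_space \<Rightarrow> nat \<Rightarrow> real" and A
  proof (intro continuous_on_coordinatewise_then_product)
    fix i
    show "continuous_on A (\<lambda>x. normalise (v x) i)"
    proof (cases "i \<le> p")
      case True
      have "continuous_on A (\<lambda>x. v x i / sqrt (\<Sum>j\<le>p. (v x j)\<^sup>2))"
      proof (intro continuous_intros that ballI)
        show "sqrt (\<Sum>j\<le>p. (v x j)\<^sup>2) \<noteq> 0" if "x \<in> A" for x
          using pos[of "v x"] \<open>\<And>x. x \<in> A \<Longrightarrow> \<exists>i\<le>p. v x i \<noteq> 0\<close>[OF that] by auto
      qed (use True in auto)
      then show ?thesis using True by (simp add: normalise_def)
    qed (simp add: normalise_def)
  qed
  have scale_cont: "continuous_on A (\<lambda>z. P (\<lambda>i. c z * x z i) j)"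
    if "j \<le> p" "continuous_on A c" "continuous_on A x"
    for A :: "'b::topological_space set" and c :: "'b \<Rightarrow> real" and x j
  proof (rule continuous_on_compose2[OF cont[OF that(1)]])
    have "continuous_on A (\<lambda>z. x z i)" for i
      by (rule continuous_on_product_then_coordinatewise[OF that(3)])
    then show "continuous_on A (\<lambda>z i. c z * x z i)"
      by (intro continuous_on_coordinatewise_then_product continuous_on_mult that(2))
  qed simp
  \<comment> \<open>If \<open>P\<close> had no zero, the normalised map \<open>f\<close> would be
    homotopic to a constant, by shrinking the radius to 0, and also to the identity of the
    sphere.\<close>
  define f where "f x = normalise (P (\<lambda>i. r * x i))" for x
  have "homotopic_with (\<lambda>_. True) (top_of_set S) (top_of_set S) (\<lambda>x. normalise (P (\<lambda>i. 0))) f"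
  proof (subst homotopic_with, simp, intro exI conjI ballI)
    let ?h = "\<lambda>(t, x). normalise (P (\<lambda>i. (t * r) * x i))"
    have "continuous_on ({0..1} \<times> S) ?h"
      unfolding case_prod_unfold
      by (intro cont_normalise scale_cont nz continuous_on_mult continuous_on_const continuous_on_fst
          continuous_on_snd continuous_on_id)
    then show "continuous_map (prod_topology (top_of_set {0..1}) (top_of_set S)) (top_of_set S) ?h"
      by (auto intro!: normalise_in nz)
  qed (auto simp: f_def)
  moreover have "homotopic_with (\<lambda>_. True) (top_of_set S) (top_of_set S) f id"
  proof (subst homotopic_with, simp, intro exI conjI ballI)
    let ?v = "\<lambda>t x i. (1 - t) * P (\<lambda>i. r * x i) i + t * x i"
    let ?h = "\<lambda>(t, x). normalise (?v t x)"
    \<comment> \<open>The inner product of a point of the segment with \<open>x\<close> is a convex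
      combination of a number that is positive by coercivity and of 1, so the segment avoids the
      origin.\<close>
    have v_nz: "\<exists>i\<le>p. ?v t x i \<noteq> 0" if "t \<in> {0..1}" "x \<in> S" for t x
    proof -
      have x: "(\<Sum>i\<le>p. (x i)\<^sup>2) = 1" using that by (simp add: S_def)
      then have "(\<Sum>i\<le>p. (r * x i)\<^sup>2) = r\<^sup>2"
        by (simp add: power_mult_distrib flip: sum_distrib_left)
      from coercive[OF this] have "0 < r * (\<Sum>i\<le>p. P (\<lambda>i. r * x i) i * x i)"
        by (simp add: sum_distrib_left mult_ac)
      then have *: "0 < (\<Sum>i\<le>p. P (\<lambda>i. r * x i) i * x i)"
        using \<open>r > 0\<close> by (simp add: zero_less_mult_iff)
      have "(\<Sum>i\<le>p. ?v t x i * x i) = (1 - t) * (\<Sum>i\<le>p. P (\<lambda>i. r * x i) i * x i) + t * (\<Sum>i\<le>p. (x i)\<^sup>2)"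
        by (simp add: sum_distrib_left algebra_simps sum.distrib power2_eq_square sum_subtractf)
      also have "\<dots> > 0"
      proof (cases "t = 0")
        case False
        then show ?thesis using that * x by (intro add_nonneg_pos) auto
      qed (use * in simp)
      finally have "(\<Sum>i\<le>p. ?v t x i * x i) \<noteq> 0" by simp
      then show ?thesis
        by (metis (no_types, lifting) atMost_iff mult_zero_left sum.neutral)
    qed
    have "continuous_on ({0..1} \<times> S) ?h"
      unfolding case_prod_unfold
    proof (rule cont_normalise)
      fix i assume "i \<le> p"
      have "continuous_on ({0..1} \<times> S) (\<lambda>z. snd z i)"
        by (rule continuous_on_product_then_coordinatewise) (rule continuous_on_snd[OF continuous_on_id])
      then show "continuous_on ({0..1} \<times> S) (\<lambda>z. ?v (fst z) (snd z) i)"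
        using \<open>i \<le> p\<close>
        by (intro continuous_on_add continuous_on_mult continuous_on_diff continuous_on_const
            continuous_on_fst scale_cont continuous_on_snd continuous_on_id)
    qed (use v_nz in auto)
    then show "continuous_map (prod_topology (top_of_set {0..1}) (top_of_set S)) (top_of_set S) ?h"
      by (auto intro!: normalise_in v_nz)
    show "?h (1, x) = id x" if "x \<in> topspace (top_of_set S)" for x
      using that by (auto simp: normalise_def S_def)
  qed (auto simp: f_def)
  ultimately have "contractible S"
    unfolding contractible_def using homotopic_with_symD homotopic_with_trans by blast
  then show False
    using non_contractible_space_nsphere[of p] by (simp add: nsp)
qed

section \<open>Square-integrable functions\<close>

definition square_integrable :: "'a measure \<Rightarrow> ('a \<Rightarrow> 'b::euclidean_space) \<Rightarrow> bool" where
  "square_integrable M f \<longleftrightarrow> f \<in> borel_measurable M \<and> integrable M (\<lambda>x. (norm (f x))\<^sup>2)"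

lemma square_integrableD:
  "square_integrable M f \<Longrightarrow> f \<in> borel_measurable M"
  "square_integrable M f \<Longrightarrow> integrable M (\<lambda>x. (norm (f x))\<^sup>2)"
  by (simp_all add: square_integrable_def)

lemma norm_add_square_le: "(norm (a + b :: 'a::real_normed_vector))\<^sup>2 \<le> 2 * (norm a)\<^sup>2 + 2 * (norm b)\<^sup>2"
proof -
  have "(norm (a + b))\<^sup>2 \<le> (norm a + norm b)\<^sup>2" by (intro power_mono norm_triangle_ineq) simp
  also have "\<dots> \<le> 2 * (norm a)\<^sup>2 + 2 * (norm b)\<^sup>2" using sum_squares_bound[of "norm a" "norm b"]
    by (simp add: power2_sum)
  finally show ?thesis .
qed

lemma square_integrable_bound:
  assumes "square_integrable M f" "g \<in> borel_measurable M" "\<And>x. norm (g x) \<le> K * norm (f x)"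
  shows "square_integrable M g"
  unfolding square_integrable_def
proof (intro conjI Bochner_Integration.integrable_bound[where f = "\<lambda>x. K\<^sup>2 * (norm (f x))\<^sup>2" and g = "\<lambda>x. (norm (g x))\<^sup>2"])
  show "AE x in M. norm ((norm (g x))\<^sup>2) \<le> norm (K\<^sup>2 * (norm (f x))\<^sup>2)"
    using power_mono[OF assms(3) norm_ge_zero, where n = 2] by (simp add: power_mult_distrib)
qed (use assms in \<open>auto simp: square_integrable_def\<close>)

lemma square_integrable_scaleR: "square_integrable M f \<Longrightarrow> square_integrable M (\<lambda>x. c *\<^sub>R f x)"
  by (rule square_integrable_bound[where K = "\<bar>c\<bar>"]) (auto simp: square_integrable_def)

lemma square_integrable_add:
  assumes "square_integrable M f" "square_integrable M g"
  shows "square_integrable M (\<lambda>x. f x + g x)"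
  unfolding square_integrable_def
proof (intro conjI Bochner_Integration.integrable_bound[where f = "\<lambda>x. 2 * (norm (f x))\<^sup>2 + 2 * (norm (g x))\<^sup>2"
      and g = "\<lambda>x. (norm (f x + g x))\<^sup>2"])
  show "AE x in M. norm ((norm (f x + g x))\<^sup>2) \<le> norm (2 * (norm (f x))\<^sup>2 + 2 * (norm (g x))\<^sup>2)"
    by (intro AE_I2) (simp add: norm_add_square_le)
qed (use assms in \<open>auto simp: square_integrable_def\<close>)

lemma square_integrable_diff:
  assumes "square_integrable M f" "square_integrable M g"
  shows "square_integrable M (\<lambda>x. f x - g x)"
  using square_integrable_add[OF assms(1) square_integrable_scaleR[OF assms(2), of "-1"]] by simp

lemma integrable_inner_square_integrable:
  assumes "square_integrable M f" "square_integrable M g"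
  shows "integrable M (\<lambda>x. f x \<bullet> g x)"
proof (rule Bochner_Integration.integrable_bound[where f = "\<lambda>x. (norm (f x))\<^sup>2 + (norm (g x))\<^sup>2"])
  show "AE x in M. norm (f x \<bullet> g x) \<le> norm ((norm (f x))\<^sup>2 + (norm (g x))\<^sup>2)"
  proof (rule AE_I2)
    fix x
    have "\<bar>f x \<bullet> g x\<bar> \<le> norm (f x) * norm (g x)" by (rule Cauchy_Schwarz_ineq2)
    also have "\<dots> \<le> (norm (f x))\<^sup>2 + (norm (g x))\<^sup>2"
    proof -
      have "0 \<le> norm (f x) * norm (g x)" by simp
      then show ?thesis using sum_squares_bound[of "norm (f x)" "norm (g x)"] by linarith
    qed
    finally show "norm (f x \<bullet> g x) \<le> norm ((norm (f x))\<^sup>2 + (norm (g x))\<^sup>2)" by simp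
  qed
qed (use assms in \<open>auto simp: square_integrable_def\<close>)

lemma integral_norm_add_square:
  assumes "square_integrable M f" "square_integrable M g"
  shows "(LINT x|M. (norm (f x + g x))\<^sup>2)
    = (LINT x|M. (norm (f x))\<^sup>2) + 2 * (LINT x|M. f x \<bullet> g x) + (LINT x|M. (norm (g x))\<^sup>2)"
proof -
  have "(LINT x|M. (norm (f x + g x))\<^sup>2) = (LINT x|M. ((norm (f x))\<^sup>2 + 2 * (f x \<bullet> g x)) + (norm (g x))\<^sup>2)"
    by (simp add: power2_norm_eq_inner inner_add inner_commute algebra_simps)
  then show ?thesis
    by (simp add: assms[THEN square_integrableD(2)] integrable_inner_square_integrable[OF assms])
qed

lemma integral_norm_diff_square:
  assumes "square_integrable M f" "square_integrable M g"
  shows "(LINT x|M. (norm (f x - g x))\<^sup>2)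
    = (LINT x|M. (norm (f x))\<^sup>2) - 2 * (LINT x|M. f x \<bullet> g x) + (LINT x|M. (norm (g x))\<^sup>2)"
  using integral_norm_add_square[OF assms(1) square_integrable_scaleR[OF assms(2), of "-1"]] by simp

lemma integral_norm_square_nonneg: "0 \<le> (LINT x|M. (norm (f x))\<^sup>2)"
  by (rule Bochner_Integration.integral_nonneg) simp

text \<open>The squared norm of \<open>f - t g\<close> is a nonnegative quadratic polynomial in
  \<open>t\<close>; evaluate it at its minimiser \<open>t = B / C\<close>.\<close>

lemma Cauchy_Schwarz_integral_inner:
  assumes f: "square_integrable M f" and g: "square_integrable M g"
  shows "\<bar>LINT x|M. f x \<bullet> g x\<bar> \<le> sqrt (LINT x|M. (norm (f x))\<^sup>2) * sqrt (LINT x|M. (norm (g x))\<^sup>2)"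
proof -
  define A B C where "A = (LINT x|M. (norm (f x))\<^sup>2)" and "B = (LINT x|M. f x \<bullet> g x)"
    and "C = (LINT x|M. (norm (g x))\<^sup>2)"
  have A0: "A \<ge> 0" and C0: "C \<ge> 0" by (simp_all add: A_def C_def integral_norm_square_nonneg)
  have quad: "0 \<le> A - 2 * t * B + t\<^sup>2 * C" for t
  proof -
    have "0 \<le> (LINT x|M. (norm (f x - t *\<^sub>R g x))\<^sup>2)" by (rule integral_norm_square_nonneg)
    also have "\<dots> = A - 2 * t * B + t\<^sup>2 * C"
      using integral_norm_diff_square[OF f square_integrable_scaleR[OF g, of t]]
      by (simp add: A_def B_def C_def power_mult_distrib)
    finally show ?thesis .
  qed
  have "B\<^sup>2 \<le> A * C"
  proof (cases "C = 0")
    case True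
    have "B = 0"
    proof (rule ccontr)
      assume "B \<noteq> 0"
      \<comment> \<open>For \<open>C = 0\<close> the polynomial is affine, and this \<open>t\<close>
        would give it the value -1.\<close>
      then show False using quad[of "(A + 1) / (2 * B)"] True by (simp add: field_simps)
    qed
    then show ?thesis using A0 C0 by simp
  next
    case False
    then have "C > 0" using C0 by simp
    have "0 \<le> (A - 2 * (B / C) * B + (B / C)\<^sup>2 * C) * C" by (intro mult_nonneg_nonneg quad C0)
    also have "\<dots> = A * C - B\<^sup>2" using \<open>C > 0\<close> by (simp add: field_simps power2_eq_square)
    finally show ?thesis by simp
  qed
  then have "sqrt (B\<^sup>2) \<le> sqrt (A * C)" by (rule real_sqrt_le_mono)
  then show ?thesis by (simp add: A_def B_def C_def real_sqrt_mult)
qed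

text \<open>Square integrability is built in because the Bochner integral of a non-integrable
  function is 0, which would otherwise count as convergence.\<close>

definition L2_tendsto :: "'a measure \<Rightarrow> (nat \<Rightarrow> 'a \<Rightarrow> 'b::euclidean_space) \<Rightarrow> ('a \<Rightarrow> 'b) \<Rightarrow> bool" where
  "L2_tendsto M f l \<longleftrightarrow> (\<forall>n. square_integrable M (f n)) \<and> square_integrable M l \<and>
     (\<lambda>n. LINT x|M. (norm (f n x - l x))\<^sup>2) \<longlonglongrightarrow> 0"

lemma L2_tendstoD:
  "L2_tendsto M f l \<Longrightarrow> square_integrable M (f n)" "L2_tendsto M f l \<Longrightarrow> square_integrable M l"
  by (simp_all add: L2_tendsto_def)

lemma L2_tendsto_const: "square_integrable M f \<Longrightarrow> L2_tendsto M (\<lambda>n. f) f"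
  by (simp add: L2_tendsto_def)

text \<open>Carries convergence over to images under maps that are Lipschitz at each point with a
  common constant, such as products with a bounded matrix field.\<close>

lemma L2_tendsto_norm_bounded:
  assumes f: "L2_tendsto M f l" and "\<And>n. h n \<in> borel_measurable M" "k \<in> borel_measurable M"
    and bound: "\<And>n x. norm (h n x - k x) \<le> K * norm (f n x - l x)" "\<And>x. norm (k x) \<le> K * norm (l x)"
  shows "L2_tendsto M h k"
proof -
  have k: "square_integrable M k"
    using assms by (intro square_integrable_bound[OF L2_tendstoD(2)[OF f]])
  have d: "square_integrable M (\<lambda>x. f n x - l x)" for n
    using L2_tendstoD[OF f] by (intro square_integrable_diff)
  have hd: "square_integrable M (\<lambda>x. h n x - k x)" for n
    using assms by (intro square_integrable_bound[OF d, where K = K]) auto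
  have h: "square_integrable M (h n)" for n
    using square_integrable_add[OF hd k, of n] by simp
  have le: "(LINT x|M. (norm (h n x - k x))\<^sup>2) \<le> K\<^sup>2 * (LINT x|M. (norm (f n x - l x))\<^sup>2)" for n
  proof -
    have "(LINT x|M. (norm (h n x - k x))\<^sup>2) \<le> (LINT x|M. K\<^sup>2 * (norm (f n x - l x))\<^sup>2)"
      using power_mono[OF bound(1) norm_ge_zero, where n = 2]
      by (intro integral_mono square_integrableD hd integrable_mult_right d) (simp add: power_mult_distrib)
    then show ?thesis by simp
  qed
  have "(\<lambda>n. K\<^sup>2 * (LINT x|M. (norm (f n x - l x))\<^sup>2)) \<longlonglongrightarrow> 0"
    using f by (intro tendsto_mult_right_zero) (simp add: L2_tendsto_def)
  then have "(\<lambda>n. LINT x|M. (norm (h n x - k x))\<^sup>2) \<longlonglongrightarrow> 0"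
    by (rule Lim_null_comparison[rotated]) (simp add: integral_norm_square_nonneg le)
  then show ?thesis using h k by (simp add: L2_tendsto_def)
qed

text \<open>Expand the square of \<open>(f n - l) + l\<close>; the mixed term tends to 0 by
  Cauchy-Schwarz.\<close>

lemma L2_tendsto_integral_norm:
  assumes f: "L2_tendsto M f l"
  shows "(\<lambda>n. LINT x|M. (norm (f n x))\<^sup>2) \<longlonglongrightarrow> (LINT x|M. (norm (l x))\<^sup>2)"
proof -
  note sq = L2_tendstoD[OF f]
  define e where "e n = (LINT x|M. (norm (f n x - l x))\<^sup>2)" for n
  have e: "e \<longlonglongrightarrow> 0" using f unfolding L2_tendsto_def e_def by blast
  have "(\<lambda>n. LINT x|M. (f n x - l x) \<bullet> l x) \<longlonglongrightarrow> 0"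
  proof (rule Lim_null_comparison)
    show "\<forall>\<^sub>F n in sequentially. norm (LINT x|M. (f n x - l x) \<bullet> l x) \<le> sqrt (e n) * sqrt (LINT x|M. (norm (l x))\<^sup>2)"
      using Cauchy_Schwarz_integral_inner[OF square_integrable_diff[OF sq] sq(2)] by (simp add: e_def)
    show "(\<lambda>n. sqrt (e n) * sqrt (LINT x|M. (norm (l x))\<^sup>2)) \<longlonglongrightarrow> 0"
      using tendsto_real_sqrt[OF e] by (intro tendsto_mult_left_zero) simp
  qed
  then have "(\<lambda>n. e n + 2 * (LINT x|M. (f n x - l x) \<bullet> l x) + (LINT x|M. (norm (l x))\<^sup>2))
      \<longlonglongrightarrow> 0 + 2 * 0 + (LINT x|M. (norm (l x))\<^sup>2)"
    by (intro tendsto_intros e)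
  moreover have "(LINT x|M. (norm (f n x))\<^sup>2)
      = e n + 2 * (LINT x|M. (f n x - l x) \<bullet> l x) + (LINT x|M. (norm (l x))\<^sup>2)" for n
    using integral_norm_add_square[OF square_integrable_diff[OF sq] sq(2), of n] by (simp add: e_def)
  ultimately show ?thesis by simp
qed

lemma L2_tendsto_add:
  assumes f: "L2_tendsto M f l" and g: "L2_tendsto M g k"
  shows "L2_tendsto M (\<lambda>n x. f n x + g n x) (\<lambda>x. l x + k x)"
proof -
  note sq = L2_tendstoD[OF f] L2_tendstoD[OF g]
  have le: "(LINT x|M. (norm ((f n x + g n x) - (l x + k x)))\<^sup>2)
      \<le> 2 * (LINT x|M. (norm (f n x - l x))\<^sup>2) + 2 * (LINT x|M. (norm (g n x - k x))\<^sup>2)" for n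
  proof -
    have d: "square_integrable M (\<lambda>x. f n x - l x)" "square_integrable M (\<lambda>x. g n x - k x)"
      using sq by (auto intro: square_integrable_diff)
    have i: "integrable M (\<lambda>x. (norm (f n x - l x))\<^sup>2)" "integrable M (\<lambda>x. (norm (g n x - k x))\<^sup>2)"
      "integrable M (\<lambda>x. (norm ((f n x - l x) + (g n x - k x)))\<^sup>2)"
      by (intro square_integrableD(2) d square_integrable_add)+
    have "(LINT x|M. (norm ((f n x + g n x) - (l x + k x)))\<^sup>2)
        \<le> (LINT x|M. 2 * (norm (f n x - l x))\<^sup>2 + 2 * (norm (g n x - k x))\<^sup>2)"
      unfolding add_diff_add
      by (intro integral_mono norm_add_square_le Bochner_Integration.integrable_add integrable_mult_right i)
    also have "\<dots> = 2 * (LINT x|M. (norm (f n x - l x))\<^sup>2) + 2 * (LINT x|M. (norm (g n x - k x))\<^sup>2)"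
      by (simp add: i)
    finally show ?thesis .
  qed
  have "(\<lambda>n. 2 * (LINT x|M. (norm (f n x - l x))\<^sup>2) + 2 * (LINT x|M. (norm (g n x - k x))\<^sup>2)) \<longlonglongrightarrow> 0"
    using f g by (intro tendsto_add_zero tendsto_mult_right_zero) (simp_all add: L2_tendsto_def)
  then have "(\<lambda>n. LINT x|M. (norm ((f n x + g n x) - (l x + k x)))\<^sup>2) \<longlonglongrightarrow> 0"
    by (rule Lim_null_comparison[rotated]) (simp add: integral_norm_square_nonneg le)
  then show ?thesis using sq by (simp add: L2_tendsto_def square_integrable_add)
qed

text \<open>Polarisation reduces inner products to the squared norms of both sequences and of their
  sum.\<close>

lemma L2_tendsto_integral_inner:
  assumes f: "L2_tendsto M f l" and g: "L2_tendsto M g k"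
  shows "(\<lambda>n. LINT x|M. f n x \<bullet> g n x) \<longlonglongrightarrow> (LINT x|M. l x \<bullet> k x)"
proof -
  note sq = L2_tendstoD[OF f] L2_tendstoD[OF g]
  have "(\<lambda>n. ((LINT x|M. (norm (f n x + g n x))\<^sup>2) - (LINT x|M. (norm (f n x))\<^sup>2) - (LINT x|M. (norm (g n x))\<^sup>2)) / 2)
    \<longlonglongrightarrow> ((LINT x|M. (norm (l x + k x))\<^sup>2) - (LINT x|M. (norm (l x))\<^sup>2) - (LINT x|M. (norm (k x))\<^sup>2)) / 2"
    by (intro tendsto_intros L2_tendsto_integral_norm[OF f] L2_tendsto_integral_norm[OF g]
        L2_tendsto_integral_norm[OF L2_tendsto_add[OF f g]]) simp
  then show ?thesis by (simp add: integral_norm_add_square sq)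
qed

text \<open>A local version of the Riesz-Fischer argument. On a set of finite measure small
  \<open>L2\<close> increments are small in \<open>L1\<close>, so along a fast subsequence the
  increments are almost everywhere summable; one subsequence serves all the countably many
  sets.\<close>

lemma L2_cauchy_imp_AE_convergent_subsequence:
  fixes f :: "nat \<Rightarrow> 'a \<Rightarrow> 'b::euclidean_space"
  assumes f[measurable]: "\<And>n. f n \<in> borel_measurable M" and A[measurable]: "\<And>k. A k \<in> sets M"
    and fin: "\<And>k. emeasure M (A k) < \<infinity>" and cover: "(\<Union>k::nat. A k) = space M"
    and cauchy: "\<And>k e. e > 0 \<Longrightarrow> \<exists>n0. \<forall>m\<ge>n0. \<forall>n\<ge>n0.
        (\<integral>\<^sup>+x. indicator (A k) x * ennreal ((norm (f m x - f n x))\<^sup>2) \<partial>M) \<le> ennreal e"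
  obtains r u where "strict_mono r" "u \<in> borel_measurable M" "AE x in M. (\<lambda>k. f (r k) x) \<longlonglongrightarrow> u x"
proof -
  \<comment> \<open>Stage \<open>k\<close> treats the sets up to index \<open>k\<close> together, so
    that a single subsequence is fast on every set from some stage on.\<close>
  have "\<exists>n0. \<forall>j\<le>k. \<forall>m\<ge>n0. \<forall>n\<ge>n0.
      (\<integral>\<^sup>+x. indicator (A j) x * ennreal ((norm (f m x - f n x))\<^sup>2) \<partial>M) \<le> ennreal ((1/4) ^ k)" for k
  proof -
    have "\<forall>j. \<exists>n0. \<forall>m\<ge>n0. \<forall>n\<ge>n0.
      (\<integral>\<^sup>+x. indicator (A j) x * ennreal ((norm (f m x - f n x))\<^sup>2) \<partial>M) \<le> ennreal ((1/4) ^ k)"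
      by (intro allI cauchy) simp
    from choice[OF this] obtain N where N: "\<forall>m\<ge>N j. \<forall>n\<ge>N j.
      (\<integral>\<^sup>+x. indicator (A j) x * ennreal ((norm (f m x - f n x))\<^sup>2) \<partial>M) \<le> ennreal ((1/4) ^ k)" for j
      by blast
    have "N j \<le> Max (N ` {..k})" if "j \<le> k" for j using that by simp
    then show ?thesis using N by (intro exI[of _ "Max (N ` {..k})"] allI impI) (meson order_trans)
  qed
  then have "\<forall>k. \<exists>n0. \<forall>j\<le>k. \<forall>m\<ge>n0. \<forall>n\<ge>n0.
      (\<integral>\<^sup>+x. indicator (A j) x * ennreal ((norm (f m x - f n x))\<^sup>2) \<partial>M) \<le> ennreal ((1/4) ^ k)"
    by blast
  from choice[OF this] obtain N where N: "\<And>k j m n. j \<le> k \<Longrightarrow> m \<ge> N k \<Longrightarrow> n \<ge> N k \<Longrightarrow>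
      (\<integral>\<^sup>+x. indicator (A j) x * ennreal ((norm (f m x - f n x))\<^sup>2) \<partial>M) \<le> ennreal ((1/4) ^ k)"
    by blast
  \<comment> \<open>Adding up all earlier thresholds makes \<open>r\<close> strictly increasing and
    keeps it above \<open>N k\<close>.\<close>
  define r where "r k = k + (\<Sum>i\<le>k. N i)" for k
  have r: "strict_mono r" by (rule strict_monoI_Suc) (simp add: r_def)
  have rN: "N k \<le> r k" for k
    unfolding r_def by (simp add: member_le_sum trans_le_add2)
  have rN': "N k \<le> r (Suc k)" for k
    using rN[of k] strict_monoD[OF r, of k "Suc k"] by simp
  define d where "d k x = norm (f (r (Suc k)) x - f (r k) x)" for k x
  have [measurable]: "d k \<in> borel_measurable M" for k unfolding d_def by measurable
  have "AE x in M. x \<in> A j \<longrightarrow> summable (\<lambda>k. d k x)" for j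
  proof -
    \<comment> \<open>The shift by \<open>j\<close> is due to the choice of \<open>N\<close>, which
      controls \<open>A j\<close> only from stage \<open>j\<close> on.\<close>
    have le: "(\<integral>\<^sup>+x. indicator (A j) x * ennreal (d (k + j) x) \<partial>M) \<le> ennreal ((1/2)^k) * (1 + emeasure M (A j))" for k
    proof -
      let ?k = "k + j"
      \<comment> \<open>Young's inequality with weight \<open>2^?k\<close>: the squared increment
        has integral at most \<open>(1/4)^?k\<close>, so both terms are of order
        \<open>(1/2)^?k\<close>.\<close>
      have "ennreal (d ?k x) \<le> ennreal (2^?k) * ennreal ((d ?k x)\<^sup>2) + ennreal ((1/2)^?k)" for x
      proof -
        have "0 \<le> (2^?k * d ?k x - 1)\<^sup>2" by simp
        then have "2 * (2^?k * d ?k x) \<le> (2^?k * d ?k x)\<^sup>2 + 1" by (simp add: power2_diff)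
        moreover have "0 \<le> 2^?k * d ?k x" by (simp add: d_def)
        ultimately have "2^?k * d ?k x \<le> (2^?k * d ?k x)\<^sup>2 + 1" by linarith
        then have "(1/2)^?k * (2^?k * d ?k x) \<le> (1/2)^?k * ((2^?k * d ?k x)\<^sup>2 + 1)"
          by (rule mult_left_mono) simp
        moreover have "i * (c * D) = (i * c) * D" "i * ((c * D)\<^sup>2 + 1) = (i * c) * (c * D\<^sup>2) + i" for i c D :: real
          by (simp_all add: power2_eq_square algebra_simps)
        moreover have "(1/2)^?k * 2^?k = (1::real)" by (simp flip: power_mult_distrib)
        ultimately have "d ?k x \<le> 2^?k * (d ?k x)\<^sup>2 + (1/2)^?k"
          by (simp only: mult_1)
        then have "ennreal (d ?k x) \<le> ennreal (2^?k * (d ?k x)\<^sup>2 + (1/2)^?k)" by (rule ennreal_leI)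
        then show ?thesis by (simp add: ennreal_plus ennreal_mult)
      qed
      then have "(\<integral>\<^sup>+x. indicator (A j) x * ennreal (d ?k x) \<partial>M)
          \<le> (\<integral>\<^sup>+x. ennreal (2^?k) * (indicator (A j) x * ennreal ((d ?k x)\<^sup>2)) + ennreal ((1/2)^?k) * indicator (A j) x \<partial>M)"
        by (intro nn_integral_mono) (auto simp: indicator_def)
      also have "\<dots> = ennreal (2^?k) * (\<integral>\<^sup>+x. indicator (A j) x * ennreal ((d ?k x)\<^sup>2) \<partial>M) + ennreal ((1/2)^?k) * emeasure M (A j)"
        by (simp add: nn_integral_add nn_integral_cmult)
      also have "\<dots> \<le> ennreal (2^?k) * ennreal ((1/4)^?k) + ennreal ((1/2)^?k) * emeasure M (A j)"
        unfolding d_def by (intro add_mono mult_left_mono N rN rN' order_refl) auto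
      also have "ennreal (2^?k) * ennreal ((1/4)^?k) = ennreal ((1/2)^?k)"
        by (simp flip: ennreal_mult' power_mult_distrib)
      also have "ennreal ((1/2)^?k) + ennreal ((1/2)^?k) * emeasure M (A j) = ennreal ((1/2)^?k) * (1 + emeasure M (A j))"
        by (simp add: distrib_left)
      also have "\<dots> \<le> ennreal ((1/2)^k) * (1 + emeasure M (A j))"
        by (intro mult_right_mono ennreal_leI power_decreasing) auto
      finally show ?thesis .
    qed
    have "(\<integral>\<^sup>+x. suminf (\<lambda>k. indicator (A j) x * ennreal (d (k + j) x)) \<partial>M)
        = suminf (\<lambda>k. \<integral>\<^sup>+x. indicator (A j) x * ennreal (d (k + j) x) \<partial>M)"
      by (rule nn_integral_suminf) measurable
    also have "\<dots> \<le> suminf (\<lambda>k. ennreal ((1/2)^k) * (1 + emeasure M (A j)))"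
      by (intro suminf_le le) auto
    also have "\<dots> = suminf (\<lambda>k. ennreal ((1/2)^k)) * (1 + emeasure M (A j))" by simp
    also have "\<dots> < \<infinity>"
    proof -
      have "suminf (\<lambda>k. ennreal ((1/2)^k)) \<noteq> top_class.top"
        by (rule ennreal_suminf_neq_top) (simp_all add: summable_geometric)
      then have "suminf (\<lambda>k. ennreal ((1/2)^k)) < top_class.top" unfolding less_top .
      moreover have "1 + emeasure M (A j) < top_class.top"
        using fin[of j] by (simp add: ennreal_add_less_top)
      ultimately show ?thesis unfolding ennreal_mult_less_top infinity_ennreal_def by blast
    qed
    finally have "AE x in M. suminf (\<lambda>k. indicator (A j) x * ennreal (d (k + j) x)) \<noteq> \<infinity>"
      by (intro nn_integral_PInf_AE) auto
    then show ?thesis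
    proof eventually_elim
      case (elim x)
      show ?case
      proof
        assume "x \<in> A j"
        then have "suminf (\<lambda>k. ennreal (d (k + j) x)) \<noteq> top_class.top" using elim by simp
        then have "summable (\<lambda>k. d (k + j) x)" by (intro summable_suminf_not_top) (auto simp: d_def)
        then show "summable (\<lambda>k. d k x)" by (rule summable_iff_shift[where f = "\<lambda>k. d k x", THEN iffD1])
      qed
    qed
  qed
  then have "AE x in M. \<forall>j. x \<in> A j \<longrightarrow> summable (\<lambda>k. d k x)"
    by (rule AE_all_countable[THEN iffD2, OF allI])
  then have "AE x in M. (\<lambda>k. f (r k) x) \<longlonglongrightarrow> lim (\<lambda>k. f (r k) x)"
  proof (rule AE_mp[OF _ AE_I2], intro impI)
    fix x assume "x \<in> space M" "\<forall>j. x \<in> A j \<longrightarrow> summable (\<lambda>k. d k x)"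
    then have "summable (\<lambda>k. d k x)" using cover by blast
    then have "summable (\<lambda>k. f (r (Suc k)) x - f (r k) x)"
      unfolding d_def by (rule summable_norm_cancel)
    then have "convergent (\<lambda>n. (\<Sum>k<n. f (r (Suc k)) x - f (r k) x) + f (r 0) x)"
      unfolding summable_iff_convergent by (intro convergent_add convergent_const)
    then have "convergent (\<lambda>n. f (r n) x)"
      by (simp add: sum_lessThan_telescope[of "\<lambda>k. f (r k) x"])
    then show "(\<lambda>k. f (r k) x) \<longlonglongrightarrow> lim (\<lambda>k. f (r k) x)" by (simp add: convergent_LIMSEQ_iff)
  qed
  moreover have "(\<lambda>x. lim (\<lambda>k. f (r k) x)) \<in> borel_measurable M" by measurable
  ultimately show ?thesis using that r by blast
qed

text \<open>Fatou's lemma along the subsequence turns a Cauchy bound into a bound on the distance to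
  the limit. The nonnegative integral makes sense before \<open>u\<close> is known to be
  square-integrable.\<close>

lemma nn_integral_diff_square_le_limit:
  fixes f :: "nat \<Rightarrow> 'a \<Rightarrow> 'b::euclidean_space"
  assumes [measurable]: "\<And>n. f n \<in> borel_measurable M" "g \<in> borel_measurable M" "B \<in> sets M"
    and r: "strict_mono r" and lim: "AE x in M. (\<lambda>k. f (r k) x) \<longlonglongrightarrow> u x"
    and bound: "\<And>m. m \<ge> n0 \<Longrightarrow> (\<integral>\<^sup>+x. indicator B x * ennreal ((norm (g x - f m x))\<^sup>2) \<partial>M) \<le> e"
  shows "(\<integral>\<^sup>+x. indicator B x * ennreal ((norm (g x - u x))\<^sup>2) \<partial>M) \<le> e"
proof -
  let ?v = "\<lambda>k x. indicator B x * ennreal ((norm (g x - f (r k) x))\<^sup>2)"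
  have "AE x in M. indicator B x * ennreal ((norm (g x - u x))\<^sup>2) = liminf (\<lambda>k. ?v k x)"
    using lim
  proof eventually_elim
    case (elim x)
    have "(\<lambda>k. ennreal ((norm (g x - f (r k) x))\<^sup>2)) \<longlonglongrightarrow> ennreal ((norm (g x - u x))\<^sup>2)"
      by (intro tendsto_ennrealI tendsto_intros elim)
    then have "(\<lambda>k. ?v k x) \<longlonglongrightarrow> indicator B x * ennreal ((norm (g x - u x))\<^sup>2)"
      by (cases "x \<in> B") auto
    then show ?case by (intro lim_imp_Liminf[symmetric]) auto
  qed
  then have "(\<integral>\<^sup>+x. indicator B x * ennreal ((norm (g x - u x))\<^sup>2) \<partial>M) = (\<integral>\<^sup>+x. liminf (\<lambda>k. ?v k x) \<partial>M)"
    by (rule nn_integral_cong_AE)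
  also have "\<dots> \<le> liminf (\<lambda>k. \<integral>\<^sup>+x. ?v k x \<partial>M)"
    by (rule nn_integral_liminf) measurable
  also have "\<dots> \<le> e"
  proof (rule Liminf_le)
    show "\<forall>\<^sub>F k in sequentially. (\<integral>\<^sup>+x. ?v k x \<partial>M) \<le> e"
      using bound seq_suble[OF r] by (intro eventually_sequentiallyI[of n0]) (meson order_trans)
  qed simp
  finally show ?thesis .
qed

text \<open>Near-minimisers of the norm in a decreasing sequence of midpoint-convex sets form a Cauchy
  sequence by the parallelogram identity; this replaces weak compactness.\<close>

lemma L2_cauchy_in_decreasing_convex_sets:
  fixes g :: "'w \<Rightarrow> 'a \<Rightarrow> 'b::euclidean_space" and K :: "nat \<Rightarrow> 'w set"
  assumes ne: "\<And>n. K n \<noteq> {}" and dec: "\<And>n. K (Suc n) \<subseteq> K n"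
    and sq: "\<And>w. w \<in> K 0 \<Longrightarrow> square_integrable M (g w)"
    and bound: "\<And>w. w \<in> K 0 \<Longrightarrow> (LINT x|M. (norm (g w x))\<^sup>2) \<le> C"
    and mid: "\<And>n v w. v \<in> K n \<Longrightarrow> w \<in> K n \<Longrightarrow> \<exists>z\<in>K n. \<forall>x. g z x = (1/2) *\<^sub>R (g v x + g w x)"
  obtains w where "\<And>n. w n \<in> K n"
    "\<And>e. e > 0 \<Longrightarrow> \<exists>n0. \<forall>m\<ge>n0. \<forall>n\<ge>n0. (LINT x|M. (norm (g (w m) x - g (w n) x))\<^sup>2) \<le> e"
proof -
  define N where "N w = (LINT x|M. (norm (g w x))\<^sup>2)" for w
  define d where "d n = Inf (N ` K n)" for n
  have N0: "0 \<le> N w" for w by (simp add: N_def integral_norm_square_nonneg)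
  have bdd: "bdd_below (N ` K n)" for n using N0 by (auto intro: bdd_belowI[of _ 0])
  have decr: "K n \<subseteq> K m" if "m \<le> n" for m n using lift_Suc_antimono_le[of K, OF dec that] .
  have d_le: "d n \<le> N w" if "w \<in> K n" for n w unfolding d_def by (intro cInf_lower bdd imageI that)
  have d_mono: "d m \<le> d n" if "m \<le> n" for m n
    unfolding d_def using ne decr[OF that] bdd by (intro cInf_superset_mono) auto
  have "d n \<le> C" for n
  proof -
    obtain w where "w \<in> K n" using ne by blast
    then show ?thesis using d_le[of w n] bound[of w] decr[of 0 n] by (auto simp: N_def)
  qed
  \<comment> \<open>The infima grow as the sets shrink and stay below \<open>C\<close>, hence they
    converge.\<close>
  moreover have "incseq d" by (simp add: incseq_def d_mono)
  ultimately obtain L where "d \<longlonglongrightarrow> L" using incseq_convergent[of d C] by blast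
  then have "Cauchy d" by (rule LIMSEQ_imp_Cauchy)
  have "\<exists>w\<in>K n. N w < d n + 1 / real (Suc n)" for n
  proof -
    have "Inf (N ` K n) < d n + 1 / real (Suc n)" by (simp add: d_def)
    then show ?thesis using cInf_less_iff[of "N ` K n"] bdd ne by auto
  qed
  then obtain w where w: "\<And>n. w n \<in> K n" "\<And>n. N (w n) < d n + 1 / real (Suc n)" by metis
  have est: "(LINT x|M. (norm (g (w m) x - g (w n) x))\<^sup>2) \<le> 2 * (d m - d n) + 4 / real (Suc n)" if "n \<le> m" for m n
  proof -
    have mem: "w m \<in> K n" "w n \<in> K n" using w decr[OF that] by auto
    have sqm: "square_integrable M (g (w m))" "square_integrable M (g (w n))"
      using mem decr[of 0 n] by (auto intro: sq)
    obtain z where z: "z \<in> K n" "\<And>x. g z x = (1/2) *\<^sub>R (g (w m) x + g (w n) x)"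
      using mid[OF mem] by blast
    \<comment> \<open>The midpoint lies in the larger set \<open>K n\<close>, so the squared norm of
      the sum is at least \<open>4 * d n\<close>; by the parallelogram identity little is left for
      the difference.\<close>
    have "4 * d n \<le> 4 * N z" using d_le[OF z(1)] by simp
    also have "\<dots> = (LINT x|M. (norm (g (w m) x + g (w n) x))\<^sup>2)"
      by (simp add: N_def z(2) power_divide)
    also have "\<dots> = 2 * N (w m) + 2 * N (w n) - (LINT x|M. (norm (g (w m) x - g (w n) x))\<^sup>2)"
      by (simp add: integral_norm_add_square integral_norm_diff_square sqm N_def)
    finally have "(LINT x|M. (norm (g (w m) x - g (w n) x))\<^sup>2) \<le> 2 * N (w m) + 2 * N (w n) - 4 * d n"
      by simp
    also have "\<dots> \<le> 2 * (d m + 1 / real (Suc n)) + 2 * (d n + 1 / real (Suc n)) - 4 * d n"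
    proof -
      have "N (w m) \<le> d m + 1 / real (Suc m)" "N (w n) \<le> d n + 1 / real (Suc n)" using w(2) less_imp_le by blast+
      moreover have "1 / real (Suc m) \<le> 1 / real (Suc n)" using that by (simp add: frac_le)
      moreover have "2 * a + 2 * b - 4 * e \<le> 2 * (c + j) + 2 * (e + j) - 4 * e"
        if "a \<le> c + i" "b \<le> e + j" "i \<le> j" for a b c e i j :: real
        using that by argo
      ultimately show ?thesis by blast
    qed
    finally show ?thesis by simp
  qed
  have "\<exists>n0. \<forall>m\<ge>n0. \<forall>n\<ge>n0. (LINT x|M. (norm (g (w m) x - g (w n) x))\<^sup>2) \<le> e" if "e > 0" for e
  proof -
    obtain n1 where n1: "\<And>m n. m \<ge> n1 \<Longrightarrow> n \<ge> n1 \<Longrightarrow> dist (d m) (d n) < e / 4"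
      using \<open>Cauchy d\<close> \<open>e > 0\<close> unfolding Cauchy_def by (meson divide_pos_pos zero_less_numeral)
    obtain n2 :: nat where n2: "8 / e < real n2" using reals_Archimedean2 by blast
    have small: "4 / real (Suc n) \<le> e / 2" if "n \<ge> n2" for n
    proof -
      have "8 / e \<le> real (Suc n)" using n2 that by simp
      then show ?thesis using \<open>e > 0\<close> by (simp add: field_simps)
    qed
    have "(LINT x|M. (norm (g (w m) x - g (w n) x))\<^sup>2) \<le> e" if "n \<le> m" "n \<ge> max n1 n2" for m n
    proof -
      have "\<bar>d m - d n\<bar> < e / 4" using n1[of m n] that by (simp add: dist_real_def)
      then have "d m - d n < e / 4" unfolding abs_less_iff by (rule conjunct1)
      moreover have "4 / real (Suc n) \<le> e / 2" using small[of n] that by simp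
      ultimately show ?thesis using est[OF that(1)] by argo
    qed
    moreover have "(LINT x|M. (norm (g (w m) x - g (w n) x))\<^sup>2) = (LINT x|M. (norm (g (w n) x - g (w m) x))\<^sup>2)" for m n
      by (simp add: norm_minus_commute)
    ultimately show ?thesis by (metis nle_le)
  qed
  then show ?thesis using that w by blast
qed

section \<open>A Poincare inequality on convex sets\<close>

text \<open>The mean value inequality along the segment, followed by Jensen's inequality. Only the
  majorant \<open>g\<close> is continuous, not \<open>f'\<close>. The extended nonnegative form is
  the one to which Tonelli's theorem applies.\<close>

lemma norm_diff_square_le_integral:
  fixes f :: "'a::euclidean_space \<Rightarrow> 'b::euclidean_space"
  assumes f: "\<And>x. (f has_derivative f' x) (at x)" and g: "\<And>x. onorm (f' x) \<le> g x"
    and cont: "continuous_on UNIV g"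
  shows "ennreal ((norm (f (x + h) - f x))\<^sup>2)
    \<le> ennreal ((norm h)\<^sup>2) * (\<integral>\<^sup>+t. indicator {0..1} t * ennreal ((g (x + t *\<^sub>R h))\<^sup>2) \<partial>lborel)"
proof -
  let ?g = "\<lambda>t. g (x + t *\<^sub>R h)"
  have cg: "continuous_on S ?g" for S :: "real set"
    by (rule continuous_on_compose2[OF cont]) (auto intro!: continuous_intros)
  have ig: "?g integrable_on {0..1}" "(\<lambda>t. (?g t)\<^sup>2) integrable_on {0..1}"
    by (intro integrable_continuous_real cg continuous_intros)+
  define m where "m = integral {0..1} ?g"
  have i23: "(\<lambda>t. (- 2 * m) * ?g t) integrable_on {0..1}" "(\<lambda>t::real. m\<^sup>2) integrable_on {0..1}"
    by (intro integrable_continuous_real cg continuous_intros)+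
  have "norm (f (x + 1 *\<^sub>R h) - f (x + 0 *\<^sub>R h)) \<le> norm h * integral {0..1} ?g - norm h * integral {0..0} ?g"
  proof (rule differentiable_bound_general[where f = "\<lambda>t. f (x + t *\<^sub>R h)" and \<phi> = "\<lambda>t. norm h * integral {0..t} ?g"
        and f' = "\<lambda>t. f' (x + t *\<^sub>R h) h" and \<phi>' = "\<lambda>t. norm h * ?g t" and a = 0 and b = 1])
    show d: "((\<lambda>t. f (x + t *\<^sub>R h)) has_vector_derivative f' (x + t *\<^sub>R h) h) (at t)" for t
    proof -
      have "((\<lambda>t. x + t *\<^sub>R h) has_derivative (\<lambda>s. s *\<^sub>R h)) (at t)"
        by (auto intro!: derivative_eq_intros)
      from has_derivative_compose[OF this f] show ?thesis
        using linear_scale[OF has_derivative_linear[OF f]] by (simp add: has_vector_derivative_def)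
    qed
    show "continuous_on {0..1} (\<lambda>t. f (x + t *\<^sub>R h))"
      by (rule continuous_at_imp_continuous_on) (blast intro: has_vector_derivative_continuous d)
    show "continuous_on {0..1} (\<lambda>t. norm h * integral {0..t} ?g)"
      by (intro continuous_intros indefinite_integral_continuous_1 ig)
    show "((\<lambda>t. norm h * integral {0..t} ?g) has_vector_derivative norm h * ?g t) (at t)" if "0 < t" "t < 1" for t
    proof -
      have "((\<lambda>t. integral {0..t} ?g) has_vector_derivative ?g t) (at t within {0..1})"
        by (rule integral_has_vector_derivative[OF cg]) (use that in auto)
      then have "((\<lambda>t. integral {0..t} ?g) has_vector_derivative ?g t) (at t)"
        using that by (simp add: at_within_Icc_at)
      then show ?thesis by (rule has_vector_derivative_mult_right)
    qed
    show "norm (f' (x + t *\<^sub>R h) h) \<le> norm h * ?g t" for t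
    proof -
      have "norm (f' (x + t *\<^sub>R h) h) \<le> onorm (f' (x + t *\<^sub>R h)) * norm h"
        by (rule onorm[OF has_derivative_bounded_linear[OF f]])
      also have "\<dots> \<le> ?g t * norm h" by (intro mult_right_mono g) simp
      finally show ?thesis by (simp add: mult.commute)
    qed
  qed simp
  then have "norm (f (x + h) - f x) \<le> norm h * m" by (simp add: m_def)
  then have "(norm (f (x + h) - f x))\<^sup>2 \<le> (norm h * m)\<^sup>2" by (intro power_mono) auto
  also have "\<dots> = (norm h)\<^sup>2 * m\<^sup>2" by (simp add: power_mult_distrib)
  also have "\<dots> \<le> (norm h)\<^sup>2 * integral {0..1} (\<lambda>t. (?g t)\<^sup>2)"
  proof (intro mult_left_mono)
    \<comment> \<open>Jensen's inequality as nonnegativity of the variance of \<open>g\<close> about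
      its mean \<open>m\<close> on the segment.\<close>
    have "0 \<le> integral {0..1} (\<lambda>t. (?g t - m)\<^sup>2)"
      by (intro integral_nonneg integrable_continuous_real continuous_intros cg) auto
    also have "\<dots> = integral {0..1} (\<lambda>t. (?g t)\<^sup>2 + ((- 2 * m) * ?g t + m\<^sup>2))"
      by (intro integral_cong) (simp add: power2_eq_square algebra_simps)
    also have "\<dots> = integral {0..1} (\<lambda>t. (?g t)\<^sup>2) + (integral {0..1} (\<lambda>t. (- 2 * m) * ?g t) + integral {0..1} (\<lambda>t::real. m\<^sup>2))"
      by (simp only: integral_add[OF ig(2) integrable_add[OF i23]] integral_add[OF i23])
    also have "integral {0..1} (\<lambda>t. (- 2 * m) * ?g t) = - 2 * m * m"
      by (simp add: m_def)
    finally show "m\<^sup>2 \<le> integral {0..1} (\<lambda>t. (?g t)\<^sup>2)" by (simp add: power2_eq_square)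
  qed simp
  finally have "ennreal ((norm (f (x + h) - f x))\<^sup>2) \<le> ennreal ((norm h)\<^sup>2 * integral {0..1} (\<lambda>t. (?g t)\<^sup>2))"
    by (rule ennreal_leI)
  also have "\<dots> = ennreal ((norm h)\<^sup>2) * ennreal (integral {0..1} (\<lambda>t. (?g t)\<^sup>2))"
    by (rule ennreal_mult') simp
  also have "ennreal (integral {0..1} (\<lambda>t. (?g t)\<^sup>2)) = (\<integral>\<^sup>+t. indicator {0..1} t * ennreal ((?g t)\<^sup>2) \<partial>lborel)"
    using nn_integral_has_integral_lebesgue[OF _ integrable_integral[OF ig(2)]]
    by (simp add: ennreal_mult' ennreal_indicator)
  finally show ?thesis .
qed

lemma nn_integral_lborel_translation:
  fixes f :: "'a::euclidean_space \<Rightarrow> ennreal"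
  assumes "f \<in> borel_measurable borel"
  shows "(\<integral>\<^sup>+x. f (c + x) \<partial>lborel) = (\<integral>\<^sup>+x. f x \<partial>lborel)"
proof -
  have "(\<integral>\<^sup>+x. f x \<partial>lborel) = (\<integral>\<^sup>+x. f x \<partial>distr lborel borel ((+) c))"
    by (simp add: lborel_distr_plus)
  also have "\<dots> = (\<integral>\<^sup>+x. f (c + x) \<partial>lborel)"
    by (rule nn_integral_distr) (use assms in auto)
  finally show ?thesis by simp
qed

text \<open>With \<open>h = y - x\<close> the segment from \<open>x\<close> to \<open>y\<close> stays in \<open>Q\<close>, so translating by \<open>t h\<close>
  and exchanging the integrals leaves an integral over \<open>Q\<close>.\<close>

lemma double_integral_diff_le:
  fixes f :: "'a::euclidean_space \<Rightarrow> 'b::euclidean_space"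
  assumes f: "\<And>x. (f has_derivative f' x) (at x)" and g: "\<And>x. onorm (f' x) \<le> g x"
    and cont: "continuous_on UNIV g"
    and Q: "convex Q" "Q \<in> sets borel" and H: "H \<in> sets borel"
    and diff: "\<And>x y. x \<in> Q \<Longrightarrow> y \<in> Q \<Longrightarrow> y - x \<in> H \<and> norm (y - x) \<le> D"
  shows "(\<integral>\<^sup>+x. indicator Q x * (\<integral>\<^sup>+y. indicator Q y * ennreal ((norm (f y - f x))\<^sup>2) \<partial>lborel) \<partial>lborel)
    \<le> emeasure lborel H * ennreal (D\<^sup>2) * (\<integral>\<^sup>+x. indicator Q x * ennreal ((g x)\<^sup>2) \<partial>lborel)"
proof -
  note [measurable] = Q(2) H
  have cf: "continuous_on UNIV f"
    by (rule continuous_at_imp_continuous_on) (blast intro: has_derivative_continuous f)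
  have [measurable]: "g \<in> borel_measurable borel" "f \<in> borel_measurable borel"
    using cont cf by (auto intro: borel_measurable_continuous_onI)
  define \<psi> where "\<psi> x = indicator Q x * ennreal ((g x)\<^sup>2)" for x
  have [measurable]: "\<psi> \<in> borel_measurable borel" unfolding \<psi>_def by measurable
  \<comment> \<open>A majorant that forgets the condition on \<open>x\<close>: \<open>H\<close>
    contains all differences of points of \<open>Q\<close> and limits the range of \<open>h\<close>
    instead.\<close>
  define K where "K x h = indicator H h * ennreal (D\<^sup>2) * (\<integral>\<^sup>+t. indicator {0..1} t * \<psi> (x + t *\<^sub>R h) \<partial>lborel)"
    for x h
  have "(\<integral>\<^sup>+x. indicator Q x * (\<integral>\<^sup>+y. indicator Q y * ennreal ((norm (f y - f x))\<^sup>2) \<partial>lborel) \<partial>lborel)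
    = (\<integral>\<^sup>+x. \<integral>\<^sup>+h. indicator Q x * (indicator Q (x + h) * ennreal ((norm (f (x + h) - f x))\<^sup>2)) \<partial>lborel \<partial>lborel)"
    by (intro nn_integral_cong, subst nn_integral_cmult)
      (simp_all add: nn_integral_lborel_translation[where f = "\<lambda>y. indicator Q y * ennreal ((norm (f y - f _))\<^sup>2)"])
  also have "\<dots> \<le> (\<integral>\<^sup>+x. \<integral>\<^sup>+h. K x h \<partial>lborel \<partial>lborel)"
  proof (intro nn_integral_mono)
    fix x h
    show "indicator Q x * (indicator Q (x + h) * ennreal ((norm (f (x + h) - f x))\<^sup>2)) \<le> K x h"
    proof (cases "x \<in> Q \<and> x + h \<in> Q")
      case True
      then have h: "h \<in> H" "norm h \<le> D" using diff[of x "x + h"] by auto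
      have "x + t *\<^sub>R h \<in> Q" if "t \<in> {0..1}" for t
      proof -
        have "(1 - t) *\<^sub>R x + t *\<^sub>R (x + h) \<in> Q"
          using True that by (intro convexD Q) auto
        then show ?thesis by (simp add: algebra_simps)
      qed
      then have "(\<integral>\<^sup>+t. indicator {0..1} t * ennreal ((g (x + t *\<^sub>R h))\<^sup>2) \<partial>lborel)
        = (\<integral>\<^sup>+t. indicator {0..1} t * \<psi> (x + t *\<^sub>R h) \<partial>lborel)"
        by (intro nn_integral_cong) (auto simp: \<psi>_def indicator_def)
      then have "ennreal ((norm (f (x + h) - f x))\<^sup>2) \<le> ennreal ((norm h)\<^sup>2) *
          (\<integral>\<^sup>+t. indicator {0..1} t * \<psi> (x + t *\<^sub>R h) \<partial>lborel)"
        using norm_diff_square_le_integral[OF f g cont, of x h] by simp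
      also have "\<dots> \<le> ennreal (D\<^sup>2) * (\<integral>\<^sup>+t. indicator {0..1} t * \<psi> (x + t *\<^sub>R h) \<partial>lborel)"
        using h by (intro mult_right_mono ennreal_leI power_mono) auto
      finally show ?thesis using True h by (simp add: K_def)
    qed (auto simp: indicator_def)
  qed
  also have "\<dots> = (\<integral>\<^sup>+h. \<integral>\<^sup>+x. K x h \<partial>lborel \<partial>lborel)"
    unfolding K_def by (intro lborel_pair.Fubini'[symmetric]) measurable
  also have "\<dots> = (\<integral>\<^sup>+h. indicator H h * ennreal (D\<^sup>2) * (\<integral>\<^sup>+x. \<psi> x \<partial>lborel) \<partial>lborel)"
  proof (intro nn_integral_cong)
    fix h
    have "(\<integral>\<^sup>+x. \<integral>\<^sup>+t. indicator {0..1} t * \<psi> (x + t *\<^sub>R h) \<partial>lborel \<partial>lborel)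
      = (\<integral>\<^sup>+t. \<integral>\<^sup>+x. indicator {0..1::real} t * \<psi> (x + t *\<^sub>R h) \<partial>lborel \<partial>lborel)"
      by (intro lborel_pair.Fubini'[symmetric]) measurable
    \<comment> \<open>For fixed \<open>t\<close> and \<open>h\<close> the shift does not change the
      integral of \<open>\<psi>\<close>, so the dependence on \<open>t\<close> disappears.\<close>
    also have "\<dots> = (\<integral>\<^sup>+t. indicator {0..1::real} t * (\<integral>\<^sup>+x. \<psi> x \<partial>lborel) \<partial>lborel)"
      using nn_integral_lborel_translation[of \<psi>]
      by (intro nn_integral_cong) (simp add: nn_integral_cmult add.commute[of _ "_ *\<^sub>R h"])
    also have "\<dots> = (\<integral>\<^sup>+x. \<psi> x \<partial>lborel)"
      by (simp add: nn_integral_multc)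
    finally show "(\<integral>\<^sup>+x. K x h \<partial>lborel) = indicator H h * ennreal (D\<^sup>2) * (\<integral>\<^sup>+x. \<psi> x \<partial>lborel)"
      unfolding K_def by (simp add: nn_integral_cmult)
  qed
  also have "\<dots> = emeasure lborel H * ennreal (D\<^sup>2) * (\<integral>\<^sup>+x. \<psi> x \<partial>lborel)"
    by (simp add: nn_integral_multc)
  finally show ?thesis unfolding \<psi>_def .
qed

lemma continuous_set_integrable_bounded:
  fixes f :: "'a::euclidean_space \<Rightarrow> 'b::{banach, second_countable_topology}"
  assumes "continuous_on UNIV f" "bounded A" "A \<in> sets lebesgue"
  shows "set_integrable lebesgue A f"
proof -
  obtain R where R: "A \<subseteq> cball 0 R" using assms(2) by (auto simp: bounded_iff subset_iff)
  have "integrable lborel (\<lambda>x. indicator (cball 0 R) x *\<^sub>R f x)"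
    by (rule borel_integrable_compact) (auto intro: continuous_on_subset[OF assms(1)])
  then have "set_integrable lebesgue (cball 0 R) f"
    by (simp add: set_integrable_def integrable_completion)
  then show ?thesis using assms(3) R by (rule set_integrable_subset)
qed

text \<open>Integrate the squared difference \<open>f y - f x\<close> over \<open>y\<close> in
  \<open>Q\<close> and \<open>x\<close> in \<open>A\<close>, and expand. The free choice of
  \<open>A\<close> gives two inequalities: \<open>A = Q\<close> compares with the average over
  \<open>Q\<close>, and a set \<open>A\<close> over which \<open>f\<close> has integral 0 removes
  the product term.\<close>

lemma poincare_inequality:
  fixes f :: "'a::euclidean_space \<Rightarrow> 'b::euclidean_space"
  assumes f: "\<And>x. (f has_derivative f' x) (at x)" and g: "\<And>x. onorm (f' x) \<le> g x"
    and cont: "continuous_on UNIV g"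
    and Q: "convex Q" "Q \<in> sets borel" "bounded Q" and H: "H \<in> sets borel" "emeasure lborel H < \<infinity>"
    and diff: "\<And>x y. x \<in> Q \<Longrightarrow> y \<in> Q \<Longrightarrow> y - x \<in> H \<and> norm (y - x) \<le> D"
    and A: "A \<subseteq> Q" "A \<in> sets lebesgue"
  shows "measure lebesgue A * (LINT x:Q|lebesgue. (norm (f x))\<^sup>2) + measure lebesgue Q * (LINT x:A|lebesgue. (norm (f x))\<^sup>2)
    - 2 * ((LINT x:A|lebesgue. f x) \<bullet> (LINT x:Q|lebesgue. f x))
    \<le> measure lebesgue H * D\<^sup>2 * (LINT x:Q|lebesgue. (g x)\<^sup>2)"
proof -
  have QL: "Q \<in> sets lebesgue" using Q by simp
  have Ab: "bounded A" using A Q bounded_subset by blast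
  have cf: "continuous_on UNIV f"
    by (rule continuous_at_imp_continuous_on) (blast intro: has_derivative_continuous f)
  note int = continuous_set_integrable_bounded[OF _ Q(3) QL] continuous_set_integrable_bounded[OF _ Ab A(2)]
  have cfs: "continuous_on UNIV (\<lambda>x. (norm (f x))\<^sup>2)" "continuous_on UNIV (\<lambda>x. (g x)\<^sup>2)"
    "\<And>c. continuous_on UNIV (\<lambda>x. (norm (f x - c))\<^sup>2)" "\<And>c. continuous_on UNIV (\<lambda>x. f x \<bullet> c)"
    by (intro continuous_intros cf cont)+
  define S where "S = (LINT x:Q|lebesgue. (norm (f x))\<^sup>2)"
  define m where "m = (LINT x:Q|lebesgue. f x)"
  define q where "q = measure lebesgue Q"
  have const: "set_integrable lebesgue Q (\<lambda>x. c)" "set_integrable lebesgue A (\<lambda>x. c)"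
    "(LINT x:Q|lebesgue. c) = q * c" "(LINT x:A|lebesgue. c) = measure lebesgue A * c" for c :: real
    by (auto intro!: int simp: q_def set_lebesgue_integral_def mult.commute)
  \<comment> \<open>The inner integral over \<open>y\<close>, written out as a quadratic function of
    \<open>f x\<close>; as it is nonnegative, its integral over \<open>A\<close> is at most that
    over \<open>Q\<close>.\<close>
  define J where "J x = S + (q * (norm (f x))\<^sup>2 - 2 * (f x \<bullet> m))" for x
  have dot: "(LINT x:B|lebesgue. f x \<bullet> c) = (LINT x:B|lebesgue. f x) \<bullet> c" if "set_integrable lebesgue B f" for B c
    using integral_inner_left[OF that[unfolded set_integrable_def], of c]
    by (simp add: set_lebesgue_integral_def)
  have J: "(LINT y:Q|lebesgue. (norm (f y - f x))\<^sup>2) = J x" for x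
  proof -
    have "(LINT y:Q|lebesgue. (norm (f y - f x))\<^sup>2)
      = (LINT y:Q|lebesgue. (norm (f y))\<^sup>2 + ((norm (f x))\<^sup>2 - 2 * (f y \<bullet> f x)))"
      by (simp add: power2_norm_eq_inner inner_diff inner_commute algebra_simps)
    also have "\<dots> = S + (q * (norm (f x))\<^sup>2 - 2 * (m \<bullet> f x))"
      by (subst set_integral_add(2) set_integral_diff(2) | intro set_integral_diff(1) set_integrable_mult_right int cfs const continuous_on_const)+
        (simp add: S_def m_def dot const int cf)
    finally show ?thesis by (simp add: J_def inner_commute)
  qed
  have J0: "0 \<le> J x" for x unfolding J[symmetric]
    by (auto simp: set_lebesgue_integral_def intro!: Bochner_Integration.integral_nonneg)
  have cJ: "continuous_on UNIV J" unfolding J_def by (intro continuous_intros cf)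
  have JA: "(LINT x:A|lebesgue. J x) = measure lebesgue A * S + (q * (LINT x:A|lebesgue. (norm (f x))\<^sup>2) - 2 * ((LINT x:A|lebesgue. f x) \<bullet> m))"
    unfolding J_def
    by (subst set_integral_add(2) set_integral_diff(2) | intro set_integral_diff(1) set_integrable_mult_right int cfs const continuous_on_const)+
        (simp add: dot const int cf)
  have nn: "ennreal (LINT x:B|lebesgue. k x) = (\<integral>\<^sup>+x. indicator B x * ennreal (k x) \<partial>lborel)"
    if "set_integrable lebesgue B k" "\<And>x. 0 \<le> k x" for B k
  proof -
    have "(\<integral>\<^sup>+x. ennreal (indicator B x *\<^sub>R k x) \<partial>lebesgue) = ennreal (LINT x:B|lebesgue. k x)"
      unfolding set_lebesgue_integral_def
      using that by (intro nn_integral_eq_integral) (auto simp: set_integrable_def)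
    then show ?thesis by (simp add: nn_integral_completion ennreal_mult' ennreal_indicator)
  qed
  have "ennreal (LINT x:A|lebesgue. J x) = (\<integral>\<^sup>+x. indicator A x * ennreal (J x) \<partial>lborel)"
    by (intro nn int cJ J0)
  also have "\<dots> \<le> (\<integral>\<^sup>+x. indicator Q x * ennreal (J x) \<partial>lborel)"
    using A by (intro nn_integral_mono) (auto simp: indicator_def)
  also have "\<dots> = (\<integral>\<^sup>+x. indicator Q x * (\<integral>\<^sup>+y. indicator Q y * ennreal ((norm (f y - f x))\<^sup>2) \<partial>lborel) \<partial>lborel)"
    unfolding J[symmetric] by (subst nn) (auto intro: int cfs)
  also have "\<dots> \<le> emeasure lborel H * ennreal (D\<^sup>2) * (\<integral>\<^sup>+x. indicator Q x * ennreal ((g x)\<^sup>2) \<partial>lborel)"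
    by (rule double_integral_diff_le[OF f g cont Q(1,2) H(1) diff])
  also have "\<dots> = ennreal (measure lebesgue H * D\<^sup>2 * (LINT x:Q|lebesgue. (g x)\<^sup>2))"
    using H by (subst nn[symmetric]) (auto intro: int cfs simp: ennreal_mult' emeasure_eq_ennreal_measure)
  finally have "(LINT x:A|lebesgue. J x) \<le> measure lebesgue H * D\<^sup>2 * (LINT x:Q|lebesgue. (g x)\<^sup>2)"
    by (subst (asm) ennreal_le_iff) (auto simp: set_lebesgue_integral_def intro!: mult_nonneg_nonneg Bochner_Integration.integral_nonneg)
  then show ?thesis unfolding JA by (simp add: S_def q_def m_def)
qed

section \<open>Calculus of \<open>C\<^sup>k\<close> functions\<close>

lemma partial_deriv_eqI:
  assumes "(f has_derivative D) (at x)"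
  shows "partial_deriv j f x = D (axis j 1)"
  using frechet_derivative_at[OF assms] by (simp add: partial_deriv_def)

lemma Ck_differentiable: "Ck (Suc k) f \<Longrightarrow> f differentiable (at x)"
  by (simp add: differentiable_on_def)

lemma Ck_has_derivative: "Ck (Suc k) f \<Longrightarrow> (f has_derivative frechet_derivative f (at x)) (at x)"
  using Ck_differentiable frechet_derivative_works by blast

lemma Ck_partial_deriv: "Ck (Suc k) f \<Longrightarrow> Ck k (partial_deriv j f)"
  by simp

lemma Ck_continuous: "Ck k f \<Longrightarrow> continuous_on UNIV f"
  by (cases k) (auto intro: differentiable_imp_continuous_on)

lemma Ck_SucD: "Ck (Suc k) f \<Longrightarrow> Ck k f"
proof (induction k arbitrary: f)
  case 0
  then show ?case using Ck_continuous[of "Suc 0" f] by simp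
next
  case (Suc k)
  then show ?case by (metis Ck.simps(2))
qed

lemma partial_deriv_continuous: "Ck (Suc k) f \<Longrightarrow> continuous_on UNIV (partial_deriv j f)"
  using Ck_continuous Ck_partial_deriv by blast

lemma partial_deriv_const: "partial_deriv j (\<lambda>x. c) = (\<lambda>x. 0)"
  by (rule ext, subst partial_deriv_eqI[OF has_derivative_const]) simp

lemma Ck_const: "Ck k (\<lambda>x. c)"
  by (induction k arbitrary: c) (simp_all add: partial_deriv_const)

lemma partial_deriv_bounded_linear:
  assumes "bounded_linear h" "f differentiable (at x)"
  shows "partial_deriv j (\<lambda>x. h (f x)) x = h (partial_deriv j f x)"
  using partial_deriv_eqI[OF bounded_linear.has_derivative[OF assms(1)
        assms(2)[unfolded frechet_derivative_works]]]
  by (simp add: partial_deriv_def)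

lemma Ck_bounded_linear:
  assumes "bounded_linear h"
  shows "Ck k f \<Longrightarrow> Ck k (\<lambda>x. h (f x))"
proof (induction k arbitrary: f)
  case 0
  then show ?case
    by (auto intro!: bounded_linear.continuous_on[OF assms])
next
  case (Suc k)
  have "partial_deriv j (\<lambda>x. h (f x)) = (\<lambda>x. h (partial_deriv j f x))" for j
    using partial_deriv_bounded_linear[OF assms Ck_differentiable[OF Suc.prems]] by blast
  moreover have "(\<lambda>x. h (f x)) differentiable (at x)" for x
    using bounded_linear.has_derivative[OF assms Ck_has_derivative[OF Suc.prems]]
    by (rule differentiableI)
  ultimately show ?case using Suc by (simp add: differentiable_on_def)
qed

lemma partial_deriv_add:
  assumes "f differentiable (at x)" "g differentiable (at x)"
  shows "partial_deriv j (\<lambda>x. f x + g x) x = partial_deriv j f x + partial_deriv j g x"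
  using partial_deriv_eqI[OF has_derivative_add[OF assms[unfolded frechet_derivative_works]]]
  by (simp add: partial_deriv_def)

lemma Ck_add: "Ck k f \<Longrightarrow> Ck k g \<Longrightarrow> Ck k (\<lambda>x. f x + g x)"
proof (induction k arbitrary: f g)
  case (Suc k)
  have "partial_deriv j (\<lambda>x. f x + g x) = (\<lambda>x. partial_deriv j f x + partial_deriv j g x)" for j
    using partial_deriv_add Ck_differentiable Suc.prems by blast
  with Suc show ?case by simp
qed (auto intro: continuous_on_add)

lemma partial_deriv_bilinear:
  assumes "bounded_bilinear h" "f differentiable (at x)" "g differentiable (at x)"
  shows "partial_deriv j (\<lambda>x. h (f x) (g x)) x = h (f x) (partial_deriv j g x) + h (partial_deriv j f x) (g x)"
  using partial_deriv_eqI[OF bounded_bilinear.FDERIV[OF assms(1) assms(2,3)[unfolded frechet_derivative_works]]]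
  by (simp add: partial_deriv_def)

lemma Ck_bilinear:
  assumes "bounded_bilinear h"
  shows "Ck k f \<Longrightarrow> Ck k g \<Longrightarrow> Ck k (\<lambda>x. h (f x) (g x))"
proof (induction k arbitrary: f g)
  case 0
  then show ?case by (auto intro: bounded_bilinear.continuous_on[OF assms])
next
  case (Suc k)
  have "partial_deriv j (\<lambda>x. h (f x) (g x)) = (\<lambda>x. h (f x) (partial_deriv j g x) + h (partial_deriv j f x) (g x))" for j
    by (rule ext) (rule partial_deriv_bilinear[OF assms Ck_differentiable[OF Suc.prems(1)]
          Ck_differentiable[OF Suc.prems(2)]])
  moreover have "(\<lambda>x. h (f x) (g x)) differentiable (at x)" for x
    using bounded_bilinear.FDERIV[OF assms Ck_has_derivative[OF Suc.prems(1)] Ck_has_derivative[OF Suc.prems(2)]]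
    by (rule differentiableI)
  moreover have "Ck k (\<lambda>x. h (f x) (partial_deriv j g x) + h (partial_deriv j f x) (g x))" for j
    by (intro Ck_add Suc.IH Ck_SucD[OF Suc.prems(1)] Ck_SucD[OF Suc.prems(2)]
        Ck_partial_deriv[OF Suc.prems(1)] Ck_partial_deriv[OF Suc.prems(2)])
  ultimately show ?case by (simp add: differentiable_on_def)
qed

lemmas Ck_mult = Ck_bilinear[OF bounded_bilinear_mult]
lemmas Ck_scaleR = Ck_bounded_linear[OF bounded_linear_scaleR_right]
lemmas Ck_component = Ck_bounded_linear[OF bounded_linear_vec_nth]
lemmas partial_deriv_mult = partial_deriv_bilinear[OF bounded_bilinear_mult]
lemmas partial_deriv_scaleR = partial_deriv_bounded_linear[OF bounded_linear_scaleR_right]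
lemmas partial_deriv_component = partial_deriv_bounded_linear[OF bounded_linear_vec_nth]

lemma Ck_sum: "(\<And>i. i \<in> I \<Longrightarrow> Ck k (f i)) \<Longrightarrow> Ck k (\<lambda>x. \<Sum>i\<in>I. f i x)"
  by (induction I rule: infinite_finite_induct) (auto intro: Ck_const Ck_add)

lemma Ck_prod:
  fixes f :: "'i \<Rightarrow> real^'n::finite \<Rightarrow> real"
  shows "(\<And>i. i \<in> I \<Longrightarrow> Ck k (f i)) \<Longrightarrow> Ck k (\<lambda>x. \<Prod>i\<in>I. f i x)"
  by (induction I rule: infinite_finite_induct) (auto intro: Ck_const Ck_mult)

lemma Ck_has_derivative_along:
  assumes "Ck (Suc k) f"
  shows "((\<lambda>s. f (x + s *\<^sub>R axis j 1)) has_vector_derivative partial_deriv j f (x + s *\<^sub>R axis j 1)) (at s)"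
proof -
  let ?D = "frechet_derivative f (at (x + s *\<^sub>R axis j 1))"
  have D: "(f has_derivative ?D) (at (x + s *\<^sub>R axis j 1))"
    by (rule Ck_has_derivative[OF assms])
  have "((\<lambda>s. x + s *\<^sub>R axis j 1) has_derivative (\<lambda>h. h *\<^sub>R axis j 1)) (at s)"
    by (auto intro!: derivative_eq_intros)
  from has_derivative_compose[OF this D]
  show ?thesis
    using linear_scale[OF has_derivative_linear[OF D]]
    by (simp add: has_vector_derivative_def partial_deriv_def)
qed

section \<open>Integration by parts\<close>

lemma integrable_continuous_bounded_support:
  fixes f :: "'a::euclidean_space \<Rightarrow> 'b::{banach, second_countable_topology}"
  assumes "continuous_on UNIV f" "bounded {x. f x \<noteq> 0}"
  shows "integrable lborel f" "integrable lebesgue f"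
proof -
  obtain R where R: "norm x \<le> R" if "f x \<noteq> 0" for x
    using assms(2) by (auto simp: bounded_iff)
  have "integrable lborel (\<lambda>x. indicator (cball 0 R) x *\<^sub>R f x)"
    by (rule borel_integrable_compact) (auto intro: continuous_on_subset[OF assms(1)])
  also have "(\<lambda>x. indicator (cball 0 R) x *\<^sub>R f x) = f"
    using R by (force simp: indicator_def)
  finally show *: "integrable lborel f" .
  then show "integrable lebesgue f" by (simp add: integrable_completion)
qed

lemma integral_lborel_translation:
  fixes f :: "'a::euclidean_space \<Rightarrow> 'b::{banach, second_countable_topology}"
  assumes "integrable lborel f"
  shows "integrable lborel (\<lambda>x. f (c + x))" "(LINT x|lborel. f (c + x)) = (LINT x|lborel. f x)"
proof -
  have f: "f \<in> borel_measurable borel" using assms by auto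
  have "integrable (distr lborel borel ((+) c)) f" by (simp add: lborel_distr_plus assms)
  then show "integrable lborel (\<lambda>x. f (c + x))" by (simp add: integrable_distr_eq f)
  have "(LINT x|lborel. f x) = (LINT x|distr lborel borel ((+) c). f x)"
    by (simp add: lborel_distr_plus)
  also have "\<dots> = (LINT x|lborel. f (c + x))" by (simp add: integral_distr f)
  finally show "(LINT x|lborel. f (c + x)) = (LINT x|lborel. f x)" by simp
qed

text \<open>Stated for an arbitrary constant \<open>c\<close> because the velocities are constant,
  but not zero, near infinity.\<close>

lemma partial_deriv_zero_outside:
  fixes f :: "real^'n::finite \<Rightarrow> 'b::real_normed_vector"
  assumes "\<And>y. norm y > R \<Longrightarrow> f y = c" "norm x > R"
  shows "partial_deriv j f x = 0"
proof -
  have "(f has_derivative (\<lambda>_. 0)) (at x)"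
  proof (rule has_derivative_transform_within_open[where s = "- cball 0 R"])
    show "((\<lambda>_. c) has_derivative (\<lambda>_. 0)) (at x)" by simp
  qed (use assms in auto)
  then show ?thesis by (rule partial_deriv_eqI)
qed

lemma bounded_support_partial_deriv:
  fixes f :: "real^'n::finite \<Rightarrow> 'b::real_normed_vector"
  assumes "bounded {x. f x \<noteq> c}"
  shows "bounded {x. partial_deriv j f x \<noteq> 0}"
proof -
  obtain R where R: "norm x \<le> R" if "f x \<noteq> c" for x
    using assms by (auto simp: bounded_iff)
  have "norm x \<le> R" if "partial_deriv j f x \<noteq> 0" for x
    using partial_deriv_zero_outside[of R f c x] that R by (meson not_less)
  then show ?thesis by (auto simp: bounded_iff)
qed

text \<open>The difference quotients in direction \<open>j\<close> have vanishing integrals by translation invariance.\<close>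

lemma integral_partial_deriv_eq_0:
  fixes f :: "real^'n::finite \<Rightarrow> real"
  assumes f: "Ck (Suc k) f" and supp: "bounded {x. f x \<noteq> 0}"
  shows "(LINT x|lebesgue. partial_deriv j f x) = 0"
proof -
  obtain R where R: "f x = 0" if "norm x > R" for x
    using supp by (auto simp: bounded_iff) (meson not_less)
  let ?e = "axis j 1 :: real^'n"
  let ?d = "partial_deriv j f"
  define q where "q n x = real (Suc n) * (f (x + (1 / real (Suc n)) *\<^sub>R ?e) - f x)" for n x
  have int: "integrable lborel f"
    by (rule integrable_continuous_bounded_support[OF Ck_continuous[OF f] supp])
  have [measurable]: "f \<in> borel_measurable borel" "?d \<in> borel_measurable borel"
    using borel_measurable_continuous_onI Ck_continuous[OF f] partial_deriv_continuous[OF f] by blast+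
  \<comment> \<open>Steps have length at most 1: the quotients vanish outside radius
    \<open>R + 1\<close>, and the intermediate points of the mean value theorem stay within
    \<open>R + 2\<close>.\<close>
  obtain K where K: "norm (?d x) \<le> K" if "x \<in> cball 0 (R + 2)" for x
    using compact_imp_bounded[OF compact_continuous_image[OF
          continuous_on_subset[OF partial_deriv_continuous[OF f]], of "cball 0 (R + 2)"]]
    by (fastforce simp: bounded_iff)
  have "(\<lambda>n. LINT x|lborel. q n x) \<longlonglongrightarrow> (LINT x|lborel. ?d x)"
  proof (rule integral_dominated_convergence[where w = "\<lambda>x. indicator (cball 0 (R + 1)) x *\<^sub>R K"])
    show "integrable lborel (\<lambda>x. indicator (cball 0 (R + 1)) x *\<^sub>R K :: real)"
      by (intro borel_integrable_compact) auto
    show "AE x in lborel. (\<lambda>n. q n x) \<longlonglongrightarrow> ?d x"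
    proof (rule AE_I2)
      fix x
      have "((\<lambda>s. f (x + s *\<^sub>R ?e)) has_real_derivative ?d x) (at 0)"
        using Ck_has_derivative_along[OF f, of x j 0]
        by (simp add: has_real_derivative_iff_has_vector_derivative)
      then have "((\<lambda>h. (f (x + h *\<^sub>R ?e) - f x) / h) \<longlongrightarrow> ?d x) (at 0)"
        by (simp add: DERIV_def)
      moreover have "filterlim (\<lambda>n. 1 / real (Suc n)) (at 0) sequentially"
        using LIMSEQ_inverse_real_of_nat by (auto simp: filterlim_at inverse_eq_divide)
      ultimately have "(\<lambda>n. (f (x + (1 / real (Suc n)) *\<^sub>R ?e) - f x) / (1 / real (Suc n))) \<longlonglongrightarrow> ?d x"
        by (rule filterlim_compose)
      then show "(\<lambda>n. q n x) \<longlonglongrightarrow> ?d x"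
        by (simp add: q_def mult.commute)
    qed
    show "AE x in lborel. norm (q n x) \<le> indicator (cball 0 (R + 1)) x *\<^sub>R K" for n
    proof (rule AE_I2)
      fix x :: "real^'n"
      define h where "h = 1 / real (Suc n)"
      have h: "0 < h" "h \<le> 1" by (auto simp: h_def)
      show "norm (q n x) \<le> indicator (cball 0 (R + 1)) x *\<^sub>R K"
      proof (cases "norm x \<le> R + 1")
        case True
        obtain z where z: "0 < z" "z < h" "f (x + h *\<^sub>R ?e) - f (x + 0 *\<^sub>R ?e) = (h - 0) * ?d (x + z *\<^sub>R ?e)"
          using MVT2[OF h(1), of "\<lambda>s. f (x + s *\<^sub>R ?e)" "\<lambda>s. ?d (x + s *\<^sub>R ?e)"]
            Ck_has_derivative_along[OF f, of x j]
          by (auto simp: has_real_derivative_iff_has_vector_derivative)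
        have "norm (x + z *\<^sub>R ?e) \<le> norm x + norm (z *\<^sub>R ?e)" by (rule norm_triangle_ineq)
        then have "norm (x + z *\<^sub>R ?e) \<le> R + 2" using True z h by (simp add: norm_axis_1)
        then have "norm (?d (x + z *\<^sub>R ?e)) \<le> K" by (intro K) simp
        moreover have "q n x = ?d (x + z *\<^sub>R ?e)"
          using z h unfolding q_def h_def[symmetric] by (simp add: h_def field_simps)
        ultimately show ?thesis using True by simp
      next
        case False
        have "norm x \<le> norm (x + h *\<^sub>R ?e) + norm (h *\<^sub>R ?e)"
          using norm_triangle_ineq4[of "x + h *\<^sub>R ?e" "h *\<^sub>R ?e"] by simp
        then have "norm (x + h *\<^sub>R ?e) > R" using False h by (simp add: norm_axis_1)
        then show ?thesis using False R[of x] R[of "x + h *\<^sub>R ?e"] unfolding q_def h_def[symmetric] by simp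
      qed
    qed
  qed (simp_all add: q_def)
  moreover have "(LINT x|lborel. q n x) = 0" for n
    using integral_lborel_translation[OF int, of "(1 / real (Suc n)) *\<^sub>R ?e"] int
    by (simp add: q_def add.commute)
  ultimately have "(LINT x|lborel. ?d x) = 0"
    by (simp add: LIMSEQ_const_iff)
  then show ?thesis by (simp add: integral_completion)
qed

text \<open>A product has bounded support as soon as one factor has, so \<open>f\<close> may be a
  velocity component that does not vanish at infinity.\<close>

lemma integration_by_parts:
  fixes f g :: "real^'n::finite \<Rightarrow> real"
  assumes f: "Ck (Suc k) f" and g: "Ck (Suc k) g" and supp: "bounded {x. g x \<noteq> 0}"
  shows "(LINT x|lebesgue. f x * partial_deriv j g x) = - (LINT x|lebesgue. partial_deriv j f x * g x)"
proof -
  have c: "continuous_on UNIV f" "continuous_on UNIV g"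
    "continuous_on UNIV (partial_deriv j f)" "continuous_on UNIV (partial_deriv j g)"
    using Ck_continuous partial_deriv_continuous f g by blast+
  have 1: "integrable lebesgue (\<lambda>x. f x * partial_deriv j g x)"
    using bounded_support_partial_deriv[OF supp, of j]
    by (intro integrable_continuous_bounded_support continuous_on_mult c) (auto elim: bounded_subset)
  have 2: "integrable lebesgue (\<lambda>x. partial_deriv j f x * g x)"
    using supp by (intro integrable_continuous_bounded_support continuous_on_mult c) (auto elim: bounded_subset)
  have "0 = (LINT x|lebesgue. partial_deriv j (\<lambda>x. f x * g x) x)"
    using supp by (intro integral_partial_deriv_eq_0[symmetric, where k = k] Ck_mult f g)
      (auto elim: bounded_subset)
  also have "\<dots> = (LINT x|lebesgue. f x * partial_deriv j g x + partial_deriv j f x * g x)"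
    by (simp add: partial_deriv_mult Ck_differentiable[OF f] Ck_differentiable[OF g])
  also have "\<dots> = (LINT x|lebesgue. f x * partial_deriv j g x) + (LINT x|lebesgue. partial_deriv j f x * g x)"
    using 1 2 by (rule Bochner_Integration.integral_add)
  finally show ?thesis by simp
qed

section \<open>The fundamental lemma of the calculus of variations\<close>

text \<open>The functions \<open>p(1/t) exp(-1/t)\<close>, extended by 0, form a family closed under
  differentiation; smoothness of the cutoff \<open>flat 1\<close> thus follows by an induction over
  all polynomials at once.\<close>

definition flat :: "real poly \<Rightarrow> real \<Rightarrow> real" where
  "flat p t = (if t > 0 then poly p (1 / t) * exp (- (1 / t)) else 0)"

text \<open>From the right, inverting the variable turns the claim into the dominance of the
  exponential over polynomials at infinity.\<close>

lemma flat_tendsto_0: "(flat p \<longlongrightarrow> 0) (at 0)"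
proof -
  have "((\<lambda>x. \<Sum>i\<le>degree p. Polynomial.coeff p i * (x ^ i / exp x)) \<longlongrightarrow> (\<Sum>i\<le>degree p. Polynomial.coeff p i * 0)) at_top"
    by (intro tendsto_sum tendsto_mult tendsto_const tendsto_power_div_exp_0)
  then have "((\<lambda>x. poly p x * exp (- x)) \<longlongrightarrow> 0) at_top"
    by (simp add: poly_altdef sum_distrib_right exp_minus divide_inverse mult.assoc)
  then have "((\<lambda>t. poly p (inverse t) * exp (- inverse t)) \<longlongrightarrow> 0) (at_right 0)"
    by (rule filterlim_compose[OF _ filterlim_inverse_at_top_right])
  then have "(flat p \<longlongrightarrow> 0) (at_right 0)"
    by (rule Lim_transform_eventually)
      (auto simp: flat_def inverse_eq_divide intro!: eventually_at_rightI[of 0 1])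
  moreover have "(flat p \<longlongrightarrow> 0) (at_left 0)"
    by (rule tendsto_eventually) (auto simp: flat_def intro!: eventually_at_leftI[of "-1" 0])
  ultimately show ?thesis by (simp add: filterlim_at_split)
qed

text \<open>The substitution s = 1/t has derivative -s^2, hence the polynomial factor
  \<open>[:0, 0, 1:]\<close>, which is s^2.\<close>

lemma flat_has_real_derivative:
  "(flat p has_real_derivative flat ([:0, 0, 1:] * (p - pderiv p)) t) (at t)"
proof (cases t "0 :: real" rule: linorder_cases)
  case less
  have "((\<lambda>_. 0) has_real_derivative 0) (at t)" by simp
  then have "(flat p has_real_derivative 0) (at t)"
    by (rule has_field_derivative_transform_within_open[where S = "{..<0}"]) (use less in \<open>auto simp: flat_def\<close>)
  then show ?thesis using less by (simp add: flat_def)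
next
  case equal
  \<comment> \<open>The difference quotient at 0 is again a member of the family, for the polynomial
    multiplied by its variable.\<close>
  have "(flat p h - flat p 0) / h = flat ([:0, 1:] * p) h" if "h \<noteq> 0" for h
    using that by (simp add: flat_def field_simps)
  then have "((\<lambda>h. (flat p (0 + h) - flat p 0) / h) \<longlongrightarrow> 0) (at 0)"
    by (intro Lim_transform_eventually[OF flat_tendsto_0[of "[:0, 1:] * p"]])
      (auto simp: eventually_at_filter)
  then show ?thesis using equal by (simp add: DERIV_def flat_def)
next
  case greater
  have "((\<lambda>t. poly p (1 / t) * exp (- (1 / t))) has_real_derivative
      flat ([:0, 0, 1:] * (p - pderiv p)) t) (at t)"
    using greater
    by (auto intro!: derivative_eq_intros poly_DERIV[THEN DERIV_chain2] simp: flat_def field_simps power2_eq_square)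
  then show ?thesis
    by (rule has_field_derivative_transform_within_open[where S = "{0<..}"]) (use greater in \<open>auto simp: flat_def\<close>)
qed

lemma flat_1: "flat 1 t = (if t > 0 then exp (- (1 / t)) else 0)"
  by (simp add: flat_def)

text \<open>The factor \<open>e\<close> and the affine argument make the statement stable under
  partial derivatives, as the induction requires.\<close>

lemma Ck_flat: "Ck k (\<lambda>x::real^'n::finite. e * flat p (c * x $ i + d))"
proof (induction k arbitrary: e p)
  case 0
  have "continuous_on UNIV (flat p)"
    by (rule continuous_at_imp_continuous_on) (blast intro: DERIV_isCont flat_has_real_derivative)
  then have "continuous_on UNIV (\<lambda>x::real^'n. flat p (c * x $ i + d))"
    by (rule continuous_on_compose2) (auto intro!: continuous_intros)
  then show ?case by (auto intro: continuous_intros)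
next
  case (Suc k)
  let ?q = "[:0, 0, 1:] * (p - pderiv p)"
  have D: "((\<lambda>x::real^'n. e * flat p (c * x $ i + d)) has_derivative
      (\<lambda>h. e * (flat ?q (c * x $ i + d) * (c * h $ i)))) (at x)" for x
  proof -
    have "((\<lambda>x::real^'n. c * x $ i + d) has_derivative (\<lambda>h. c * h $ i)) (at x)"
      by (auto intro!: derivative_eq_intros bounded_linear.has_derivative[OF bounded_linear_vec_nth])
    from has_derivative_compose[OF this flat_has_real_derivative[unfolded has_field_derivative_def]]
    show ?thesis by (intro has_derivative_mult_right)
  qed
  have "partial_deriv j (\<lambda>x::real^'n. e * flat p (c * x $ i + d)) =
      (\<lambda>x. (e * c * axis j 1 $ i) * flat ?q (c * x $ i + d))" for j
    by (rule ext, subst partial_deriv_eqI[OF D]) (simp add: mult_ac)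
  moreover have "(\<lambda>x::real^'n. e * flat p (c * x $ i + d)) differentiable (at x)" for x
    using D by (rule differentiableI)
  ultimately show ?case using Suc.IH by (simp add: differentiable_on_def)
qed

text \<open>Powers of the standard bump \<open>\<Prod>\<^sub>i exp (-1/(x\<^sub>i - a\<^sub>i)) exp (-1/(b\<^sub>i - x\<^sub>i))\<close> with
  exponents tending to 0.\<close>

lemma box_indicator_approximation:
  fixes a b :: "real^'n::finite"
  obtains \<phi> where "\<And>n::nat. \<phi> n \<in> test_functions" "\<And>n x. \<bar>\<phi> n x :: real\<bar> \<le> indicator (box a b) x"
    "\<And>x. (\<lambda>n. \<phi> n x) \<longlonglongrightarrow> indicator (box a b) x"
proof
  \<comment> \<open>Multiplying the argument of \<open>flat 1\<close> by \<open>Suc n\<close> is the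
    same as taking the power with exponent \<open>1 / Suc n\<close>.\<close>
  define \<phi> where "\<phi> n x = (\<Prod>i\<in>UNIV. flat 1 (real (Suc n) * (x $ i - a $ i)) * flat 1 (real (Suc n) * (b $ i - x $ i)))"
    for n and x :: "real^'n"
  have flat01: "0 \<le> flat 1 t" "flat 1 t \<le> 1" for t by (auto simp: flat_1)
  have out: "\<phi> n x = 0" if out: "x \<notin> box a b" for n x
  proof -
    obtain i where "x $ i \<le> a $ i \<or> x $ i \<ge> b $ i"
      using out by (auto simp: mem_box_cart not_less)
    then have "real (Suc n) * (x $ i - a $ i) \<le> 0 \<or> real (Suc n) * (b $ i - x $ i) \<le> 0"
      by (auto intro!: mult_nonneg_nonpos)
    then have "flat 1 (real (Suc n) * (x $ i - a $ i)) * flat 1 (real (Suc n) * (b $ i - x $ i)) = 0"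
      by (auto simp: flat_1)
    then show ?thesis unfolding \<phi>_def by (meson UNIV_I finite_code prod_zero)
  qed
  have bounds: "0 \<le> \<phi> n x" "\<phi> n x \<le> 1" for n x
    unfolding \<phi>_def by (auto intro!: prod_nonneg prod_le_1 mult_le_one mult_nonneg_nonneg flat01)
  show "\<bar>\<phi> n x\<bar> \<le> indicator (box a b) x" for n x
    using bounds[of n x] out[of x n] by (auto simp: indicator_def)
  have "Ck k (\<lambda>x::real^'n. flat 1 (c * (x $ i - d)))" "Ck k (\<lambda>x::real^'n. flat 1 (c * (d - x $ i)))" for k i c d
    using Ck_flat[of k 1 1 c i "- c * d"] Ck_flat[of k 1 1 "- c" i "c * d"] by (simp_all add: algebra_simps)
  then have "Ck k (\<phi> n)" for k n
    unfolding \<phi>_def by (intro Ck_prod Ck_mult)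
  moreover have "bounded {x. \<phi> n x \<noteq> 0}" for n
    by (rule bounded_subset[OF bounded_box[of a b]]) (use out in auto)
  ultimately show "\<phi> n \<in> test_functions" for n by (simp add: test_functions_def)
  show "(\<lambda>n. \<phi> n x) \<longlonglongrightarrow> indicator (box a b) x" for x
  proof (cases "x \<in> box a b")
    case True
    have *: "(\<lambda>n. flat 1 (real (Suc n) * t)) \<longlonglongrightarrow> 1" if "t > 0" for t
    proof -
      have "(\<lambda>n. exp (- (inverse (real (Suc n)) * (1 / t)))) \<longlonglongrightarrow> exp (- (0 * (1 / t)))"
        by (intro tendsto_intros LIMSEQ_inverse_real_of_nat)
      moreover have "flat 1 (real (Suc n) * t) = exp (- (inverse (real (Suc n)) * (1 / t)))" for n
        using that by (simp add: flat_1 inverse_eq_divide)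
      ultimately show ?thesis by simp
    qed
    have "(\<lambda>n. \<phi> n x) \<longlonglongrightarrow> (\<Prod>i\<in>(UNIV::'n set). 1 * 1)"
      unfolding \<phi>_def using True
      by (intro tendsto_prod tendsto_mult *) (auto simp: mem_box_cart)
    then show ?thesis using True by simp
  qed (simp add: out)
qed

text \<open>Boxes are stable under intersection and generate the Borel sets. A Dynkin argument
  therefore extends the vanishing of integrals to all Borel sets, among them sets on which the sign
  of \<open>g\<close> is known almost everywhere.\<close>

lemma AE_eq_0_if_integral_box_eq_0:
  fixes g :: "'a::euclidean_space \<Rightarrow> real"
  assumes int: "integrable lebesgue g"
    and zero: "\<And>a b. (LINT x|lebesgue. indicator (box a b) x * g x) = 0"
  shows "AE x in lebesgue. g x = 0"
proof -
  have ig: "integrable lebesgue (\<lambda>x. indicator A x * g x)" if "A \<in> sets lebesgue" for A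
    using integrable_mult_indicator[OF that int] by simp
  have all0: "(LINT x|lebesgue. indicator A x * g x) = 0" if "A \<in> sets borel" for A
  proof -
    let ?G = "range (\<lambda>(a, b). box a b :: 'a set)"
    have "Int_stable ?G" by (auto simp: Int_stable_def box_Int_box)
    moreover have "?G \<subseteq> Pow UNIV" by simp
    moreover have "A \<in> sigma_sets UNIV ?G" using that by (simp add: borel_eq_box)
    ultimately show ?thesis
    proof (induction rule: sigma_sets_induct_disjoint)
      case (compl A)
      \<comment> \<open>Complements require the integral over the whole space to vanish; it is the
        limit of integrals over growing boxes.\<close>
      have "(\<lambda>n::nat. LINT x|lebesgue. indicator (box (- (real n *\<^sub>R One)) (real n *\<^sub>R One)) x * g x)
          \<longlonglongrightarrow> (LINT x|lebesgue. g x)"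
      proof (rule integral_dominated_convergence[where w = "\<lambda>x. norm (g x)"])
        show "AE x in lebesgue. (\<lambda>n::nat. indicator (box (- (real n *\<^sub>R One)) (real n *\<^sub>R One)) x * g x) \<longlonglongrightarrow> g x"
        proof (rule AE_I2)
          fix x :: 'a
          obtain n0 :: nat where "norm x < real n0" using reals_Archimedean2 by blast
          then have "x \<in> box (- (real n *\<^sub>R One)) (real n *\<^sub>R One)" if "n \<ge> n0" for n
            using that Basis_le_norm[of _ x] by (fastforce simp: mem_box abs_le_iff)
          then have "eventually (\<lambda>n. g x = indicator (box (- (real n *\<^sub>R One)) (real n *\<^sub>R One)) x * g x) sequentially"
            by (auto simp: eventually_sequentially indicator_def)
          then show "(\<lambda>n::nat. indicator (box (- (real n *\<^sub>R One)) (real n *\<^sub>R One)) x * g x) \<longlonglongrightarrow> g x"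
            by (rule tendsto_eventually[OF eventually_mono]) auto
        qed
      qed (use int ig in \<open>auto simp: indicator_def intro!: borel_measurable_integrable\<close>)
      then have "(LINT x|lebesgue. g x) = 0" by (simp add: zero LIMSEQ_const_iff)
      moreover have "A \<in> sets lebesgue" using compl by (simp add: borel_eq_box)
      moreover have "(LINT x|lebesgue. indicator (UNIV - A) x * g x) = (LINT x|lebesgue. g x - indicator A x * g x)"
        by (rule Bochner_Integration.integral_cong) (auto simp: indicator_def)
      ultimately show ?case using compl ig[of A] int by simp
    next
      case (union A)
      have A: "A i \<in> sets lebesgue" for i
      proof -
        have "A i \<in> sigma_sets UNIV ?G" using union(2) by blast
        then show ?thesis by (simp add: borel_eq_box)
      qed
      have "set_lebesgue_integral lebesgue (\<Union>(range A)) g = suminf (\<lambda>i. set_lebesgue_integral lebesgue (A i) g)"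
        using union A ig[of "\<Union>(range A)"]
        by (intro lebesgue_integral_countable_add) (auto simp: set_integrable_def disjoint_family_on_def)
      then show ?case using union by (simp add: set_lebesgue_integral_def)
    qed (auto simp: zero)
  qed
  \<comment> \<open>The sign sets of \<open>g\<close> itself are only Lebesgue measurable, so those
    of a Borel representative are used.\<close>
  obtain g' where g': "g' \<in> borel_measurable lborel" "AE x in lborel. g x = g' x"
    using completion_ex_borel_measurable_real[OF borel_measurable_integrable[OF int]] by blast
  have eq: "AE x in lebesgue. g x = g' x" using g' by (simp add: AE_completion)
  have [measurable]: "g \<in> borel_measurable lebesgue" "g' \<in> borel_measurable lebesgue"
    using int g' by (auto intro: measurable_completion)
  have "AE x in lebesgue. indicator A x * g x = 0" if A: "A \<in> sets borel" "\<And>x. x \<in> A \<Longrightarrow> s * g' x \<ge> 0" "s \<noteq> 0" for A s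
  proof -
    have [measurable]: "A \<in> sets lebesgue" using A by simp
    have "AE x in lebesgue. s * (indicator A x * g x) \<ge> 0"
      using eq by eventually_elim (use A in \<open>auto simp: indicator_def\<close>)
    moreover have "(LINT x|lebesgue. s * (indicator A x * g x)) = 0"
      using all0[OF A(1)] by simp
    ultimately have "AE x in lebesgue. s * (indicator A x * g x) = 0"
      using integral_nonneg_eq_0_iff_AE[of lebesgue "\<lambda>x. s * (indicator A x * g x)"] ig[of A] by simp
    then show ?thesis using A(3) by simp
  qed
  from this[of "{x. g' x \<ge> 0}" 1] this[of "{x. g' x \<le> 0}" "-1"] g'(1)
  have "AE x in lebesgue. indicator {x. g' x \<ge> 0} x * g x = 0" "AE x in lebesgue. indicator {x. g' x \<le> 0} x * g x = 0"
    by auto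
  then show ?thesis
    by eventually_elim (auto simp: indicator_def split: if_splits)
qed

text \<open>Bumps converging to the indicator of a box show that \<open>g\<close> has integral 0
  over every box. Cut off to a box, \<open>g\<close> is integrable, and since boxes intersect in
  boxes, \<open>AE_eq_0_if_integral_box_eq_0\<close> applies to it; countably many boxes cover the
  space.\<close>

lemma fundamental_lemma:
  fixes g :: "real^'n::finite \<Rightarrow> real"
  assumes int: "\<And>K. compact K \<Longrightarrow> set_integrable lebesgue K g"
    and zero: "\<And>\<phi>. \<phi> \<in> test_functions \<Longrightarrow> (LINT x|lebesgue. g x * \<phi> x) = 0"
  shows "AE x in lebesgue. g x = 0"
proof -
  have box_int: "integrable lebesgue (\<lambda>x. indicator (box a b) x * g x)" for a b
    using set_integrable_subset[OF int[OF compact_cbox], of "box a b" a b] box_subset_cbox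
    by (auto simp: set_integrable_def)
  have box_zero: "(LINT x|lebesgue. indicator (box a b) x * g x) = 0" for a b
  proof -
    obtain \<phi> where \<phi>: "\<And>n. \<phi> n \<in> test_functions" "\<And>n x. \<bar>\<phi> n x :: real\<bar> \<le> indicator (box a b) x"
      "\<And>x. (\<lambda>n. \<phi> n x) \<longlonglongrightarrow> indicator (box a b) x"
      using box_indicator_approximation by blast
    \<comment> \<open>The bump vanishes off the box, so the cutoff can be inserted, and the cut-off
      function is an integrable majorant.\<close>
    have \<phi>g: "g x * \<phi> n x = (indicator (box a b) x * g x) * \<phi> n x" for x n
      using \<phi>(2)[of n x] by (auto simp: indicator_def split: if_splits)
    have "continuous_on UNIV (\<phi> n)" for n
      using \<phi>(1)[of n] Ck_continuous by (auto simp: test_functions_def)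
    then have [measurable]: "\<phi> n \<in> borel_measurable lebesgue" for n
      by (intro measurable_completion) (simp add: borel_measurable_continuous_onI)
    have [measurable]: "(\<lambda>x. indicator (box a b) x * g x) \<in> borel_measurable lebesgue"
      using box_int by auto
    have "(\<lambda>n. LINT x|lebesgue. (indicator (box a b) x * g x) * \<phi> n x) \<longlonglongrightarrow> (LINT x|lebesgue. indicator (box a b) x * g x)"
    proof (rule integral_dominated_convergence[where w = "\<lambda>x. norm (indicator (box a b) x * g x)"])
      show "AE x in lebesgue. (\<lambda>n. (indicator (box a b) x * g x) * \<phi> n x) \<longlonglongrightarrow> indicator (box a b) x * g x"
      proof (rule AE_I2)
        fix x
        have "(\<lambda>n. (indicator (box a b) x * g x) * \<phi> n x) \<longlonglongrightarrow> (indicator (box a b) x * g x) * indicator (box a b) x"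
          by (intro tendsto_mult tendsto_const \<phi>(3))
        moreover have "(indicator (box a b) x * g x) * indicator (box a b) x = indicator (box a b) x * g x"
          by (simp add: indicator_def)
        ultimately show "(\<lambda>n. (indicator (box a b) x * g x) * \<phi> n x) \<longlonglongrightarrow> indicator (box a b) x * g x"
          by simp
      qed
      show "AE x in lebesgue. norm (indicator (box a b) x * g x * \<phi> n x) \<le> norm (indicator (box a b) x * g x)" for n
      proof (rule AE_I2)
        fix x
        have "\<bar>\<phi> n x\<bar> \<le> 1" by (rule order_trans[OF \<phi>(2) indicator_le_1])
        then show "norm (indicator (box a b) x * g x * \<phi> n x) \<le> norm (indicator (box a b) x * g x)"
          unfolding norm_mult[of _ "\<phi> n x"] by (auto intro: mult_left_le)
      qed
    qed (use box_int in \<open>auto intro: integrable_norm\<close>)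
    then show ?thesis using zero[OF \<phi>(1)] by (simp add: \<phi>g LIMSEQ_const_iff flip: \<phi>g)
  qed
  have "AE x in lebesgue. indicator (box a b) x * g x = 0" for a b
  proof (rule AE_eq_0_if_integral_box_eq_0[OF box_int])
    show "(LINT x|lebesgue. indicator (box c d) x * (indicator (box a b) x * g x)) = 0" for c d
      using box_zero by (simp add: box_Int_box flip: indicator_inter_arith mult.assoc)
  qed
  then have "AE x in lebesgue. \<forall>n::nat. indicator (box (- (real n *\<^sub>R One)) (real n *\<^sub>R One)) x * g x = 0"
    by (rule AE_all_countable[THEN iffD2, OF allI])
  then show ?thesis
  proof eventually_elim
    case (elim x)
    obtain n :: nat where "norm x < real n" using reals_Archimedean2 by blast
    then have "x \<in> box (- (real n *\<^sub>R One)) (real n *\<^sub>R One)"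
      using Basis_le_norm[of _ x] by (fastforce simp: mem_box abs_le_iff)
    then show ?case using elim[rule_format, of n] by simp
  qed
qed

declare Ck.simps(2) [simp del]

section \<open>Vector fields in the plane\<close>

lemma gradient_nth: "gradient v x $ i $ j = partial_deriv j v x $ i"
  by (simp add: gradient_def jacobian_def matrix_def partial_deriv_def)

lemma gradient_eq: "gradient v = (\<lambda>x. \<chi> i j. partial_deriv j v x $ i)"
  by (auto simp: vec_eq_iff gradient_nth)

lemma divergence_eq: "divergence v x = (\<Sum>j\<in>UNIV. partial_deriv j v x $ j)"
  by (simp add: divergence_def trace_def gradient_nth)

lemma gradient_mult_vec: "gradient v x *v a = (\<Sum>j\<in>UNIV. a $ j *\<^sub>R partial_deriv j v x)"
  by (simp add: vec_eq_iff matrix_vector_mult_def gradient_nth mult.commute)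

lemma gradient_inner: "gradient v x \<bullet> gradient w x = (\<Sum>j\<in>UNIV. partial_deriv j v x \<bullet> partial_deriv j w x)"
  unfolding inner_vec_def gradient_nth by (rule sum.swap)

lemma frechet_derivative_eq_gradient:
  "Ck (Suc k) v \<Longrightarrow> frechet_derivative v (at x) h = gradient v x *v h"
  by (simp add: gradient_def jacobian_def matrix_works has_derivative_linear[OF Ck_has_derivative])

text \<open>Cauchy-Schwarz in each row. It lets the Frobenius norm of the gradient replace the
  operator norm in the Poincare inequality.\<close>

lemma norm_matrix_vector_mult_le: "norm (A *v x) \<le> norm A * norm x"
  for A :: "real^'n::finite^'m::finite"
proof -
  have "norm (A *v x) = L2_set (\<lambda>i. \<bar>A $ i \<bullet> x\<bar>) UNIV"
    by (simp add: norm_vec_def matrix_vector_mul_component)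
  also have "\<dots> \<le> L2_set (\<lambda>i. norm (A $ i) * norm x) UNIV"
    by (intro L2_set_mono Cauchy_Schwarz_ineq2) auto
  also have "\<dots> = norm A * norm x"
    by (simp add: norm_vec_def[of A] L2_set_left_distrib)
  finally show ?thesis .
qed

lemma onorm_frechet_derivative_le: "Ck (Suc k) v \<Longrightarrow> onorm (frechet_derivative v (at x)) \<le> norm (gradient v x)"
  by (intro onorm_le) (simp add: frechet_derivative_eq_gradient norm_matrix_vector_mult_le)

lemma continuous_on_gradient: "Ck (Suc k) v \<Longrightarrow> continuous_on UNIV (gradient v)"
  unfolding gradient_eq
  by (intro continuous_on_vec_lambda continuous_on_component partial_deriv_continuous)

lemma bounded_support_gradient:
  assumes "bounded {x. v x \<noteq> c}"
  shows "bounded {x. gradient v x \<noteq> 0}"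
proof -
  have "{x. gradient v x \<noteq> 0} \<subseteq> (\<Union>j\<in>UNIV. {x. partial_deriv j v x \<noteq> 0})"
    by (auto simp: gradient_eq vec_eq_iff)
  then show ?thesis
    by (rule bounded_subset[rotated]) (use bounded_support_partial_deriv[OF assms] in auto)
qed

lemma gradient_add:
  assumes "Ck (Suc k) v" "Ck (Suc l) w"
  shows "gradient (\<lambda>x. v x + w x) x = gradient v x + gradient w x"
  using partial_deriv_add[OF Ck_differentiable[OF assms(1)] Ck_differentiable[OF assms(2)]]
  by (simp add: vec_eq_iff gradient_nth)

lemma gradient_scaleR:
  assumes "Ck (Suc k) v"
  shows "gradient (\<lambda>x. c *\<^sub>R v x) x = c *\<^sub>R gradient v x"
  using partial_deriv_scaleR[OF Ck_differentiable[OF assms]]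
  by (simp add: vec_eq_iff gradient_nth)

lemma gradient_const: "gradient (\<lambda>x. c) x = 0"
  by (simp add: vec_eq_iff gradient_nth partial_deriv_const)

lemma gradient_sum:
  assumes "\<And>i. i \<in> I \<Longrightarrow> Ck (Suc k) (v i)"
  shows "gradient (\<lambda>x. \<Sum>i\<in>I. v i x) x = (\<Sum>i\<in>I. gradient (v i) x)"
  using assms
proof (induction I rule: infinite_finite_induct)
  case (insert i I)
  then show ?case using gradient_add[of k "v i" k "\<lambda>x. \<Sum>i\<in>I. v i x"] Ck_sum[of I "Suc k" v] by simp
qed (simp_all add: gradient_const)

lemma integral_sum_partial_deriv_eq_0:
  fixes h :: "'n::finite \<Rightarrow> real^'n \<Rightarrow> real"
  assumes "\<And>j. Ck (Suc 0) (h j)" "\<And>j. bounded {x. h j x \<noteq> 0}"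
  shows "(LINT x|lebesgue. (\<Sum>j\<in>UNIV. partial_deriv j (h j) x)) = 0"
  using integrable_continuous_bounded_support(2)[OF partial_deriv_continuous[OF assms(1)]
      bounded_support_partial_deriv[OF assms(2)]]
  by (simp add: Bochner_Integration.integral_sum integral_partial_deriv_eq_0[OF assms])

lemmas Ck_inner = Ck_bilinear[OF bounded_bilinear_inner]
lemmas partial_deriv_inner = partial_deriv_bilinear[OF bounded_bilinear_inner]

text \<open>For divergence-free \<open>a\<close> the sum of the two integrands is the divergence of
  \<open>(v \<bullet> w) a\<close>, whose support is bounded through \<open>w\<close> alone. With
  \<open>v = w\<close> the convection term vanishes; with \<open>w\<close> a test field all
  derivatives fall on it.\<close>

lemma convection_antisymmetric:
  fixes a v w :: "real^2 \<Rightarrow> real^2"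
  assumes a: "Ck (Suc 0) a" "\<And>x. divergence a x = 0" and v: "Ck (Suc 0) v"
    and w: "Ck (Suc 0) w" "bounded {x. w x \<noteq> 0}"
  shows "(LINT x|lebesgue. (gradient v x *v a x) \<bullet> w x) = - (LINT x|lebesgue. (gradient w x *v a x) \<bullet> v x)"
proof -
  define h where "h j x = a x $ j * (v x \<bullet> w x)" for j x
  have h: "Ck (Suc 0) (h j)" "bounded {x. h j x \<noteq> 0}" for j
    unfolding h_def using w(2) by (auto intro!: Ck_mult Ck_inner Ck_component a v w elim: bounded_subset)
  have pd: "partial_deriv j (h j) x = a x $ j * (partial_deriv j v x \<bullet> w x + partial_deriv j w x \<bullet> v x)
      + partial_deriv j a x $ j * (v x \<bullet> w x)" for j x
  proof -
    have "partial_deriv j (h j) x = a x $ j * partial_deriv j (\<lambda>x. v x \<bullet> w x) x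
        + partial_deriv j (\<lambda>x. a x $ j) x * (v x \<bullet> w x)"
      unfolding h_def by (intro partial_deriv_mult Ck_differentiable[OF Ck_component[OF a(1)]] Ck_differentiable[OF Ck_inner[OF v w(1)]])
    also have "partial_deriv j (\<lambda>x. v x \<bullet> w x) x = v x \<bullet> partial_deriv j w x + partial_deriv j v x \<bullet> w x"
      by (intro partial_deriv_inner Ck_differentiable[OF v] Ck_differentiable[OF w(1)])
    also have "partial_deriv j (\<lambda>x. a x $ j) x = partial_deriv j a x $ j"
      by (intro partial_deriv_component Ck_differentiable[OF a(1)])
    finally show ?thesis by (simp add: inner_commute add.commute)
  qed
  have "(\<Sum>j\<in>UNIV. partial_deriv j (h j) x) = (gradient v x *v a x) \<bullet> w x + (gradient w x *v a x) \<bullet> v x" for x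
    using a(2)[of x]
    by (simp add: pd gradient_mult_vec inner_sum_left divergence_eq sum.distrib distrib_left
        flip: sum_distrib_right)
  then have "0 = (LINT x|lebesgue. (gradient v x *v a x) \<bullet> w x + (gradient w x *v a x) \<bullet> v x)"
    using integral_sum_partial_deriv_eq_0[of h] h by simp
  also have "\<dots> = (LINT x|lebesgue. (gradient v x *v a x) \<bullet> w x) + (LINT x|lebesgue. (gradient w x *v a x) \<bullet> v x)"
  proof (rule Bochner_Integration.integral_add)
    have mv: "continuous_on UNIV (\<lambda>x. gradient z x *v a x)" if "Ck (Suc 0) z" for z
      unfolding gradient_mult_vec
      by (intro continuous_intros Ck_continuous[OF a(1)] partial_deriv_continuous[OF that])
    show "integrable lebesgue (\<lambda>x. (gradient v x *v a x) \<bullet> w x)"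
      using w(2) by (intro integrable_continuous_bounded_support continuous_on_inner mv v Ck_continuous[OF w(1)])
        (auto elim: bounded_subset)
    show "integrable lebesgue (\<lambda>x. (gradient w x *v a x) \<bullet> v x)"
      using bounded_support_gradient[OF w(2)]
      by (intro integrable_continuous_bounded_support continuous_on_inner mv w(1) Ck_continuous[OF v])
        (auto elim: bounded_subset)
  qed
  finally show ?thesis by simp
qed

text \<open>The divergence theorem for the field with components
  \<open>v \<bullet> partial_deriv j w\<close>. The right-hand side passes to limits under
  convergence of \<open>v\<close> on balls alone.\<close>

lemma integral_gradient_inner_gradient:
  fixes v w :: "real^2 \<Rightarrow> real^2"
  assumes v: "Ck (Suc 0) v" and w: "Ck (Suc (Suc 0)) w" "bounded {x. w x \<noteq> 0}"
  shows "(LINT x|lebesgue. gradient v x \<bullet> gradient w x)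
    = - (LINT x|lebesgue. v x \<bullet> (\<Sum>j\<in>UNIV. partial_deriv j (partial_deriv j w) x))"
proof -
  define h where "h j x = v x \<bullet> partial_deriv j w x" for j x
  have w1: "Ck (Suc 0) (partial_deriv j w)" for j by (rule Ck_partial_deriv[OF w(1)])
  have s1: "bounded {x. partial_deriv j w x \<noteq> 0}" for j
    by (rule bounded_support_partial_deriv[OF w(2)])
  have h: "Ck (Suc 0) (h j)" "bounded {x. h j x \<noteq> 0}" for j
    unfolding h_def using s1[of j] by (auto intro!: Ck_inner v w1 elim: bounded_subset)
  have pd: "partial_deriv j (h j) x = v x \<bullet> partial_deriv j (partial_deriv j w) x + partial_deriv j v x \<bullet> partial_deriv j w x" for j x
    unfolding h_def by (intro partial_deriv_inner Ck_differentiable[OF v] Ck_differentiable[OF w1])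
  have "(\<Sum>j\<in>UNIV. partial_deriv j (h j) x)
      = v x \<bullet> (\<Sum>j\<in>UNIV. partial_deriv j (partial_deriv j w) x) + gradient v x \<bullet> gradient w x" for x
    by (simp add: pd gradient_inner inner_sum_right sum.distrib)
  then have "0 = (LINT x|lebesgue. v x \<bullet> (\<Sum>j\<in>UNIV. partial_deriv j (partial_deriv j w) x) + gradient v x \<bullet> gradient w x)"
    using integral_sum_partial_deriv_eq_0[of h] h by simp
  also have "\<dots> = (LINT x|lebesgue. v x \<bullet> (\<Sum>j\<in>UNIV. partial_deriv j (partial_deriv j w) x)) + (LINT x|lebesgue. gradient v x \<bullet> gradient w x)"
  proof (rule Bochner_Integration.integral_add)
    have "bounded (\<Union>j\<in>UNIV. {x. partial_deriv j (partial_deriv j w) x \<noteq> 0})"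
      using bounded_support_partial_deriv[OF s1] by auto
    moreover have "{x. v x \<bullet> (\<Sum>j\<in>UNIV. partial_deriv j (partial_deriv j w) x) \<noteq> 0} \<subseteq> (\<Union>j\<in>UNIV. {x. partial_deriv j (partial_deriv j w) x \<noteq> 0})"
      by (rule subsetI, rule ccontr) simp
    ultimately show "integrable lebesgue (\<lambda>x. v x \<bullet> (\<Sum>j\<in>UNIV. partial_deriv j (partial_deriv j w) x))"
      by (intro integrable_continuous_bounded_support continuous_intros Ck_continuous[OF v] partial_deriv_continuous[OF w1])
        (rule bounded_subset)
    show "integrable lebesgue (\<lambda>x. gradient v x \<bullet> gradient w x)"
      using bounded_support_gradient[OF w(2)]
      by (intro integrable_continuous_bounded_support continuous_on_inner continuous_on_gradient[OF v] continuous_on_gradient[OF w(1)])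
        (auto elim: bounded_subset)
  qed
  finally show ?thesis by simp
qed

section \<open>Galerkin approximations\<close>

text \<open>The value near infinity may differ from field to field: a constant is added to each
  Galerkin velocity to correct its average. Gradients nevertheless have bounded support, and
  midpoints stay in the class.\<close>

definition admissible :: "(real^2 \<Rightarrow> real^2) set" where
  "admissible = {w. Ck (Suc 0) w \<and> (\<forall>x. divergence w x = 0) \<and> (\<exists>c. bounded {x. w x \<noteq> c})}"

lemma L2_iff_square_integrable: "f \<in> L2 \<longleftrightarrow> square_integrable lebesgue f"
  by (auto simp: L2_def square_integrable_def)

lemma solenoidal_test_functionsD:
  assumes "\<phi> \<in> solenoidal_test_functions"
  shows "Ck k \<phi>" "divergence \<phi> x = 0" "bounded {x. \<phi> x \<noteq> 0}"
  using assms by (auto simp: solenoidal_test_functions_def test_functions_def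
      intro: bounded_subset[OF compact_imp_bounded closure_subset])

lemma square_integrable_continuous_bounded_support:
  fixes f :: "'a::euclidean_space \<Rightarrow> 'b::euclidean_space"
  assumes "continuous_on UNIV f" "bounded {x. f x \<noteq> 0}"
  shows "square_integrable lebesgue f"
  unfolding square_integrable_def
proof
  show "f \<in> borel_measurable lebesgue"
    using assms(1) by (intro measurable_completion) (simp add: borel_measurable_continuous_onI)
  show "integrable lebesgue (\<lambda>x. (norm (f x))\<^sup>2)"
    using assms by (intro integrable_continuous_bounded_support continuous_intros) auto
qed

lemma admissibleD:
  assumes "w \<in> admissible"
  shows "Ck (Suc 0) w" "divergence w x = 0" "square_integrable lebesgue (gradient w)"
  using assms
  by (auto simp: admissible_def intro!: square_integrable_continuous_bounded_support continuous_on_gradient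
      elim: bounded_support_gradient)

lemma sum_matrix_vector_mult: "(\<Sum>k\<in>I. c k *\<^sub>R A k) *v x = (\<Sum>k\<in>I. c k *\<^sub>R (A k *v x))"
  for A :: "'i \<Rightarrow> real^'n::finite^'m::finite"
proof (induction I rule: infinite_finite_induct)
  case (insert k I)
  then show ?case
    by (simp add: matrix_vector_mult_add_rdistrib scaleR_matrix_vector_assoc)
qed simp_all

lemma matrix_vector_mult_sum: "A *v (\<Sum>k\<in>I. c k *\<^sub>R x k) = (\<Sum>k\<in>I. c k *\<^sub>R (A *v x k))"
  for A :: "real^'n::finite^'m::finite"
  by (simp add: linear_sum[OF matrix_vector_mul_linear] linear_scale[OF matrix_vector_mul_linear])

lemma continuous_on_gradient_mult_vec:
  assumes "Ck (Suc 0) v" "continuous_on UNIV a"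
  shows "continuous_on UNIV (\<lambda>x. gradient v x *v a x)"
  unfolding gradient_mult_vec
  by (intro continuous_intros assms(2) partial_deriv_continuous[OF assms(1)])

lemma integral_sum_inner:
  assumes "\<And>i. i \<in> I \<Longrightarrow> integrable M (\<lambda>x. f x \<bullet> g i x)"
  shows "(\<Sum>i\<in>I. c i * (LINT x|M. f x \<bullet> g i x)) = (LINT x|M. f x \<bullet> (\<Sum>i\<in>I. c i *\<^sub>R g i x))"
proof -
  have "(LINT x|M. f x \<bullet> (\<Sum>i\<in>I. c i *\<^sub>R g i x)) = (LINT x|M. (\<Sum>i\<in>I. c i * (f x \<bullet> g i x)))"
    by (simp add: inner_sum_right)
  also have "\<dots> = (\<Sum>i\<in>I. LINT x|M. c i * (f x \<bullet> g i x))"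
    by (rule Bochner_Integration.integral_sum) (use assms in auto)
  finally show ?thesis by simp
qed

text \<open>The term \<open>\<delta> c\<^sub>i\<close> makes the Galerkin map coercive although the test functions may be linearly
  dependent. It costs an error of order \<open>sqrt \<delta>\<close> in the equation.\<close>

lemma galerkin_approximation:
  fixes \<phi> :: "nat \<Rightarrow> real^2 \<Rightarrow> real^2" and F :: "real^2 \<Rightarrow> real^2^2"
  assumes \<phi>: "\<And>i. \<phi> i \<in> solenoidal_test_functions" and F: "square_integrable lebesgue F"
    and \<omega>: "bounded \<omega>" "\<omega> \<in> sets lebesgue" "measure lebesgue \<omega> > 0" and "\<epsilon> > 0"
  obtains w where "w \<in> admissible" "(LINT x:\<omega>|lebesgue. w x) = measure lebesgue \<omega> *\<^sub>R \<mu>"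
    "(LINT x|lebesgue. (norm (gradient w x))\<^sup>2) \<le> (LINT x|lebesgue. F x \<bullet> gradient w x)"
    "\<And>i. i \<le> p \<Longrightarrow> \<bar>(LINT x|lebesgue. gradient w x \<bullet> gradient (\<phi> i) x)
      + (LINT x|lebesgue. (gradient w x *v w x) \<bullet> \<phi> i x) - (LINT x|lebesgue. F x \<bullet> gradient (\<phi> i) x)\<bar> \<le> \<epsilon>"
proof -
  note \<phi>D = solenoidal_test_functionsD[OF \<phi>]
  note Ck\<phi> = \<phi>D(1)[where k = "Suc 0"]
  have c\<phi>: "continuous_on UNIV (\<phi> i)" for i by (rule Ck_continuous[OF Ck\<phi>])
  have sq: "square_integrable lebesgue (gradient (\<phi> i))" for i
    by (intro square_integrable_continuous_bounded_support continuous_on_gradient[OF Ck\<phi>]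
        bounded_support_gradient[OF \<phi>D(3)])
  have i2: "integrable lebesgue (\<lambda>x. (gradient v x *v b x) \<bullet> \<phi> i x)"
    if "Ck (Suc 0) v" "continuous_on UNIV b" for v b i
    using \<phi>D(3)[of i]
    by (intro integrable_continuous_bounded_support continuous_on_inner continuous_on_gradient_mult_vec that c\<phi>)
      (auto elim: bounded_subset)
  define Fsq where "Fsq = (LINT x|lebesgue. (norm (F x))\<^sup>2)"
  have Fsq0: "0 \<le> Fsq" by (simp add: Fsq_def integral_norm_square_nonneg)
  \<comment> \<open>Chosen so that \<open>\<delta> * Fsq\<close> is at most
    \<open>\<epsilon>\<^sup>2\<close>; the summand 1 covers the case \<open>Fsq = 0\<close>.\<close>
  define \<delta> where "\<delta> = \<epsilon>\<^sup>2 / (Fsq + 1)"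
  have \<delta>: "\<delta> > 0" "\<delta> * Fsq \<le> \<epsilon>\<^sup>2" using Fsq0 \<open>\<epsilon> > 0\<close> by (auto simp: \<delta>_def field_simps)
  define m where "m i = (1 / measure lebesgue \<omega>) *\<^sub>R (LINT x:\<omega>|lebesgue. \<phi> i x)" for i
  \<comment> \<open>\<open>v\<close> carries the whole gradient and has bounded support, so the
    velocity can be tested with it; the constant \<open>d\<close> adjusts the average.\<close>
  define v where "v c x = (\<Sum>k\<le>p. c k *\<^sub>R \<phi> k x)" for c x
  define d where "d c = \<mu> - (\<Sum>k\<le>p. c k *\<^sub>R m k)" for c
  define u where "u c x = v c x + d c" for c x
  have Ckv: "Ck (Suc 0) (v c)" for c
    unfolding v_def by (intro Ck_sum Ck_scaleR Ck\<phi>)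
  have Cku: "Ck (Suc 0) (u c)" for c
    unfolding u_def by (intro Ck_add Ck_const Ckv)
  have grad_v: "gradient (v c) x = (\<Sum>k\<le>p. c k *\<^sub>R gradient (\<phi> k) x)" for c x
    unfolding v_def by (subst gradient_sum[OF Ck_scaleR[OF Ck\<phi>]]) (simp add: gradient_scaleR[OF Ck\<phi>])
  have grad_u: "gradient (u c) = gradient (v c)" for c
    unfolding u_def by (rule ext, subst gradient_add[OF Ckv Ck_const]) (simp add: gradient_const)
  have supp_v: "bounded {x. v c x \<noteq> 0}" for c
  proof (rule bounded_subset)
    show "bounded (\<Union>k\<le>p. {x. \<phi> k x \<noteq> 0})" using \<phi>D(3) by auto
    show "{x. v c x \<noteq> 0} \<subseteq> (\<Union>k\<le>p. {x. \<phi> k x \<noteq> 0})"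
      unfolding v_def by (rule subsetI, rule ccontr) simp
  qed
  have div_u: "divergence (u c) x = 0" for c x
  proof -
    have "divergence (u c) x = (\<Sum>k\<le>p. c k * divergence (\<phi> k) x)"
      unfolding divergence_def grad_u grad_v trace_def
      by (simp add: sum_component sum_distrib_left) (rule sum.swap)
    then show ?thesis by (simp add: \<phi>D)
  qed
  have adm: "u c \<in> admissible" for c
    using supp_v[of c] by (auto simp: admissible_def Cku div_u u_def intro!: exI[of _ "d c"])
  have mean: "(LINT x:\<omega>|lebesgue. u c x) = measure lebesgue \<omega> *\<^sub>R \<mu>" for c
  proof -
    have int: "set_integrable lebesgue \<omega> (\<phi> k)" for k
      by (rule continuous_set_integrable_bounded[OF c\<phi> \<omega>(1,2)])
    have fin: "set_integrable lebesgue \<omega> (\<lambda>x. a)" for a :: "real^2"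
      by (rule continuous_set_integrable_bounded[OF continuous_on_const \<omega>(1,2)])
    have "(LINT x:\<omega>|lebesgue. v c x) = (\<Sum>k\<le>p. c k *\<^sub>R (LINT x:\<omega>|lebesgue. \<phi> k x))"
    proof -
      have "(LINT x:\<omega>|lebesgue. v c x) = (LINT x|lebesgue. (\<Sum>k\<le>p. c k *\<^sub>R (indicator \<omega> x *\<^sub>R \<phi> k x)))"
        by (simp add: v_def set_lebesgue_integral_def scaleR_sum_right mult.commute)
      also have "\<dots> = (\<Sum>k\<le>p. LINT x|lebesgue. c k *\<^sub>R (indicator \<omega> x *\<^sub>R \<phi> k x))"
        by (intro Bochner_Integration.integral_sum integrable_scaleR_right int[unfolded set_integrable_def])
      finally show ?thesis unfolding set_lebesgue_integral_def integral_scaleR_right .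
    qed
    also have "\<dots> = measure lebesgue \<omega> *\<^sub>R (\<Sum>k\<le>p. c k *\<^sub>R m k)"
      using \<omega>(3) by (simp add: m_def scaleR_sum_right)
    finally have "(LINT x:\<omega>|lebesgue. v c x) = measure lebesgue \<omega> *\<^sub>R (\<Sum>k\<le>p. c k *\<^sub>R m k)" .
    moreover have "set_integrable lebesgue \<omega> (v c)"
      by (rule continuous_set_integrable_bounded[OF Ck_continuous[OF Ckv] \<omega>(1,2)])
    moreover have "(LINT x:\<omega>|lebesgue. d c) = measure lebesgue \<omega> *\<^sub>R d c"
    proof -
      have "integrable lebesgue (indicator \<omega> :: _ \<Rightarrow> real)"
        using continuous_set_integrable_bounded[OF continuous_on_const \<omega>(1,2), of "1 :: real"]
        by (simp add: set_integrable_def)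
      from integral_scaleR_left[OF this] show ?thesis by (simp add: set_lebesgue_integral_def)
    qed
    ultimately show ?thesis
      unfolding u_def by (subst set_integral_add(2)[OF _ fin]) (simp_all add: d_def algebra_simps)
  qed
  define E1 where "E1 c i = (LINT x|lebesgue. gradient (u c) x \<bullet> gradient (\<phi> i) x)" for c i
  define E2 where "E2 c i = (LINT x|lebesgue. (gradient (u c) x *v u c x) \<bullet> \<phi> i x)" for c i
  define E3 where "E3 i = (LINT x|lebesgue. F x \<bullet> gradient (\<phi> i) x)" for i
  define P where "P c i = E1 c i + E2 c i - E3 i + \<delta> * c i" for c i
  have sqv: "square_integrable lebesgue (gradient (v c))" for c
    by (intro square_integrable_continuous_bounded_support continuous_on_gradient[OF Ckv]
        bounded_support_gradient[OF supp_v])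
  \<comment> \<open>Expanding in the coefficients shows that the Galerkin map is polynomial in
    \<open>c\<close>, hence continuous.\<close>
  have E1: "E1 c i = (\<Sum>k\<le>p. c k * (LINT x|lebesgue. gradient (\<phi> i) x \<bullet> gradient (\<phi> k) x))" for c i
    unfolding E1_def grad_u grad_v
    by (subst integral_sum_inner) (auto intro: integrable_inner_square_integrable sq simp: inner_commute)
  have E2: "E2 c i = (\<Sum>k\<le>p. c k * ((LINT x|lebesgue. (gradient (\<phi> k) x *v \<mu>) \<bullet> \<phi> i x)
      + (\<Sum>l\<le>p. c l * (LINT x|lebesgue. (gradient (\<phi> k) x *v (\<phi> l x - m l)) \<bullet> \<phi> i x))))" for c i
  proof -
    have u: "u c x = \<mu> + (\<Sum>l\<le>p. c l *\<^sub>R (\<phi> l x - m l))" for x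
      by (simp add: u_def v_def d_def scaleR_diff_right sum_subtractf)
    have "E2 c i = (LINT x|lebesgue. (\<Sum>k\<le>p. c k * ((gradient (\<phi> k) x *v \<mu>) \<bullet> \<phi> i x
      + (\<Sum>l\<le>p. c l * ((gradient (\<phi> k) x *v (\<phi> l x - m l)) \<bullet> \<phi> i x)))))"
      unfolding E2_def grad_u grad_v u sum_matrix_vector_mult
      unfolding matrix_vector_right_distrib matrix_vector_mult_sum
      by (simp add: inner_sum_left inner_add_left)
    also have "\<dots> = (\<Sum>k\<le>p. c k * ((LINT x|lebesgue. (gradient (\<phi> k) x *v \<mu>) \<bullet> \<phi> i x)
      + (\<Sum>l\<le>p. c l * (LINT x|lebesgue. (gradient (\<phi> k) x *v (\<phi> l x - m l)) \<bullet> \<phi> i x))))"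
    proof -
      have a: "integrable lebesgue (\<lambda>x. (gradient (\<phi> k) x *v \<mu>) \<bullet> \<phi> i x)" for k
        by (rule i2[OF Ck\<phi> continuous_on_const])
      have b: "integrable lebesgue (\<lambda>x. (gradient (\<phi> k) x *v (\<phi> l x - m l)) \<bullet> \<phi> i x)" for k l
        by (intro i2[OF Ck\<phi>] continuous_intros c\<phi>)
      show ?thesis by (simp add: Bochner_Integration.integral_sum a b)
    qed
    finally show ?thesis .
  qed
  have cont: "continuous_on UNIV (\<lambda>c. P c i)" for i
    unfolding P_def E1 E2 by (intro continuous_intros) auto
  have pair: "(\<Sum>i\<le>p. P c i * c i) = (LINT x|lebesgue. (norm (gradient (v c) x))\<^sup>2)
      - (LINT x|lebesgue. F x \<bullet> gradient (v c) x) + \<delta> * (\<Sum>i\<le>p. (c i)\<^sup>2)" for c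
  proof -
    have "(\<Sum>i\<le>p. c i * E1 c i) = (LINT x|lebesgue. (norm (gradient (v c) x))\<^sup>2)"
      unfolding E1_def grad_u
      by (subst integral_sum_inner) (auto intro: integrable_inner_square_integrable sq sqv simp: power2_norm_eq_inner simp flip: grad_v)
    moreover have "(\<Sum>i\<le>p. c i * E2 c i) = 0"
    proof -
      have "(\<Sum>i\<le>p. c i * E2 c i) = (LINT x|lebesgue. (gradient (v c) x *v u c x) \<bullet> v c x)"
        unfolding E2_def grad_u
        by (subst integral_sum_inner) (auto intro!: i2 Ckv Ck_continuous[OF Cku] simp flip: v_def)
      \<comment> \<open>\<open>v\<close> is transported by the divergence-free \<open>u\<close> and
        tested with itself, so by antisymmetry the integral is its own negative.\<close>
      also have "\<dots> = 0"
        by (rule equal_neg_zero[THEN iffD1]) (rule convection_antisymmetric[OF Cku div_u Ckv Ckv supp_v])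
      finally show ?thesis .
    qed
    moreover have "(\<Sum>i\<le>p. c i * E3 i) = (LINT x|lebesgue. F x \<bullet> gradient (v c) x)"
      unfolding E3_def
      by (subst integral_sum_inner) (auto intro: integrable_inner_square_integrable sq F simp flip: grad_v)
    moreover have "(\<Sum>i\<le>p. P c i * c i) = (\<Sum>i\<le>p. c i * E1 c i) + (\<Sum>i\<le>p. c i * E2 c i)
        - (\<Sum>i\<le>p. c i * E3 i) + \<delta> * (\<Sum>i\<le>p. (c i)\<^sup>2)"
      by (simp add: P_def algebra_simps power2_eq_square sum.distrib sum_subtractf sum_distrib_left)
    ultimately show ?thesis by simp
  qed
  have young: "(LINT x|lebesgue. F x \<bullet> gradient (v c) x) \<le> (LINT x|lebesgue. (norm (gradient (v c) x))\<^sup>2) + Fsq" for c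
  proof -
    have "0 \<le> (LINT x|lebesgue. (norm (F x - gradient (v c) x))\<^sup>2)" by (rule integral_norm_square_nonneg)
    then have "2 * (LINT x|lebesgue. F x \<bullet> gradient (v c) x) \<le> Fsq + (LINT x|lebesgue. (norm (gradient (v c) x))\<^sup>2)"
      unfolding integral_norm_diff_square[OF F sqv] Fsq_def by simp
    then show ?thesis using Fsq0 integral_norm_square_nonneg[of lebesgue "gradient (v c)"] by linarith
  qed
  obtain c where c: "\<And>i. i \<le> p \<Longrightarrow> P c i = 0"
  proof -
    have "\<exists>c. \<forall>i\<le>p. P c i = 0"
    \<comment> \<open>On this sphere the penalty contributes \<open>Fsq + 1\<close>, one more than
      the term with \<open>F\<close> can take away by Young's inequality.\<close>
    proof (rule coercive_has_zero[where r = "sqrt ((Fsq + 1) / \<delta>)"])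
      show "0 < sqrt ((Fsq + 1) / \<delta>)" using Fsq0 \<delta> by simp
      show "(\<Sum>i\<le>p. P c i * c i) > 0" if "(\<Sum>i\<le>p. (c i)\<^sup>2) = (sqrt ((Fsq + 1) / \<delta>))\<^sup>2" for c
      proof -
        have "\<delta> * (\<Sum>i\<le>p. (c i)\<^sup>2) = Fsq + 1" using that Fsq0 \<delta> by simp
        then show ?thesis using young[of c] by (simp add: pair)
      qed
    qed (rule cont)
    then show ?thesis using that by blast
  qed
  then have zero: "(LINT x|lebesgue. (norm (gradient (v c) x))\<^sup>2)
      - (LINT x|lebesgue. F x \<bullet> gradient (v c) x) + \<delta> * (\<Sum>i\<le>p. (c i)\<^sup>2) = 0"
    using pair[of c] by simp
  have "0 \<le> \<delta> * (\<Sum>i\<le>p. (c i)\<^sup>2)" using \<delta> by (simp add: sum_nonneg)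
  then have energy: "(LINT x|lebesgue. (norm (gradient (u c) x))\<^sup>2) \<le> (LINT x|lebesgue. F x \<bullet> gradient (u c) x)"
    using zero by (simp add: grad_u)
  have res: "\<bar>E1 c i + E2 c i - E3 i\<bar> \<le> \<epsilon>" if "i \<le> p" for i
  proof -
    \<comment> \<open>The energy balance together with Young's inequality leaves at most
      \<open>Fsq\<close> for the penalty, so the defect \<open>\<delta> * c i\<close> has square at
      most \<open>\<delta> * Fsq\<close>.\<close>
    have "(\<delta> * c i)\<^sup>2 \<le> \<delta> * (\<delta> * (\<Sum>i\<le>p. (c i)\<^sup>2))"
      using \<delta> that member_le_sum[of i "{..p}" "\<lambda>i. (c i)\<^sup>2"]
      by (simp add: power_mult_distrib power2_eq_square mult.assoc)
    also have "\<dots> \<le> \<delta> * Fsq"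
      using zero young[of c] \<delta> by (intro mult_left_mono) auto
    also have "\<dots> \<le> \<epsilon>\<^sup>2" by (rule \<delta>)
    finally have "\<bar>\<delta> * c i\<bar> \<le> \<epsilon>" using \<open>\<epsilon> > 0\<close> by (simp add: abs_le_square_iff[symmetric])
    moreover have "E1 c i + E2 c i - E3 i = - (\<delta> * c i)" using c[OF that] by (simp add: P_def)
    ultimately show ?thesis by simp
  qed
  show ?thesis
    by (rule that[OF adm mean energy]) (use res in \<open>simp add: E1_def E2_def E3_def\<close>)
qed

section \<open>Local compactness from averages over small squares\<close>

text \<open>Half-open cells of side 1/N: for fixed \<open>N > 0\<close> they partition the plane,
  and floors name the cell of a point.\<close>

definition square :: "nat \<times> int \<times> int \<Rightarrow> (real^2) set" where
  "square = (\<lambda>(N, k, l). {x. \<lfloor>real N * x $ 1\<rfloor> = k \<and> \<lfloor>real N * x $ 2\<rfloor> = l})"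

lemma mem_square:
  "x \<in> square (N, k, l) \<longleftrightarrow> of_int k \<le> real N * x $ 1 \<and> real N * x $ 1 < of_int k + 1
    \<and> of_int l \<le> real N * x $ 2 \<and> real N * x $ 2 < of_int l + 1"
  by (auto simp: square_def floor_eq_iff)

lemma square_eq_halfspaces:
  "square (N, k, l) = {x. (real N *\<^sub>R axis 1 1) \<bullet> x \<ge> of_int k} \<inter> {x. (real N *\<^sub>R axis 1 1) \<bullet> x < of_int k + 1}
    \<inter> {x. (real N *\<^sub>R axis 2 1) \<bullet> x \<ge> of_int l} \<inter> {x. (real N *\<^sub>R axis 2 1) \<bullet> x < of_int l + 1}"
  by (auto simp: mem_square inner_axis')

lemma convex_square: "convex (square p)"
  by (cases p) (auto simp only: square_eq_halfspaces intro!: convex_Int convex_halfspace_ge convex_halfspace_lt)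

lemma square_borel: "square p \<in> sets borel"
  by (cases p) (simp only: square_eq_halfspaces sets.Int borel_closed[OF closed_halfspace_ge]
      borel_open[OF open_halfspace_lt])

text \<open>Serves both as a large domain and as the set \<open>H\<close> of differences in
  \<open>poincare_inequality\<close>.\<close>

definition centred_square :: "real \<Rightarrow> (real^2) set" where
  "centred_square r = cbox (\<chi> i. - r) (\<chi> i. r)"

lemma mem_centred_square: "x \<in> centred_square r \<longleftrightarrow> (\<forall>i. \<bar>x $ i\<bar> \<le> r)"
  by (simp add: centred_square_def mem_box_cart abs_le_iff minus_le_iff[of r] conj_commute)

lemma bounded_square:
  assumes "N > 0"
  shows "bounded (square (N, k, l))"
proof (rule bounded_subset[OF bounded_cbox])
  show "square (N, k, l) \<subseteq> cbox (vector [of_int k / real N, of_int l / real N])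
      (vector [(of_int k + 1) / real N, (of_int l + 1) / real N])"
    using assms by (auto simp: mem_square mem_box_cart forall_2 vector_2 field_simps)
qed

lemma measure_square_ge:
  assumes "N > 0"
  shows "1 / (real N)\<^sup>2 \<le> measure lebesgue (square (N, k, l))"
proof -
  let ?a = "vector [of_int k / real N, of_int l / real N] :: real^2"
  let ?b = "vector [(of_int k + 1) / real N, (of_int l + 1) / real N] :: real^2"
  have le: "?a $ i \<le> ?b $ i" for i
    using assms exhaust_2[of i] by (auto simp: vector_2 divide_right_mono)
  have "1 / (real N)\<^sup>2 = measure lborel (cbox ?a ?b)"
  proof -
    have "cbox ?a ?b \<noteq> {}" using le by (simp add: interval_ne_empty_cart)
    then show ?thesis using assms
      by (simp add: content_cbox_cart UNIV_2 vector_2 power2_eq_square diff_divide_distrib[symmetric])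
  qed
  also have "\<dots> = measure lborel (box ?a ?b)"
    by (simp add: measure_lborel_box_eq measure_lborel_cbox_eq)
  also have "\<dots> = measure lebesgue (box ?a ?b)" by simp
  also have "\<dots> \<le> measure lebesgue (square (N, k, l))"
  proof (rule measure_mono_fmeasurable)
    show "box ?a ?b \<subseteq> square (N, k, l)"
      using assms by (auto simp: mem_square mem_box_cart forall_2 vector_2 field_simps)
    show "square (N, k, l) \<in> lmeasurable"
      by (rule bounded_set_imp_lmeasurable[OF bounded_square[OF assms]]) (use square_borel in simp)
  qed simp
  finally show ?thesis .
qed

lemma measure_centred_square: "r \<ge> 0 \<Longrightarrow> measure lebesgue (centred_square r) = 4 * r\<^sup>2"
  by (simp add: centred_square_def content_cbox_cart interval_ne_empty_cart UNIV_2 power2_eq_square)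

text \<open>\<open>poincare_inequality\<close> with \<open>A = Q\<close>. Differences lie in a
  square of area \<open>4 / N\<^sup>2\<close> and have length at most \<open>2 / N\<close>, and the
  cell has area at least \<open>1 / N\<^sup>2\<close>: half of \<open>16 / N^4\<close>, times
  \<open>N\<^sup>2\<close>, is the factor \<open>8 / N\<^sup>2\<close>. Its decay in
  \<open>N\<close> is the source of compactness.\<close>

lemma poincare_square:
  assumes f: "Ck (Suc 0) f" and "N > 0"
  shows "(LINT x:square (N, k, l)|lebesgue. (norm (f x))\<^sup>2)
    \<le> (real N)\<^sup>2 * (norm (LINT x:square (N, k, l)|lebesgue. f x))\<^sup>2
      + 8 / (real N)\<^sup>2 * (LINT x:square (N, k, l)|lebesgue. (norm (gradient f x))\<^sup>2)"
proof -
  let ?Q = "square (N, k, l)"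
  define q where "q = measure lebesgue ?Q"
  define S where "S = (LINT x:?Q|lebesgue. (norm (f x))\<^sup>2)"
  define I where "I = (LINT x:?Q|lebesgue. (norm (gradient f x))\<^sup>2)"
  define m where "m = (LINT x:?Q|lebesgue. f x)"
  have S0: "S \<ge> 0" by (simp add: S_def set_lebesgue_integral_def)
  have "q * S + q * S - 2 * (m \<bullet> m) \<le> measure lebesgue (centred_square (1 / real N)) * (2 / real N)\<^sup>2 * I"
    unfolding q_def S_def I_def m_def
  proof (rule poincare_inequality)
    show "(f has_derivative frechet_derivative f (at x)) (at x)" for x by (rule Ck_has_derivative[OF f])
    show "onorm (frechet_derivative f (at x)) \<le> norm (gradient f x)" for x
      by (rule onorm_frechet_derivative_le[OF f])
    show "continuous_on UNIV (\<lambda>x. norm (gradient f x))"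
      by (intro continuous_intros continuous_on_gradient[OF f])
    show "emeasure lborel (centred_square (1 / real N)) < \<infinity>"
      using emeasure_lborel_cbox_finite unfolding centred_square_def infinity_ennreal_def less_top by blast
    show "y - x \<in> centred_square (1 / real N) \<and> norm (y - x) \<le> 2 / real N" if "x \<in> ?Q" "y \<in> ?Q" for x y
    proof -
      have "\<bar>real N * (y - x) $ 1\<bar> \<le> 1" "\<bar>real N * (y - x) $ 2\<bar> \<le> 1"
        using that by (auto simp: mem_square right_diff_distrib)
      then have *: "\<bar>(y - x) $ 1\<bar> \<le> 1 / real N" "\<bar>(y - x) $ 2\<bar> \<le> 1 / real N"
      proof -
        have "\<bar>t\<bar> \<le> 1 / real N" if "\<bar>real N * t\<bar> \<le> 1" for t
          using that \<open>N > 0\<close> by (simp add: abs_mult field_simps)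
        then show "\<bar>(y - x) $ 1\<bar> \<le> 1 / real N" "\<bar>(y - x) $ 2\<bar> \<le> 1 / real N"
          using \<open>\<bar>real N * (y - x) $ 1\<bar> \<le> 1\<close> \<open>\<bar>real N * (y - x) $ 2\<bar> \<le> 1\<close> by blast+
      qed
      then have "norm (y - x) \<le> 1 / real N + 1 / real N"
        using norm_le_l1_cart[of "y - x"] unfolding UNIV_2 by simp
      then show ?thesis using * by (simp add: mem_centred_square forall_2)
    qed
  qed (use \<open>N > 0\<close> in \<open>auto simp: centred_square_def convex_square square_borel bounded_square\<close>)
  then have "2 * (q * S) \<le> 2 * (norm m)\<^sup>2 + 16 / (real N)^4 * I"
    using \<open>N > 0\<close> by (simp add: measure_centred_square dot_square_norm power_divide eval_nat_numeral field_simps)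
  moreover have "1 / (real N)\<^sup>2 * S \<le> q * S"
    unfolding q_def by (intro mult_right_mono measure_square_ge \<open>N > 0\<close> S0)
  ultimately have "1 / (real N)\<^sup>2 * S \<le> (norm m)\<^sup>2 + 8 / (real N)^4 * I" by simp
  then have "(real N)\<^sup>2 * (1 / (real N)\<^sup>2 * S) \<le> (real N)\<^sup>2 * ((norm m)\<^sup>2 + 8 / (real N)^4 * I)"
    by (rule mult_left_mono) simp
  then show ?thesis using \<open>N > 0\<close>
    by (simp add: S_def I_def m_def distrib_left eval_nat_numeral)
qed

text \<open>Finitely many cells cover the ball, and as they are disjoint, their Poincare
  inequalities add up with the gradient counted only once. A fine scale makes the gradient term
  small and still involves finitely many averages.\<close>

lemma integral_norm_square_ball_le:
  fixes f :: "real^2 \<Rightarrow> real^2" and R N :: nat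
  assumes f: "Ck (Suc 0) f" and g: "square_integrable lebesgue (gradient f)" and "N > 0"
  defines "J \<equiv> {- int (N * R) - 1..int (N * R)} \<times> {- int (N * R) - 1..int (N * R)}"
  shows "(LINT x:cball 0 (real R)|lebesgue. (norm (f x))\<^sup>2)
    \<le> (real N)\<^sup>2 * (\<Sum>(k, l)\<in>J. (norm (LINT x:square (N, k, l)|lebesgue. f x))\<^sup>2)
      + 8 / (real N)\<^sup>2 * (LINT x|lebesgue. (norm (gradient f x))\<^sup>2)"
proof -
  have fin: "finite J" by (simp add: J_def)
  \<comment> \<open>Exactly one cell of the scale contains \<open>x\<close>, so the sum of
    indicators only asks whether the index of that cell is in \<open>J\<close>.\<close>
  have cover: "(\<Sum>p\<in>J. indicator (square (N, p)) x) = (indicator J (\<lfloor>real N * x $ 1\<rfloor>, \<lfloor>real N * x $ 2\<rfloor>) :: real)" for x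
  proof -
    have "(\<Sum>p\<in>J. indicator (square (N, p)) x)
        = (\<Sum>p\<in>J. if p = (\<lfloor>real N * x $ 1\<rfloor>, \<lfloor>real N * x $ 2\<rfloor>) then 1 else (0::real))"
      by (intro sum.cong) (auto simp: square_def indicator_def split: prod.splits)
    then show ?thesis using fin by (simp add: indicator_def)
  qed
  have QS: "square (N, p) \<in> sets lebesgue" for p using square_borel by simp
  have Qb: "bounded (square (N, p))" for p using bounded_square[OF \<open>N > 0\<close>] by (cases p) simp
  have cf: "continuous_on UNIV (\<lambda>x. (norm (f x))\<^sup>2)" "continuous_on UNIV (\<lambda>x. (norm (gradient f x))\<^sup>2)"
    by (intro continuous_intros Ck_continuous[OF f] continuous_on_gradient[OF f])+
  have intQ: "integrable lebesgue (\<lambda>x. indicator (square (N, p)) x * (norm (f x))\<^sup>2)"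
    "integrable lebesgue (\<lambda>x. indicator (square (N, p)) x * (norm (gradient f x))\<^sup>2)" for p
    using continuous_set_integrable_bounded[OF cf(1) Qb QS] continuous_set_integrable_bounded[OF cf(2) Qb QS]
    by (simp_all add: set_integrable_def)
  have "(LINT x:cball 0 (real R)|lebesgue. (norm (f x))\<^sup>2)
      \<le> (LINT x|lebesgue. (\<Sum>p\<in>J. indicator (square (N, p)) x * (norm (f x))\<^sup>2))"
    unfolding set_lebesgue_integral_def
  proof (rule integral_mono)
    show "integrable lebesgue (\<lambda>x. indicator (cball 0 (real R)) x *\<^sub>R (norm (f x))\<^sup>2)"
      using continuous_set_integrable_bounded[OF cf(1) bounded_cball] by (simp add: set_integrable_def)
    show "integrable lebesgue (\<lambda>x. \<Sum>p\<in>J. indicator (square (N, p)) x * (norm (f x))\<^sup>2)"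
      by (intro Bochner_Integration.integrable_sum intQ)
    show "indicator (cball 0 (real R)) x *\<^sub>R (norm (f x))\<^sup>2 \<le> (\<Sum>p\<in>J. indicator (square (N, p)) x * (norm (f x))\<^sup>2)" for x
    proof (cases "x \<in> cball 0 (real R)")
      case True
      have "\<lfloor>real N * x $ i\<rfloor> \<in> {- int (N * R) - 1..int (N * R)}" for i
      proof -
        have "\<bar>x $ i\<bar> \<le> real R" using True component_le_norm_cart[of x i] by simp
        then have "real N * \<bar>x $ i\<bar> \<le> real N * real R" by (intro mult_left_mono) auto
        then have "\<bar>real N * x $ i\<bar> \<le> real (N * R)" by (simp add: abs_mult)
        then show ?thesis by (auto simp: abs_le_iff le_floor_iff floor_le_iff)
      qed
      then have "(\<lfloor>real N * x $ 1\<rfloor>, \<lfloor>real N * x $ 2\<rfloor>) \<in> J" by (simp add: J_def)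
      then show ?thesis using True by (simp add: cover flip: sum_distrib_right)
    qed (simp add: sum_nonneg)
  qed
  also have "\<dots> = (\<Sum>p\<in>J. LINT x:square (N, p)|lebesgue. (norm (f x))\<^sup>2)"
    unfolding set_lebesgue_integral_def real_scaleR_def by (rule Bochner_Integration.integral_sum) (rule intQ)
  also have "\<dots> \<le> (\<Sum>p\<in>J. (real N)\<^sup>2 * (norm (LINT x:square (N, p)|lebesgue. f x))\<^sup>2
      + 8 / (real N)\<^sup>2 * (LINT x:square (N, p)|lebesgue. (norm (gradient f x))\<^sup>2))"
    by (intro sum_mono) (use poincare_square[OF f \<open>N > 0\<close>] in \<open>auto split: prod.splits\<close>)
  also have "\<dots> = (real N)\<^sup>2 * (\<Sum>p\<in>J. (norm (LINT x:square (N, p)|lebesgue. f x))\<^sup>2)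
      + 8 / (real N)\<^sup>2 * (\<Sum>p\<in>J. LINT x:square (N, p)|lebesgue. (norm (gradient f x))\<^sup>2)"
    by (simp add: sum.distrib sum_distrib_left)
  also have "(\<Sum>p\<in>J. LINT x:square (N, p)|lebesgue. (norm (gradient f x))\<^sup>2)
      = (LINT x|lebesgue. (\<Sum>p\<in>J. indicator (square (N, p)) x * (norm (gradient f x))\<^sup>2))"
    unfolding set_lebesgue_integral_def real_scaleR_def by (rule Bochner_Integration.integral_sum[symmetric]) (rule intQ)
  also have "\<dots> \<le> (LINT x|lebesgue. (norm (gradient f x))\<^sup>2)"
  proof (rule integral_mono)
    show "(\<Sum>p\<in>J. indicator (square (N, p)) x * (norm (gradient f x))\<^sup>2) \<le> (norm (gradient f x))\<^sup>2" for x
      by (simp add: cover flip: sum_distrib_right) (simp add: indicator_def)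
  qed (use g intQ in \<open>auto simp: square_integrable_def intro!: Bochner_Integration.integrable_sum\<close>)
  finally show ?thesis by (simp add: case_prod_unfold mult_left_mono divide_right_mono)
qed

text \<open>In \<open>poincare_inequality\<close> the product term vanishes and the term with the
  integral over \<open>A\<close> is nonnegative. Differences of points of the square lie in
  \<open>centred_square (2 * r)\<close>, of area \<open>16 * r\<^sup>2\<close>, and have length at
  most \<open>4 * r\<close>.\<close>

lemma integral_norm_square_le_if_integral_eq_0:
  fixes f :: "real^2 \<Rightarrow> real^2"
  assumes f: "Ck (Suc 0) f" and g: "square_integrable lebesgue (gradient f)" and "r \<ge> 0"
    and A: "A \<subseteq> centred_square r" "A \<in> sets lebesgue" "measure lebesgue A > 0" "(LINT x:A|lebesgue. f x) = 0"
  shows "(LINT x:centred_square r|lebesgue. (norm (f x))\<^sup>2)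
    \<le> 16 * r\<^sup>2 * (4 * r)\<^sup>2 / measure lebesgue A * (LINT x|lebesgue. (norm (gradient f x))\<^sup>2)"
proof -
  let ?Q = "centred_square r"
  have Q: "convex ?Q" "bounded ?Q" "?Q \<in> sets borel" by (auto simp: centred_square_def)
  have "measure lebesgue A * (LINT x:?Q|lebesgue. (norm (f x))\<^sup>2) + measure lebesgue ?Q * (LINT x:A|lebesgue. (norm (f x))\<^sup>2)
      - 2 * ((LINT x:A|lebesgue. f x) \<bullet> (LINT x:?Q|lebesgue. f x))
    \<le> measure lebesgue (centred_square (2 * r)) * (4 * r)\<^sup>2 * (LINT x:?Q|lebesgue. (norm (gradient f x))\<^sup>2)"
  proof (rule poincare_inequality)
    show "(f has_derivative frechet_derivative f (at x)) (at x)" for x by (rule Ck_has_derivative[OF f])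
    show "onorm (frechet_derivative f (at x)) \<le> norm (gradient f x)" for x
      by (rule onorm_frechet_derivative_le[OF f])
    show "continuous_on UNIV (\<lambda>x. norm (gradient f x))"
      by (intro continuous_intros continuous_on_gradient[OF f])
    show "emeasure lborel (centred_square (2 * r)) < \<infinity>"
      using emeasure_lborel_cbox_finite unfolding centred_square_def infinity_ennreal_def less_top by blast
    show "y - x \<in> centred_square (2 * r) \<and> norm (y - x) \<le> 4 * r" if "x \<in> ?Q" "y \<in> ?Q" for x y
    proof -
      have *: "\<bar>(y - x) $ i\<bar> \<le> 2 * r" for i
        using that abs_triangle_ineq4[of "y $ i" "x $ i"] unfolding mem_centred_square
        by (metis add_mono mult_2 order_trans vector_minus_component)
      have "norm (y - x) \<le> 2 * r + 2 * r"
        using norm_le_l1_cart[of "y - x"] *[of 1] *[of 2] unfolding UNIV_2 by simp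
      then show ?thesis using * by (simp add: mem_centred_square)
    qed
  qed (use Q A in \<open>auto simp: centred_square_def\<close>)
  moreover have "0 \<le> measure lebesgue ?Q * (LINT x:A|lebesgue. (norm (f x))\<^sup>2)"
    by (simp add: set_lebesgue_integral_def)
  moreover have "(LINT x:?Q|lebesgue. (norm (gradient f x))\<^sup>2) \<le> (LINT x|lebesgue. (norm (gradient f x))\<^sup>2)"
    unfolding set_lebesgue_integral_def
  proof (rule integral_mono)
    show "integrable lebesgue (\<lambda>x. indicator ?Q x *\<^sub>R (norm (gradient f x))\<^sup>2)"
      using Q by (intro continuous_set_integrable_bounded[unfolded set_integrable_def] continuous_intros
          continuous_on_gradient[OF f]) auto
  qed (use g in \<open>auto simp: square_integrable_def indicator_def\<close>)
  then have "16 * r\<^sup>2 * (4 * r)\<^sup>2 * (LINT x:?Q|lebesgue. (norm (gradient f x))\<^sup>2)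
      \<le> 16 * r\<^sup>2 * (4 * r)\<^sup>2 * (LINT x|lebesgue. (norm (gradient f x))\<^sup>2)"
    by (rule mult_left_mono) simp
  ultimately have "measure lebesgue A * (LINT x:?Q|lebesgue. (norm (f x))\<^sup>2)
      \<le> 16 * r\<^sup>2 * (4 * r)\<^sup>2 * (LINT x|lebesgue. (norm (gradient f x))\<^sup>2)"
    using A(4) \<open>r \<ge> 0\<close> by (simp add: measure_centred_square power_mult_distrib)
  then show ?thesis using A(3) by (simp add: field_simps)
qed

section \<open>Approximate solutions, their moments and the energy inequality\<close>

definition residual :: "(real^2 \<Rightarrow> real^2^2) \<Rightarrow> (real^2 \<Rightarrow> real^2) \<Rightarrow> (real^2 \<Rightarrow> real^2) \<Rightarrow> real" where
  "residual F w \<phi> = (LINT x|lebesgue. gradient w x \<bullet> gradient \<phi> x)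
    + (LINT x|lebesgue. (gradient w x *v w x) \<bullet> \<phi> x) - (LINT x|lebesgue. F x \<bullet> gradient \<phi> x)"

text \<open>The shift avoids squares of scale \<open>N = 0\<close>, one of which is the whole plane.\<close>

definition moment :: "(real^2 \<Rightarrow> real^2) \<Rightarrow> nat \<times> int \<times> int \<Rightarrow> real^2" where
  "moment w p = (LINT x:square (Suc (fst p), snd p)|lebesgue. w x)"

text \<open>What all Galerkin approximations share, whatever test functions and accuracy they were
  built for.\<close>

definition energy_class :: "(real^2 \<Rightarrow> real^2^2) \<Rightarrow> (real^2) set \<Rightarrow> real^2 \<Rightarrow> (real^2 \<Rightarrow> real^2) set" where
  "energy_class F \<omega> \<mu> = {w \<in> admissible. (LINT x:\<omega>|lebesgue. w x) = measure lebesgue \<omega> *\<^sub>R \<mu> \<and>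
    (LINT x|lebesgue. (norm (gradient w x))\<^sup>2) \<le> (LINT x|lebesgue. F x \<bullet> gradient w x)}"

text \<open>All conditions are convex in \<open>w\<close>.\<close>

definition tail_class :: "(real^2 \<Rightarrow> real^2^2) \<Rightarrow> (real^2) set \<Rightarrow> real^2 \<Rightarrow> (nat \<times> int \<times> int \<Rightarrow> real^2) \<Rightarrow> real
    \<Rightarrow> nat \<Rightarrow> (real^2 \<Rightarrow> real^2) set" where
  "tail_class F \<omega> \<mu> a l n = {w \<in> admissible. (LINT x:\<omega>|lebesgue. w x) = measure lebesgue \<omega> *\<^sub>R \<mu> \<and>
    (\<forall>p\<in>{..n} \<times> {- int n..int n} \<times> {- int n..int n}. norm (moment w p - a p) \<le> 1 / real (Suc n)) \<and>
    \<bar>(LINT x|lebesgue. F x \<bullet> gradient w x) - l\<bar> \<le> 1 / real (Suc n) \<and>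
    (LINT x|lebesgue. (norm (gradient w x))\<^sup>2) \<le> l + 1 / real (Suc n)}"

text \<open>Expanding the squared norm of \<open>F - gradient w\<close> bounds twice the pairing by
  the squared norms of \<open>F\<close> and of the gradient; the latter is at most the pairing
  itself and is absorbed.\<close>

lemma energy_class_bounds:
  assumes F: "square_integrable lebesgue F" and w: "w \<in> energy_class F \<omega> \<mu>"
  shows "0 \<le> (LINT x|lebesgue. F x \<bullet> gradient w x)"
    "(LINT x|lebesgue. F x \<bullet> gradient w x) \<le> (LINT x|lebesgue. (norm (F x))\<^sup>2)"
    "(LINT x|lebesgue. (norm (gradient w x))\<^sup>2) \<le> (LINT x|lebesgue. (norm (F x))\<^sup>2)"
proof -
  have sq: "square_integrable lebesgue (gradient w)" using w admissibleD by (auto simp: energy_class_def)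
  have e: "(LINT x|lebesgue. (norm (gradient w x))\<^sup>2) \<le> (LINT x|lebesgue. F x \<bullet> gradient w x)"
    using w by (simp add: energy_class_def)
  have "0 \<le> (LINT x|lebesgue. (norm (F x - gradient w x))\<^sup>2)" by (rule integral_norm_square_nonneg)
  then have y: "0 \<le> (LINT x|lebesgue. (norm (F x))\<^sup>2) - 2 * (LINT x|lebesgue. F x \<bullet> gradient w x)
      + (LINT x|lebesgue. (norm (gradient w x))\<^sup>2)"
    unfolding integral_norm_diff_square[OF F sq] .
  show "0 \<le> (LINT x|lebesgue. F x \<bullet> gradient w x)"
    using e integral_norm_square_nonneg[of lebesgue "gradient w"] by linarith
  show u: "(LINT x|lebesgue. F x \<bullet> gradient w x) \<le> (LINT x|lebesgue. (norm (F x))\<^sup>2)"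
    using e y by linarith
  show "(LINT x|lebesgue. (norm (gradient w x))\<^sup>2) \<le> (LINT x|lebesgue. (norm (F x))\<^sup>2)"
    using e u by linarith
qed

lemma bounded_subset_centred_square:
  assumes "bounded A"
  obtains r where "r \<ge> 0" "A \<subseteq> centred_square r"
proof -
  obtain r where r: "r > 0" "\<And>x. x \<in> A \<Longrightarrow> norm x \<le> r" using assms bounded_pos by blast
  have "A \<subseteq> centred_square r"
    using r(2) component_le_norm_cart order_trans by (fastforce simp: mem_centred_square)
  then show ?thesis using r(1) that[of r] by simp
qed

text \<open>After subtraction of \<mu> the integral over \<omega> is 0, so the Poincare inequality
  on a square containing both \<omega> and the cell bounds the field in \<open>L2\<close> uniformly
  over the class.\<close>

lemma moment_bounded:
  assumes F: "square_integrable lebesgue F"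
    and \<omega>: "bounded \<omega>" "\<omega> \<in> sets lebesgue" "measure lebesgue \<omega> > 0"
  shows "\<exists>b. \<forall>w\<in>energy_class F \<omega> \<mu>. norm (moment w p) \<le> b"
proof -
  let ?Q = "square (Suc (fst p), snd p)"
  have Q: "bounded ?Q" "?Q \<in> sets lebesgue"
    using bounded_square[of "Suc (fst p)"] square_borel by (cases "snd p", auto)
  obtain r where r: "r \<ge> 0" "?Q \<union> \<omega> \<subseteq> centred_square r"
    using bounded_subset_centred_square[of "?Q \<union> \<omega>"] Q \<omega> by auto
  let ?B = "centred_square r"
  have B: "bounded ?B" "?B \<in> sets lebesgue" by (auto simp: centred_square_def)
  define C where "C = 16 * r\<^sup>2 * (4 * r)\<^sup>2 / measure lebesgue \<omega>"
  have "norm (moment w p) \<le> (LINT x:?B|lebesgue. norm \<mu> + 1) + C * (LINT x|lebesgue. (norm (F x))\<^sup>2)"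
    if w: "w \<in> energy_class F \<omega> \<mu>" for w
  proof -
    have wD: "Ck (Suc 0) w" "square_integrable lebesgue (gradient w)"
      "(LINT x:\<omega>|lebesgue. w x) = measure lebesgue \<omega> *\<^sub>R \<mu>"
      using w admissibleD by (auto simp: energy_class_def)
    define f where "f x = w x + (- \<mu>)" for x
    have f: "Ck (Suc 0) f" unfolding f_def by (intro Ck_add Ck_const wD)
    have gf: "gradient f = gradient w"
      unfolding f_def by (rule ext, subst gradient_add[OF wD(1) Ck_const]) (simp add: gradient_const)
    have int1: "integrable lebesgue (indicator \<omega> :: _ \<Rightarrow> real)"
      using continuous_set_integrable_bounded[OF continuous_on_const \<omega>(1,2), of "1 :: real"]
      by (simp add: set_integrable_def)
    have "(LINT x:\<omega>|lebesgue. f x) = (LINT x:\<omega>|lebesgue. w x) + (LINT x:\<omega>|lebesgue. - \<mu>)"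
      unfolding f_def
      by (intro set_integral_add continuous_set_integrable_bounded \<omega> Ck_continuous[OF wD(1)] continuous_on_const)
    also have "(LINT x:\<omega>|lebesgue. - \<mu>) = - (measure lebesgue \<omega> *\<^sub>R \<mu>)"
      using integral_scaleR_left[OF int1, of "- \<mu>"] by (simp add: set_lebesgue_integral_def)
    finally have f0: "(LINT x:\<omega>|lebesgue. f x) = 0" by (simp add: wD(3))
    have cf: "continuous_on UNIV (\<lambda>x. (norm (f x))\<^sup>2)" by (intro continuous_intros Ck_continuous[OF f])
    have "C \<ge> 0" by (simp add: C_def)
    have "norm (moment w p) \<le> (LINT x:?B|lebesgue. (norm \<mu> + 1) + (norm (f x))\<^sup>2)"
      unfolding moment_def set_lebesgue_integral_def
    proof (rule order_trans[OF integral_norm_bound integral_mono])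
      show "integrable lebesgue (\<lambda>x. norm (indicator ?Q x *\<^sub>R w x))"
        by (rule integrable_norm) (use continuous_set_integrable_bounded[OF Ck_continuous[OF wD(1)] Q] in \<open>simp add: set_integrable_def\<close>)
      show "integrable lebesgue (\<lambda>x. indicator ?B x *\<^sub>R ((norm \<mu> + 1) + (norm (f x))\<^sup>2))"
        by (intro continuous_set_integrable_bounded[unfolded set_integrable_def] continuous_on_add
            continuous_on_const cf B)
      show "norm (indicator ?Q x *\<^sub>R w x) \<le> indicator ?B x *\<^sub>R ((norm \<mu> + 1) + (norm (f x))\<^sup>2)" for x
      proof (cases "x \<in> ?Q")
        case True
        have "norm (w x) \<le> norm (f x) + norm \<mu>" using norm_triangle_ineq[of "f x" \<mu>] by (simp add: f_def)
        also have "norm (f x) \<le> 1 + (norm (f x))\<^sup>2"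
        proof -
          have "0 \<le> (norm (f x) - 1)\<^sup>2" by simp
          then have "2 * norm (f x) \<le> 1 + (norm (f x))\<^sup>2" by (simp add: power2_diff)
          then show ?thesis using norm_ge_zero[of "f x"] by linarith
        qed
        finally show ?thesis using True r(2) by auto
      qed (auto simp: indicator_def)
    qed
    also have "\<dots> = (LINT x:?B|lebesgue. norm \<mu> + 1) + (LINT x:?B|lebesgue. (norm (f x))\<^sup>2)"
      by (intro set_integral_add continuous_set_integrable_bounded B cf continuous_on_const)
    also have "(LINT x:?B|lebesgue. (norm (f x))\<^sup>2) \<le> C * (LINT x|lebesgue. (norm (gradient f x))\<^sup>2)"
      unfolding C_def using r wD f0 \<omega> gf
      by (intro integral_norm_square_le_if_integral_eq_0 f) auto
    also have "\<dots> \<le> C * (LINT x|lebesgue. (norm (F x))\<^sup>2)"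
      unfolding gf using energy_class_bounds(3)[OF F w] \<open>C \<ge> 0\<close> by (rule mult_left_mono)
    finally show ?thesis by simp
  qed
  then show ?thesis by blast
qed

lemma zero_solenoidal_test_function: "(\<lambda>x. 0) \<in> solenoidal_test_functions"
  by (simp add: solenoidal_test_functions_def test_functions_def Ck_const divergence_def gradient_const trace_def)

text \<open>This is the finite intersection property for the sets of approximate solutions: finitely
  many test functions fit into one Galerkin space.\<close>

lemma exists_common_approximant:
  assumes F: "square_integrable lebesgue F"
    and \<omega>: "bounded \<omega>" "\<omega> \<in> sets lebesgue" "measure lebesgue \<omega> > 0"
    and I: "finite I" "I \<subseteq> solenoidal_test_functions \<times> {0<..}"
  shows "\<exists>w\<in>energy_class F \<omega> \<mu>. \<forall>(\<phi>, e)\<in>I. \<bar>residual F w \<phi>\<bar> \<le> e"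
proof -
  obtain n and h :: "nat \<Rightarrow> _" where h: "I = h ` {i. i < n}"
    using finite_imp_nat_seg_image_inj_on[OF I(1)] by blast
  \<comment> \<open>Padded by the zero field, since the Galerkin lemma takes an infinite sequence
    and uses the indices up to and including \<open>n\<close>.\<close>
  define \<phi> where "\<phi> i = (if i < n then fst (h i) else (\<lambda>x. 0))" for i
  \<comment> \<open>The smallest of the required accuracies; the element 1 covers an empty
    \<open>I\<close>.\<close>
  define e where "e = Min (insert 1 (snd ` I))"
  have "e > 0" unfolding e_def using I by (subst Min_gr_iff) auto
  have "\<phi> i \<in> solenoidal_test_functions" for i
    using I(2) h zero_solenoidal_test_function by (auto simp: \<phi>_def)
  then obtain w where w: "w \<in> admissible" "(LINT x:\<omega>|lebesgue. w x) = measure lebesgue \<omega> *\<^sub>R \<mu>"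
    "(LINT x|lebesgue. (norm (gradient w x))\<^sup>2) \<le> (LINT x|lebesgue. F x \<bullet> gradient w x)"
    "\<And>i. i \<le> n \<Longrightarrow> \<bar>residual F w (\<phi> i)\<bar> \<le> e"
    using galerkin_approximation[OF _ F \<omega> \<open>e > 0\<close>, of \<phi> \<mu> n] unfolding residual_def by blast
  have "\<bar>residual F w (fst z)\<bar> \<le> snd z" if z: "z \<in> I" for z
  proof -
    obtain i where "i < n" "z = h i" using z h by auto
    then have "\<bar>residual F w (fst z)\<bar> \<le> e" using w(4)[of i] by (simp add: \<phi>_def)
    also have "e \<le> snd z" unfolding e_def using I(1) z by (intro Min_le) auto
    finally show ?thesis .
  qed
  then show ?thesis using w by (auto simp: energy_class_def split_beta)
qed

text \<open>A compactness argument by the finite intersection property in the product space of all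
  moments: no countable dense set of test functions is needed.\<close>

lemma exists_limit_moments:
  assumes F: "square_integrable lebesgue F"
    and \<omega>: "bounded \<omega>" "\<omega> \<in> sets lebesgue" "measure lebesgue \<omega> > 0"
  obtains a l where "\<And>\<phi> n. \<phi> \<in> solenoidal_test_functions \<Longrightarrow>
    \<exists>w\<in>tail_class F \<omega> \<mu> a l n. \<bar>residual F w \<phi>\<bar> \<le> 1 / real (Suc n)"
proof -
  let ?E = "energy_class F \<omega> \<mu>"
  let ?e = "\<lambda>w. LINT x|lebesgue. F x \<bullet> gradient w x"
  define S where "S = (\<lambda>(\<phi>, e). {w \<in> ?E. \<bar>residual F w \<phi>\<bar> \<le> e})"
  define \<psi> where "\<psi> w = (moment w, ?e w)" for w
  have "\<forall>p. \<exists>b. \<forall>w\<in>?E. norm (moment w p) \<le> b" using moment_bounded[OF F \<omega>] by blast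
  from choice[OF this] obtain b where b: "\<And>p w. w \<in> ?E \<Longrightarrow> norm (moment w p) \<le> b p" by blast
  \<comment> \<open>Every moment ranges over a ball and the pairing with \<open>F\<close> over an
    interval; Tychonoff's theorem makes the product compact.\<close>
  define C where "C = PiE UNIV (\<lambda>p. cball 0 (b p) :: (real^2) set) \<times> {0..LINT x|lebesgue. (norm (F x))\<^sup>2}"
  have "compactin (product_topology (\<lambda>p. euclidean) UNIV) (PiE UNIV (\<lambda>p. cball 0 (b p) :: (real^2) set))"
    by (subst compactin_PiE) (simp add: compactin_euclidean_iff)
  then have "compact C"
    unfolding C_def by (intro compact_Times) (auto simp: euclidean_product_topology compactin_euclidean_iff)
  have \<psi>C: "\<psi> w \<in> C" if "w \<in> ?E" for w
    using b[OF that] energy_class_bounds(1,2)[OF F that] by (auto simp: C_def \<psi>_def)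
  \<comment> \<open>A common point of all closures fixes the limits before any test function is
    chosen.\<close>
  have "C \<inter> (\<Inter>i\<in>solenoidal_test_functions \<times> {0<..}. closure (\<psi> ` S i)) \<noteq> {}"
  proof (rule compact_imp_fip_image[OF \<open>compact C\<close>])
    fix I assume I: "finite I" "I \<subseteq> solenoidal_test_functions \<times> {0::real<..}"
    obtain w where w: "w \<in> ?E" "\<And>\<phi> e. (\<phi>, e) \<in> I \<Longrightarrow> \<bar>residual F w \<phi>\<bar> \<le> e"
      using exists_common_approximant[OF F \<omega> I] by blast
    then have "\<psi> w \<in> closure (\<psi> ` S i)" if "i \<in> I" for i
      using that by (intro subsetD[OF closure_subset] imageI) (auto simp: S_def split: prod.splits)
    then show "C \<inter> (\<Inter>i\<in>I. closure (\<psi> ` S i)) \<noteq> {}" using \<psi>C[OF w(1)] by blast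
  qed simp
  then obtain a l where al: "\<And>\<phi> e. \<phi> \<in> solenoidal_test_functions \<Longrightarrow> e > 0 \<Longrightarrow> (a, l) \<in> closure (\<psi> ` S (\<phi>, e))"
    by (auto simp: C_def)
  have "\<exists>w\<in>tail_class F \<omega> \<mu> a l n. \<bar>residual F w \<phi>\<bar> \<le> 1 / real (Suc n)" if \<phi>: "\<phi> \<in> solenoidal_test_functions" for \<phi> n
  proof -
    define J where "J = {..n} \<times> {- int n..int n} \<times> {- int n..int n}"
    \<comment> \<open>A neighbourhood in the product topology constrains finitely many coordinates,
      which is why \<open>tail_class\<close> compares moments over a finite index set.\<close>
    define U where "U = (\<Inter>p\<in>J. {z :: (nat \<times> int \<times> int \<Rightarrow> real^2) \<times> real. norm (fst z p - a p) < 1 / real (Suc n)})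
        \<inter> {z. \<bar>snd z - l\<bar> < 1 / real (Suc n)}"
    have "continuous_on UNIV (\<lambda>z :: (nat \<times> int \<times> int \<Rightarrow> real^2) \<times> real. fst z p)" for p
      by (rule continuous_on_product_then_coordinatewise) (rule continuous_on_fst[OF continuous_on_id])
    then have "open U"
      unfolding U_def by (intro open_Int open_INT open_Collect_less continuous_intros ballI) (auto simp: J_def)
    moreover have "(a, l) \<in> U" by (simp add: U_def)
    moreover have "(a, l) \<in> closure (\<psi> ` S (\<phi>, 1 / real (Suc n)))" by (rule al[OF \<phi>]) simp
    ultimately obtain z where "z \<in> U" "z \<in> \<psi> ` S (\<phi>, 1 / real (Suc n))"
      using open_Int_closure_eq_empty by blast
    then obtain w where w: "w \<in> ?E" "\<bar>residual F w \<phi>\<bar> \<le> 1 / real (Suc n)" "\<psi> w \<in> U"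
      by (auto simp: S_def)
    have "\<bar>?e w - l\<bar> < 1 / real (Suc n)" using w(3) by (simp add: U_def \<psi>_def)
    moreover have "(LINT x|lebesgue. (norm (gradient w x))\<^sup>2) \<le> ?e w" using w(1) by (simp add: energy_class_def)
    moreover have "y \<le> l + d" if "\<bar>e - l\<bar> < d" "y \<le> e" for y e d :: real using that by argo
    ultimately have "(LINT x|lebesgue. (norm (gradient w x))\<^sup>2) \<le> l + 1 / real (Suc n)" by blast
    moreover have "\<forall>p\<in>J. norm (moment w p - a p) < 1 / real (Suc n)" using w(3) by (simp add: U_def \<psi>_def)
    ultimately have "w \<in> tail_class F \<omega> \<mu> a l n"
      using w(1) \<open>\<bar>?e w - l\<bar> < 1 / real (Suc n)\<close>
      unfolding tail_class_def energy_class_def J_def by (auto intro: less_imp_le)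
    then show ?thesis using w(2) by blast
  qed
  then show ?thesis using that by blast
qed

section \<open>Convexity and Cauchy property of the tail classes\<close>

lemma gradient_lincomb:
  assumes "Ck (Suc 0) v" "Ck (Suc 0) w"
  shows "gradient (\<lambda>x. s *\<^sub>R v x + t *\<^sub>R w x) x = s *\<^sub>R gradient v x + t *\<^sub>R gradient w x"
  unfolding gradient_add[OF Ck_scaleR[OF assms(1)] Ck_scaleR[OF assms(2)]]
    gradient_scaleR[OF assms(1)] gradient_scaleR[OF assms(2)] ..

lemma set_integral_lincomb:
  fixes v w :: "'a::euclidean_space \<Rightarrow> 'b::euclidean_space"
  assumes "continuous_on UNIV v" "continuous_on UNIV w" "bounded A" "A \<in> sets lebesgue"
  shows "(LINT x:A|lebesgue. s *\<^sub>R v x + t *\<^sub>R w x) = s *\<^sub>R (LINT x:A|lebesgue. v x) + t *\<^sub>R (LINT x:A|lebesgue. w x)"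
proof -
  have "(LINT x:A|lebesgue. s *\<^sub>R v x + t *\<^sub>R w x) = (LINT x:A|lebesgue. s *\<^sub>R v x) + (LINT x:A|lebesgue. t *\<^sub>R w x)"
    by (intro set_integral_add continuous_set_integrable_bounded assms continuous_intros)
  then show ?thesis by (simp add: set_lebesgue_integral_def scaleR_left_commute[of _ s] scaleR_left_commute[of _ t])
qed

lemma bounded_measurable_square:
  "bounded (square (Suc N, p))" "square (Suc N, p) \<in> sets lebesgue"
  using bounded_square[of "Suc N"] square_borel by (cases p, auto)

lemma moment_lincomb:
  assumes "Ck (Suc 0) v" "Ck (Suc 0) w"
  shows "moment (\<lambda>x. s *\<^sub>R v x + t *\<^sub>R w x) p = s *\<^sub>R moment v p + t *\<^sub>R moment w p"
  unfolding moment_def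
  by (intro set_integral_lincomb Ck_continuous[OF assms(1)] Ck_continuous[OF assms(2)] bounded_measurable_square)

lemma tail_classD:
  assumes "w \<in> tail_class F \<omega> \<mu> a l n"
  shows "w \<in> admissible" "(LINT x:\<omega>|lebesgue. w x) = measure lebesgue \<omega> *\<^sub>R \<mu>"
    "\<And>N i j. N \<le> n \<Longrightarrow> \<bar>i\<bar> \<le> int n \<Longrightarrow> \<bar>j\<bar> \<le> int n \<Longrightarrow> norm (moment w (N, i, j) - a (N, i, j)) \<le> 1 / real (Suc n)"
    "\<bar>(LINT x|lebesgue. F x \<bullet> gradient w x) - l\<bar> \<le> 1 / real (Suc n)"
    "(LINT x|lebesgue. (norm (gradient w x))\<^sup>2) \<le> l + 1 / real (Suc n)"
  using assms by (auto simp: tail_class_def abs_le_iff)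

lemma tail_class_decreasing: "tail_class F \<omega> \<mu> a l (Suc n) \<subseteq> tail_class F \<omega> \<mu> a l n"
proof
  fix w assume w: "w \<in> tail_class F \<omega> \<mu> a l (Suc n)"
  note D = tail_classD[OF w]
  have le: "1 / real (Suc (Suc n)) \<le> 1 / real (Suc n)" by (simp add: frac_le)
  have "norm (moment w p - a p) \<le> 1 / real (Suc n)" if p: "p \<in> {..n} \<times> {- int n..int n} \<times> {- int n..int n}" for p
  proof -
    obtain N i j where p': "p = (N, i, j)" "N \<le> Suc n" "\<bar>i\<bar> \<le> int (Suc n)" "\<bar>j\<bar> \<le> int (Suc n)"
      using p by (cases p) auto
    show ?thesis unfolding p'(1) by (rule order_trans[OF D(3)[OF p'(2-4)] le])
  qed
  moreover have "(LINT x|lebesgue. (norm (gradient w x))\<^sup>2) \<le> l + 1 / real (Suc n)"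
    by (rule order_trans[OF D(5) add_left_mono[OF le]])
  ultimately show "w \<in> tail_class F \<omega> \<mu> a l n"
    unfolding tail_class_def mem_Collect_eq using D(1,2) order_trans[OF D(4) le] by blast
qed

lemma admissible_midpoint:
  assumes v: "v \<in> admissible" and w: "w \<in> admissible"
  shows "(\<lambda>x. (1/2) *\<^sub>R v x + (1/2) *\<^sub>R w x) \<in> admissible"
proof -
  note C = admissibleD(1)[OF v] admissibleD(1)[OF w]
  obtain c d where cd: "bounded {x. v x \<noteq> c}" "bounded {x. w x \<noteq> d}" using v w by (auto simp: admissible_def)
  have "bounded ({x. v x \<noteq> c} \<union> {x. w x \<noteq> d})" using cd by simp
  then have "bounded {x. (1/2) *\<^sub>R v x + (1/2) *\<^sub>R w x \<noteq> (1/2) *\<^sub>R c + (1/2) *\<^sub>R d}"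
    by (rule bounded_subset) auto
  moreover have "divergence (\<lambda>x. (1/2) *\<^sub>R v x + (1/2) *\<^sub>R w x) x = 0" for x
    using admissibleD(2)[OF v, of x] admissibleD(2)[OF w, of x]
    by (simp add: divergence_def gradient_lincomb[OF C] trace_def sum.distrib flip: sum_divide_distrib)
  moreover have "Ck (Suc 0) (\<lambda>x. (1/2) *\<^sub>R v x + (1/2) *\<^sub>R w x)" by (intro Ck_add Ck_scaleR C)
  ultimately show ?thesis unfolding admissible_def by blast
qed

text \<open>Affine conditions survive midpoints, and the bound on the gradient does by convexity of
  the squared norm. This is the midpoint hypothesis of
  \<open>L2_cauchy_in_decreasing_convex_sets\<close>.\<close>

lemma tail_class_midpoint:
  assumes F: "square_integrable lebesgue F" and \<omega>: "bounded \<omega>" "\<omega> \<in> sets lebesgue"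
    and v: "v \<in> tail_class F \<omega> \<mu> a l n" and w: "w \<in> tail_class F \<omega> \<mu> a l n"
  shows "\<exists>z\<in>tail_class F \<omega> \<mu> a l n. \<forall>x. gradient z x = (1/2) *\<^sub>R (gradient v x + gradient w x)"
proof (intro bexI allI)
  let ?z = "\<lambda>x. (1/2) *\<^sub>R v x + (1/2) *\<^sub>R w x"
  let ?d = "1 / real (Suc n)"
  note vD = tail_classD[OF v] note wD = tail_classD[OF w]
  note C = admissibleD(1)[OF vD(1)] admissibleD(1)[OF wD(1)]
  note sq = admissibleD(3)[OF vD(1)] admissibleD(3)[OF wD(1)]
  have g: "gradient ?z x = (1/2) *\<^sub>R gradient v x + (1/2) *\<^sub>R gradient w x" for x
    by (rule gradient_lincomb[OF C])
  show "gradient ?z x = (1/2) *\<^sub>R (gradient v x + gradient w x)" for x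
    unfolding g by (simp add: scaleR_add_right)
  have mid: "\<bar>(1/2) * s + (1/2) * t - c\<bar> \<le> d" if "\<bar>s - c\<bar> \<le> d" "\<bar>t - c\<bar> \<le> d" for s t c d :: real
    using that by argo
  have "(LINT x:\<omega>|lebesgue. ?z x) = measure lebesgue \<omega> *\<^sub>R \<mu>"
    unfolding set_integral_lincomb[OF Ck_continuous[OF C(1)] Ck_continuous[OF C(2)] \<omega>] vD(2) wD(2)
    by (simp flip: scaleR_add_left)
  moreover have "norm (moment ?z p - a p) \<le> ?d" if p: "p \<in> {..n} \<times> {- int n..int n} \<times> {- int n..int n}" for p
  proof -
    have "norm (moment v p - a p) \<le> ?d" "norm (moment w p - a p) \<le> ?d"
      using p v w unfolding tail_class_def by auto
    moreover have "moment ?z p - a p = (1/2) *\<^sub>R (moment v p - a p) + (1/2) *\<^sub>R (moment w p - a p)"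
      unfolding moment_lincomb[OF C] by (simp add: scaleR_diff_right flip: scaleR_add_left)
    moreover have "norm ((1/2) *\<^sub>R x + (1/2) *\<^sub>R y) \<le> d" if "norm x \<le> d" "norm y \<le> d" for x y :: "real^2" and d
      using norm_triangle_ineq[of "(1/2) *\<^sub>R x" "(1/2) *\<^sub>R y"] that by simp
    ultimately show ?thesis by presburger
  qed
  moreover have "\<bar>(LINT x|lebesgue. F x \<bullet> gradient ?z x) - l\<bar> \<le> ?d"
  proof -
    have "(LINT x|lebesgue. F x \<bullet> gradient ?z x) = (1/2) * (LINT x|lebesgue. F x \<bullet> gradient v x) + (1/2) * (LINT x|lebesgue. F x \<bullet> gradient w x)"
      unfolding g inner_add_right inner_scaleR_right
      by (simp add: integrable_inner_square_integrable[OF F] sq)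
    then show ?thesis using mid[OF vD(4) wD(4)] by simp
  qed
  moreover have "(LINT x|lebesgue. (norm (gradient ?z x))\<^sup>2) \<le> l + ?d"
  proof -
    have sz: "square_integrable lebesgue (gradient ?z)"
      by (rule admissibleD(3)[OF admissible_midpoint[OF vD(1) wD(1)]])
    have "(LINT x|lebesgue. (norm (gradient ?z x))\<^sup>2)
        \<le> (LINT x|lebesgue. (1/2) * (norm (gradient v x))\<^sup>2 + (1/2) * (norm (gradient w x))\<^sup>2)"
    proof (rule integral_mono)
      show "(norm (gradient ?z x))\<^sup>2 \<le> (1/2) * (norm (gradient v x))\<^sup>2 + (1/2) * (norm (gradient w x))\<^sup>2" for x
        unfolding g using norm_add_square_le[of "(1/2) *\<^sub>R gradient v x" "(1/2) *\<^sub>R gradient w x"]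
        by (simp add: power_divide)
    qed (use sq sz in \<open>auto simp: square_integrable_def\<close>)
    also have "\<dots> = (1/2) * (LINT x|lebesgue. (norm (gradient v x))\<^sup>2) + (1/2) * (LINT x|lebesgue. (norm (gradient w x))\<^sup>2)"
      by (simp add: square_integrableD(2) sq)
    also have "\<dots> \<le> l + ?d"
    proof -
      have "(1/2) * s + (1/2) * t \<le> d" if "s \<le> d" "t \<le> d" for s t d :: real using that by argo
      then show ?thesis using vD(5) wD(5) by blast
    qed
    finally show ?thesis .
  qed
  ultimately show "?z \<in> tail_class F \<omega> \<mu> a l n"
    unfolding tail_class_def mem_Collect_eq using admissible_midpoint[OF vD(1) wD(1)] by blast
qed

text \<open>The scale of the cells is fixed first, to make the gradient term small; late classes
  then make the finitely many moments at that scale agree. The estimate is uniform over members, so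
  any two sequences drawn from the classes have the same limit.\<close>

lemma tail_class_cauchy:
  assumes "e > 0"
  shows "\<exists>n0. \<forall>m\<ge>n0. \<forall>n\<ge>n0. \<forall>v\<in>tail_class F \<omega> \<mu> a l m. \<forall>w\<in>tail_class F \<omega> \<mu> a l n.
    (LINT x:cball 0 (real R)|lebesgue. (norm (v x - w x))\<^sup>2) \<le> e"
proof -
  \<comment> \<open>The difference of two members has squared gradient norm at most
    \<open>4 * \<bar>l + 1\<bar>\<close>; at scale \<open>N\<close> the Poincare factor
    \<open>8 / (real N)\<^sup>2\<close> brings this below \<open>e / 2\<close>.\<close>
  obtain M :: nat where M: "64 * \<bar>l + 1\<bar> / e < real M" using reals_Archimedean2 by blast
  define N where "N = Suc M"
  define J where "J = {- int (N * R) - 1..int (N * R)} \<times> {- int (N * R) - 1..int (N * R)}"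
  \<comment> \<open>The other half of \<open>e\<close> has to hold \<open>(real N)\<^sup>2\<close>
    times \<open>card J\<close> squared moments, each at most
    \<open>4 / real (Suc n0)\<close>.\<close>
  obtain n1 :: nat where n1: "8 * (real N)\<^sup>2 * real (card J) / e < real n1" using reals_Archimedean2 by blast
  \<comment> \<open>Class \<open>n0\<close> must reach moment index \<open>M\<close>, which by the
    shift in \<open>moment\<close> means cells of side 1/N, and cell numbers up to
    \<open>N * R + 1\<close> in absolute value.\<close>
  define n0 where "n0 = n1 + M + N * R + 1"
  have "(LINT x:cball 0 (real R)|lebesgue. (norm (v x - w x))\<^sup>2) \<le> e"
    if mn: "m \<ge> n0" "n \<ge> n0" and v: "v \<in> tail_class F \<omega> \<mu> a l m" and w: "w \<in> tail_class F \<omega> \<mu> a l n" for m n v w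
  proof -
    note vD = tail_classD[OF v] note wD = tail_classD[OF w]
    note C = admissibleD(1)[OF vD(1)] admissibleD(1)[OF wD(1)]
    note sq = admissibleD(3)[OF vD(1)] admissibleD(3)[OF wD(1)]
    define f where "f x = 1 *\<^sub>R v x + (- 1) *\<^sub>R w x" for x
    have f: "Ck (Suc 0) f" unfolding f_def by (intro Ck_add Ck_scaleR C)
    have g: "gradient f x = gradient v x - gradient w x" for x
      unfolding f_def gradient_lincomb[OF C] by simp
    have gs: "square_integrable lebesgue (gradient f)"
      unfolding g[abs_def] by (rule square_integrable_diff[OF sq])
    have dm: "1 / real (Suc m) \<le> 1 / real (Suc n0)" "1 / real (Suc n) \<le> 1 / real (Suc n0)" "1 / real (Suc n0) \<le> 1"
      using mn by (auto simp: frac_le)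
    have G: "(LINT x|lebesgue. (norm (gradient f x))\<^sup>2) \<le> 4 * \<bar>l + 1\<bar>"
    proof -
      have "(LINT x|lebesgue. (norm (gradient f x))\<^sup>2)
          \<le> (LINT x|lebesgue. 2 * (norm (gradient v x))\<^sup>2 + 2 * (norm (gradient w x))\<^sup>2)"
      proof (rule integral_mono)
        show "(norm (gradient f x))\<^sup>2 \<le> 2 * (norm (gradient v x))\<^sup>2 + 2 * (norm (gradient w x))\<^sup>2" for x
          unfolding g using norm_add_square_le[of "gradient v x" "- gradient w x"] by simp
      qed (use sq gs in \<open>auto simp: square_integrable_def\<close>)
      also have "\<dots> = 2 * (LINT x|lebesgue. (norm (gradient v x))\<^sup>2) + 2 * (LINT x|lebesgue. (norm (gradient w x))\<^sup>2)"
        by (simp add: square_integrableD(2) sq)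
      also have "\<dots> \<le> 4 * \<bar>l + 1\<bar>"
      proof -
        have "2 * s + 2 * t \<le> 4 * \<bar>l + 1\<bar>" if "s \<le> l + c" "t \<le> l + d" "c \<le> b" "d \<le> b" "b \<le> 1" for s t c d b :: real
          using that by argo
        then show ?thesis using vD(5) wD(5) dm by blast
      qed
      finally show ?thesis .
    qed
    have mom: "(norm (LINT x:square (N, k, j)|lebesgue. f x))\<^sup>2 \<le> 4 / real (Suc n0)" if kj: "(k, j) \<in> J" for k j
    proof -
      have b: "M \<le> m" "M \<le> n" "\<bar>k\<bar> \<le> int m" "\<bar>k\<bar> \<le> int n" "\<bar>j\<bar> \<le> int m" "\<bar>j\<bar> \<le> int n"
      proof -
        have "N * R + 1 \<le> m" "N * R + 1 \<le> n" using mn by (simp_all add: n0_def)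
        then have "int (N * R + 1) \<le> int m" "int (N * R + 1) \<le> int n" by (simp_all only: of_nat_le_iff)
        moreover have "- int (N * R) - 1 \<le> k" "k \<le> int (N * R)" "- int (N * R) - 1 \<le> j" "j \<le> int (N * R)"
          using kj unfolding J_def by (simp_all only: mem_Sigma_iff atLeastAtMost_iff)
        ultimately show "\<bar>k\<bar> \<le> int m" "\<bar>k\<bar> \<le> int n" "\<bar>j\<bar> \<le> int m" "\<bar>j\<bar> \<le> int n"
          unfolding of_nat_add abs_le_iff by linarith+
      qed (use mn in \<open>simp_all add: n0_def\<close>)
      have "(LINT x:square (N, k, j)|lebesgue. f x) = moment f (M, k, j)" by (simp add: moment_def N_def)
      also have "\<dots> = (moment v (M, k, j) - a (M, k, j)) - (moment w (M, k, j) - a (M, k, j))"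
        unfolding f_def moment_lincomb[OF C] by simp
      also have "norm \<dots> \<le> 1 / real (Suc m) + 1 / real (Suc n)"
        by (rule order_trans[OF norm_triangle_ineq4 add_mono]) (intro vD(3) wD(3) b)+
      also have "\<dots> \<le> 2 / real (Suc n0)" using add_mono[OF dm(1,2)] by simp
      finally have "(norm (LINT x:square (N, k, j)|lebesgue. f x))\<^sup>2 \<le> (2 / real (Suc n0))\<^sup>2"
        by (intro power_mono) auto
      also have "\<dots> = (4 / real (Suc n0)) * (1 / real (Suc n0))" by (simp add: power2_eq_square)
      also have "\<dots> \<le> (4 / real (Suc n0)) * 1" using dm(3) by (intro mult_left_mono) auto
      finally show ?thesis by simp
    qed
    have "(LINT x:cball 0 (real R)|lebesgue. (norm (f x))\<^sup>2)
      \<le> (real N)\<^sup>2 * (\<Sum>(k, j)\<in>J. (norm (LINT x:square (N, k, j)|lebesgue. f x))\<^sup>2)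
        + 8 / (real N)\<^sup>2 * (LINT x|lebesgue. (norm (gradient f x))\<^sup>2)"
      unfolding J_def by (rule integral_norm_square_ball_le[OF f gs]) (simp add: N_def)
    also have "\<dots> \<le> (real N)\<^sup>2 * (real (card J) * (4 / real (Suc n0))) + 8 / (real N)\<^sup>2 * (4 * \<bar>l + 1\<bar>)"
    proof (intro add_mono mult_left_mono G)
      show "(\<Sum>(k, j)\<in>J. (norm (LINT x:square (N, k, j)|lebesgue. f x))\<^sup>2) \<le> real (card J) * (4 / real (Suc n0))"
        by (rule sum_bounded_above) (use mom in auto)
    qed auto
    also have "\<dots> \<le> e / 2 + e / 2"
    proof (rule add_mono)
      have "8 * (real N)\<^sup>2 * real (card J) \<le> e * real (Suc n0)"
        using n1 \<open>e > 0\<close> by (simp add: n0_def field_simps)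
          (smt (verit, best) mult_nonneg_nonneg of_nat_0_le_iff)
      then show "(real N)\<^sup>2 * (real (card J) * (4 / real (Suc n0))) \<le> e / 2"
        by (simp add: field_simps)
      have "64 * \<bar>l + 1\<bar> \<le> e * real N" using M \<open>e > 0\<close> by (simp add: N_def field_simps)
      also have "\<dots> \<le> e * (real N)\<^sup>2" using \<open>e > 0\<close> by (intro mult_left_mono) (auto simp: N_def power2_eq_square)
      finally show "8 / (real N)\<^sup>2 * (4 * \<bar>l + 1\<bar>) \<le> e / 2" by (simp add: N_def field_simps)
    qed
    finally show ?thesis by (simp add: f_def)
  qed
  then show ?thesis by blast
qed

section \<open>Passage to the limit\<close>

text \<open>On the set \<open>A\<close>, which has finite measure, the norm of \<open>f\<close> is
  dominated by one plus its square.\<close>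

lemma set_integrable_square_integrable:
  assumes f: "square_integrable lebesgue (\<lambda>x. indicator A x *\<^sub>R f x)" and "bounded A" "A \<in> sets lebesgue"
  shows "set_integrable lebesgue A f"
  unfolding set_integrable_def
proof (rule Bochner_Integration.integrable_bound)
  show "integrable lebesgue (\<lambda>x. indicator A x *\<^sub>R (1::real) + (norm (indicator A x *\<^sub>R f x))\<^sup>2)"
    using continuous_set_integrable_bounded[OF continuous_on_const assms(2,3), of "1::real"] square_integrableD(2)[OF f]
    by (intro Bochner_Integration.integrable_add) (simp_all only: set_integrable_def)
  show "AE x in lebesgue. norm (indicator A x *\<^sub>R f x) \<le> norm (indicator A x *\<^sub>R (1::real) + (norm (indicator A x *\<^sub>R f x))\<^sup>2)"
  proof (rule AE_I2)
    fix x
    have "0 \<le> (norm (f x) - 1)\<^sup>2" by simp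
    then have "2 * norm (f x) \<le> 1 + (norm (f x))\<^sup>2" by (simp add: power2_diff)
    then have "norm (f x) \<le> 1 + (norm (f x))\<^sup>2" using norm_ge_zero[of "f x"] by linarith
    then show "norm (indicator A x *\<^sub>R f x) \<le> norm (indicator A x *\<^sub>R (1::real) + (norm (indicator A x *\<^sub>R f x))\<^sup>2)"
      by (cases "x \<in> A") (simp_all add: abs_of_nonneg add_nonneg_nonneg)
  qed
qed (use f in \<open>simp add: square_integrable_def\<close>)

lemma nn_integral_norm_square_eq:
  assumes "square_integrable M f"
  shows "(\<integral>\<^sup>+x. ennreal ((norm (f x))\<^sup>2) \<partial>M) = ennreal (LINT x|M. (norm (f x))\<^sup>2)"
  by (rule nn_integral_eq_integral[OF square_integrableD(2)[OF assms]]) simp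

text \<open>Fatou's lemma delivers bounds on nonnegative integrals; their finiteness for one
  \<open>n\<close> already makes \<open>l\<close> square-integrable.\<close>

lemma L2_tendstoI:
  assumes f: "\<And>n. square_integrable M (f n)" and l: "l \<in> borel_measurable M"
    and lim: "\<And>e. e > 0 \<Longrightarrow> \<exists>n0. \<forall>n\<ge>n0. (\<integral>\<^sup>+x. ennreal ((norm (f n x - l x))\<^sup>2) \<partial>M) \<le> ennreal e"
  shows "L2_tendsto M f l"
proof -
  have meas: "(\<lambda>x. f n x - l x) \<in> borel_measurable M" for n
    using square_integrableD(1)[OF f] l by (rule borel_measurable_diff)
  have sq: "square_integrable M (\<lambda>x. f n x - l x)"
    if "(\<integral>\<^sup>+x. ennreal ((norm (f n x - l x))\<^sup>2) \<partial>M) \<le> ennreal e" for n e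
    unfolding square_integrable_def
  proof (intro conjI meas integrableI_bounded)
    show "(\<lambda>x. (norm (f n x - l x))\<^sup>2) \<in> borel_measurable M" using meas[of n] by measurable
    show "(\<integral>\<^sup>+x. ennreal (norm ((norm (f n x - l x))\<^sup>2)) \<partial>M) < \<infinity>"
      using that by (simp add: le_less_trans[OF _ ennreal_less_top])
  qed
  obtain n where n: "(\<integral>\<^sup>+x. ennreal ((norm (f n x - l x))\<^sup>2) \<partial>M) \<le> ennreal 1"
    using lim[of 1] by auto
  have "square_integrable M (\<lambda>x. f n x - (f n x - l x))"
    by (rule square_integrable_diff[OF f sq[OF n]])
  then have sl: "square_integrable M l" by simp
  have "(\<lambda>n. LINT x|M. (norm (f n x - l x))\<^sup>2) \<longlonglongrightarrow> 0"
  proof (rule LIMSEQ_I)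
    fix e :: real assume "e > 0"
    then obtain n0 where n0: "\<And>n. n \<ge> n0 \<Longrightarrow> (\<integral>\<^sup>+x. ennreal ((norm (f n x - l x))\<^sup>2) \<partial>M) \<le> ennreal (e / 2)"
      using lim[of "e / 2"] by auto
    have "(LINT x|M. (norm (f n x - l x))\<^sup>2) \<le> e / 2" if "n \<ge> n0" for n
      using n0[OF that] \<open>e > 0\<close> by (simp add: nn_integral_norm_square_eq[OF sq[OF n0[OF that]]])
    then have "norm ((LINT x|M. (norm (f n x - l x))\<^sup>2) - 0) < e" if "n \<ge> n0" for n
      using that \<open>e > 0\<close> by (fastforce simp: integral_norm_square_nonneg)
    then show "\<exists>n0. \<forall>n\<ge>n0. norm ((LINT x|M. (norm (f n x - l x))\<^sup>2) - 0) < e" by blast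
  qed
  then show ?thesis using f sl by (simp add: L2_tendsto_def)
qed

definition L2_loc_tendsto :: "(nat \<Rightarrow> real^2 \<Rightarrow> real^2) \<Rightarrow> (real^2 \<Rightarrow> real^2) \<Rightarrow> bool" where
  "L2_loc_tendsto y u \<longleftrightarrow> (\<forall>R::nat. L2_tendsto lebesgue
     (\<lambda>n x. indicator (cball 0 (real R)) x *\<^sub>R y n x) (\<lambda>x. indicator (cball 0 (real R)) x *\<^sub>R u x))"

lemma continuous_borel_measurable_lebesgue:
  "continuous_on UNIV f \<Longrightarrow> f \<in> borel_measurable lebesgue"
  for f :: "'a::euclidean_space \<Rightarrow> 'b::{second_countable_topology, real_normed_vector}"
  by (intro measurable_completion) (simp add: borel_measurable_continuous_onI)

lemma continuous_square_integrable_indicator: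
  fixes f :: "'a::euclidean_space \<Rightarrow> 'b::euclidean_space"
  assumes f: "continuous_on UNIV f" and A: "bounded A" "A \<in> sets lebesgue"
  shows "square_integrable lebesgue (\<lambda>x. indicator A x *\<^sub>R f x)"
  unfolding square_integrable_def
proof
  show "(\<lambda>x. indicator A x *\<^sub>R f x) \<in> borel_measurable lebesgue"
    using A continuous_borel_measurable_lebesgue[OF f] by measurable
  have "integrable lebesgue (\<lambda>x. indicator A x *\<^sub>R (norm (f x))\<^sup>2)"
    by (intro continuous_set_integrable_bounded[unfolded set_integrable_def] continuous_intros f A)
  also have "(\<lambda>x. indicator A x *\<^sub>R (norm (f x))\<^sup>2) = (\<lambda>x. (norm (indicator A x *\<^sub>R f x))\<^sup>2)"
    by (auto simp: indicator_def)
  finally show "integrable lebesgue (\<lambda>x. (norm (indicator A x *\<^sub>R f x))\<^sup>2)" .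
qed

lemma nn_integral_indicator_norm_square:
  fixes f :: "'a::euclidean_space \<Rightarrow> 'b::euclidean_space"
  assumes "continuous_on UNIV f" "bounded A" "A \<in> sets lebesgue"
  shows "(\<integral>\<^sup>+x. indicator A x * ennreal ((norm (f x))\<^sup>2) \<partial>lebesgue) = ennreal (LINT x:A|lebesgue. (norm (f x))\<^sup>2)"
proof -
  have "(\<integral>\<^sup>+x. indicator A x * ennreal ((norm (f x))\<^sup>2) \<partial>lebesgue)
      = (\<integral>\<^sup>+x. ennreal ((norm (indicator A x *\<^sub>R f x))\<^sup>2) \<partial>lebesgue)"
    by (intro nn_integral_cong) (auto simp: indicator_def)
  also have "\<dots> = ennreal (LINT x|lebesgue. (norm (indicator A x *\<^sub>R f x))\<^sup>2)"
    by (rule nn_integral_norm_square_eq[OF continuous_square_integrable_indicator[OF assms]])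
  also have "(LINT x|lebesgue. (norm (indicator A x *\<^sub>R f x))\<^sup>2) = (LINT x:A|lebesgue. (norm (f x))\<^sup>2)"
    unfolding set_lebesgue_integral_def by (intro Bochner_Integration.integral_cong) (auto simp: indicator_def)
  finally show ?thesis .
qed

lemma cover_cball: "(\<Union>k::nat. cball (0 :: 'a::real_normed_vector) (real k)) = UNIV"
  by (auto intro: real_arch_simple)

text \<open>Near-minimality yields the strong convergence of the gradients of \<open>w\<close>.
  Velocities converge on balls for every choice of members from the classes, always to the same
  \<open>u\<close>.\<close>

lemma exists_limit:
  assumes F: "square_integrable lebesgue F" and \<omega>: "bounded \<omega>" "\<omega> \<in> sets lebesgue"
    and ne: "\<And>n. tail_class F \<omega> \<mu> a l n \<noteq> {}"
  obtains w u G where "\<And>n. w n \<in> tail_class F \<omega> \<mu> a l n" "u \<in> borel_measurable lebesgue"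
    "L2_tendsto lebesgue (\<lambda>n. gradient (w n)) G"
    "\<And>y. (\<And>n. y n \<in> tail_class F \<omega> \<mu> a l n) \<Longrightarrow> L2_loc_tendsto y u"
proof -
  let ?K = "tail_class F \<omega> \<mu> a l"
  have cont: "continuous_on UNIV w" "continuous_on UNIV (gradient w)" "square_integrable lebesgue (gradient w)"
    if "w \<in> ?K n" for w n
    using that tail_classD(1) admissibleD Ck_continuous continuous_on_gradient by blast+
  have cballs: "cball 0 (real k) \<in> sets lebesgue" "bounded (cball 0 (real k))" for k by auto
  have fin: "emeasure lebesgue (cball (0 :: real^2) (real k)) < \<infinity>" for k
  proof -
    have "emeasure lebesgue (cball (0 :: real^2) (real k)) = emeasure lborel (cball (0 :: real^2) (real k))" by simp
    then show ?thesis using emeasure_lborel_cball_finite unfolding infinity_ennreal_def less_top by metis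
  qed
  obtain w where w: "\<And>n. w n \<in> ?K n"
    and cG: "\<And>e. e > 0 \<Longrightarrow> \<exists>n0. \<forall>m\<ge>n0. \<forall>n\<ge>n0. (LINT x|lebesgue. (norm (gradient (w m) x - gradient (w n) x))\<^sup>2) \<le> e"
  proof (rule L2_cauchy_in_decreasing_convex_sets[of ?K lebesgue gradient "l + 1"])
    show "(LINT x|lebesgue. (norm (gradient w x))\<^sup>2) \<le> l + 1" if "w \<in> ?K 0" for w
      using tail_classD(5)[OF that] by simp
    show "square_integrable lebesgue (gradient w)" if "w \<in> ?K 0" for w
      using cont(3)[OF that] .
    show "\<exists>z\<in>?K n. \<forall>x. gradient z x = (1/2) *\<^sub>R (gradient v x + gradient w x)" if "v \<in> ?K n" "w \<in> ?K n" for v w n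
      by (rule tail_class_midpoint[OF F \<omega> that])
  qed (use ne tail_class_decreasing in auto)
  have mg: "gradient (w n) \<in> borel_measurable lebesgue" "w n \<in> borel_measurable lebesgue" for n
    using cont[OF w] by (auto intro: continuous_borel_measurable_lebesgue)
  have cG': "\<exists>n0. \<forall>m\<ge>n0. \<forall>n\<ge>n0. (\<integral>\<^sup>+x. indicator A x * ennreal ((norm (gradient (w m) x - gradient (w n) x))\<^sup>2) \<partial>lebesgue) \<le> ennreal e"
    if "e > 0" for e and A :: "(real^2) set"
  proof -
    obtain n0 where n0: "\<And>m n. m \<ge> n0 \<Longrightarrow> n \<ge> n0 \<Longrightarrow> (LINT x|lebesgue. (norm (gradient (w m) x - gradient (w n) x))\<^sup>2) \<le> e"
      using cG[OF \<open>e > 0\<close>] by blast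
    have "(\<integral>\<^sup>+x. indicator A x * ennreal ((norm (gradient (w m) x - gradient (w n) x))\<^sup>2) \<partial>lebesgue) \<le> ennreal e"
      if "m \<ge> n0" "n \<ge> n0" for m n
    proof -
      have "(\<integral>\<^sup>+x. indicator A x * ennreal ((norm (gradient (w m) x - gradient (w n) x))\<^sup>2) \<partial>lebesgue)
          \<le> (\<integral>\<^sup>+x. ennreal ((norm (gradient (w m) x - gradient (w n) x))\<^sup>2) \<partial>lebesgue)"
        by (intro nn_integral_mono) (auto simp: indicator_def)
      also have "\<dots> = ennreal (LINT x|lebesgue. (norm (gradient (w m) x - gradient (w n) x))\<^sup>2)"
        by (rule nn_integral_norm_square_eq[OF square_integrable_diff[OF cont(3)[OF w] cont(3)[OF w]]])
      also have "\<dots> \<le> ennreal e" by (rule ennreal_leI[OF n0[OF that]])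
      finally show ?thesis .
    qed
    then show ?thesis by blast
  qed
  obtain r G where r: "strict_mono r" and G: "G \<in> borel_measurable lebesgue"
    "AE x in lebesgue. (\<lambda>k. gradient (w (r k)) x) \<longlonglongrightarrow> G x"
    by (rule L2_cauchy_imp_AE_convergent_subsequence[of "\<lambda>n. gradient (w n)" lebesgue "\<lambda>k. cball 0 (real k)"])
      (use mg cG' in \<open>auto simp only: cover_cball fin cballs space_completion space_lborel space_borel\<close>)
  have lim_G: "L2_tendsto lebesgue (\<lambda>n. gradient (w n)) G"
  proof (rule L2_tendstoI[OF cont(3)[OF w] G(1)])
    fix e :: real assume "e > 0"
    then obtain n0 where n0: "\<And>m n. m \<ge> n0 \<Longrightarrow> n \<ge> n0 \<Longrightarrow>
        (\<integral>\<^sup>+x. indicator UNIV x * ennreal ((norm (gradient (w m) x - gradient (w n) x))\<^sup>2) \<partial>lebesgue) \<le> ennreal e"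
      using cG'[of e UNIV] by blast
    have "(\<integral>\<^sup>+x. indicator UNIV x * ennreal ((norm (gradient (w n) x - G x))\<^sup>2) \<partial>lebesgue) \<le> ennreal e" if "n \<ge> n0" for n
      by (rule nn_integral_diff_square_le_limit[of "\<lambda>n. gradient (w n)" lebesgue _ _ _ _ n0, OF mg(1) mg(1) _ r G(2)])
        (use n0 that in auto)
    then show "\<exists>n0. \<forall>n\<ge>n0. (\<integral>\<^sup>+x. ennreal ((norm (gradient (w n) x - G x))\<^sup>2) \<partial>lebesgue) \<le> ennreal e" by auto
  qed
  have cu: "\<exists>n0. \<forall>m\<ge>n0. \<forall>n\<ge>n0. \<forall>v\<in>?K m. \<forall>w\<in>?K n.
      (\<integral>\<^sup>+x. indicator (cball 0 (real R)) x * ennreal ((norm (v x - w x))\<^sup>2) \<partial>lebesgue) \<le> ennreal e"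
    if e: "e > 0" for e and R :: nat
  proof -
    obtain n0 where n0: "\<And>m n v w. m \<ge> n0 \<Longrightarrow> n \<ge> n0 \<Longrightarrow> v \<in> ?K m \<Longrightarrow> w \<in> ?K n \<Longrightarrow>
        (LINT x:cball 0 (real R)|lebesgue. (norm (v x - w x))\<^sup>2) \<le> e"
      using tail_class_cauchy[OF e, of F \<omega> \<mu> a l R] by blast
    have "(\<integral>\<^sup>+x. indicator (cball 0 (real R)) x * ennreal ((norm (v x - w x))\<^sup>2) \<partial>lebesgue) \<le> ennreal e"
      if "m \<ge> n0" "n \<ge> n0" "v \<in> ?K m" "w \<in> ?K n" for m n v w
      by (subst nn_integral_indicator_norm_square[OF continuous_on_diff[OF cont(1)[OF that(3)] cont(1)[OF that(4)]] cballs(2,1)])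
        (rule ennreal_leI[OF n0[OF that]])
    then show ?thesis by blast
  qed
  obtain s u where s: "strict_mono s" and u: "u \<in> borel_measurable lebesgue"
    "AE x in lebesgue. (\<lambda>k. w (s k) x) \<longlonglongrightarrow> u x"
  proof (rule L2_cauchy_imp_AE_convergent_subsequence[of w lebesgue "\<lambda>k. cball 0 (real k)"])
    show "\<exists>n0. \<forall>m\<ge>n0. \<forall>n\<ge>n0. (\<integral>\<^sup>+x. indicator (cball 0 (real k)) x * ennreal ((norm (w m x - w n x))\<^sup>2) \<partial>lebesgue) \<le> ennreal e"
      if "e > 0" for k e
      using cu[OF that, of k] w by blast
  qed (use mg in \<open>auto simp only: cover_cball fin cballs space_completion space_lborel space_borel\<close>)
  \<comment> \<open>\<open>u\<close> is constructed from \<open>w\<close>, but the Cauchy estimate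
    compares members of different sequences, so Fatou's lemma applies to \<open>y n\<close> against
    the subsequence of \<open>w\<close>.\<close>
  have lim_u: "L2_loc_tendsto y u" if y: "\<And>n. y n \<in> ?K n" for y
    unfolding L2_loc_tendsto_def
  proof
    fix R :: nat
    let ?B = "cball 0 (real R) :: (real^2) set"
    have my: "y n \<in> borel_measurable lebesgue" for n
      using cont[OF y] by (auto intro: continuous_borel_measurable_lebesgue)
    show "L2_tendsto lebesgue (\<lambda>n x. indicator ?B x *\<^sub>R y n x) (\<lambda>x. indicator ?B x *\<^sub>R u x)"
    proof (rule L2_tendstoI)
      show "square_integrable lebesgue (\<lambda>x. indicator ?B x *\<^sub>R y n x)" for n
        by (rule continuous_square_integrable_indicator[OF cont(1)[OF y] cballs(2,1)])
      show "(\<lambda>x. indicator ?B x *\<^sub>R u x) \<in> borel_measurable lebesgue"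
        by (intro borel_measurable_scaleR borel_measurable_indicator cballs(1) u(1))
      fix e :: real assume "e > 0"
      then obtain n0 where n0: "\<And>m n v w. m \<ge> n0 \<Longrightarrow> n \<ge> n0 \<Longrightarrow> v \<in> ?K m \<Longrightarrow> w \<in> ?K n \<Longrightarrow>
          (\<integral>\<^sup>+x. indicator ?B x * ennreal ((norm (v x - w x))\<^sup>2) \<partial>lebesgue) \<le> ennreal e"
        using cu[of e R] by blast
      have "(\<integral>\<^sup>+x. indicator ?B x * ennreal ((norm (y n x - u x))\<^sup>2) \<partial>lebesgue) \<le> ennreal e" if "n \<ge> n0" for n
        by (rule nn_integral_diff_square_le_limit[of w lebesgue _ _ _ _ n0, OF mg(2) my cballs(1) s u(2)])
          (use n0 that y w in blast)
      moreover have "ennreal ((norm (indicator ?B x *\<^sub>R y n x - indicator ?B x *\<^sub>R u x))\<^sup>2)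
          = indicator ?B x * ennreal ((norm (y n x - u x))\<^sup>2)" for n x
        by (auto simp: indicator_def)
      ultimately show "\<exists>n0. \<forall>n\<ge>n0. (\<integral>\<^sup>+x. ennreal ((norm (indicator ?B x *\<^sub>R y n x - indicator ?B x *\<^sub>R u x))\<^sup>2) \<partial>lebesgue) \<le> ennreal e"
        by auto
    qed
  qed
  show ?thesis by (rule that[OF w u(1) lim_G lim_u])
qed

section \<open>Limits of the linear, quadratic and convective integrals\<close>

lemma borel_measurable_matrix_vector_mult:
  fixes A :: "'a \<Rightarrow> real^'n::finite^'m::finite"
  assumes "A \<in> borel_measurable M" "x \<in> borel_measurable M"
  shows "(\<lambda>z. A z *v x z) \<in> borel_measurable M"
proof (rule borel_measurable_continuous_Pair[OF assms])
  show "continuous_on UNIV (\<lambda>z :: (real^'n^'m) \<times> (real^'n). fst z *v snd z)"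
    unfolding matrix_vector_mult_def by (intro continuous_intros)
qed

text \<open>The tensor product. It rewrites the convection term as a Frobenius product of the
  gradient with a tensor built from velocity and test field, that is, as a pairing of two
  \<open>L2\<close> convergent sequences.\<close>

definition outer :: "real^'m::finite \<Rightarrow> real^'n::finite \<Rightarrow> real^'n^'m" where
  "outer a b = (\<chi> i. a $ i *\<^sub>R b)"

lemma inner_outer: "A \<bullet> outer a b = (A *v b) \<bullet> a"
  by (simp add: outer_def inner_vec_def[of A] inner_vec_def[of "A *v b"] matrix_vector_mul_component mult.commute)

lemma norm_outer: "norm (outer a b) = norm a * norm b"
  by (simp add: outer_def norm_vec_def[of "\<chi> i. a $ i *\<^sub>R b"] norm_vec_def[of a] L2_set_left_distrib)

lemma outer_diff: "outer a (b - c) = outer a b - outer a c"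
  by (simp add: outer_def vec_eq_iff scaleR_diff_right right_diff_distrib)

lemma borel_measurable_outer:
  assumes "a \<in> borel_measurable M" "b \<in> borel_measurable M"
  shows "(\<lambda>z. outer (a z) (b z)) \<in> borel_measurable M"
proof (rule borel_measurable_continuous_Pair[OF assms])
  show "continuous_on UNIV (\<lambda>z :: (real^'m::finite) \<times> (real^'n::finite). outer (fst z) (snd z))"
    unfolding outer_def by (intro continuous_intros)
qed

lemma bounded_support_natural_radius:
  fixes f :: "'a::real_normed_vector \<Rightarrow> 'b::zero"
  assumes "bounded {x. f x \<noteq> 0}"
  obtains R :: nat where "\<And>x. x \<notin> cball 0 (real R) \<Longrightarrow> f x = 0"
proof -
  obtain r where r: "norm x \<le> r" if "f x \<noteq> 0" for x using assms by (auto simp: bounded_iff)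
  obtain R :: nat where "r \<le> real R" using real_arch_simple by blast
  then have "f x = 0" if "x \<notin> cball 0 (real R)" for x using r[of x] that by fastforce
  then show ?thesis by (rule that)
qed

lemma continuous_bounded_support_bounded:
  fixes f :: "'a::euclidean_space \<Rightarrow> 'b::real_normed_vector"
  assumes "continuous_on UNIV f" "bounded {x. f x \<noteq> 0}"
  obtains K where "\<And>x. norm (f x) \<le> K" "K \<ge> 0"
proof -
  obtain R :: nat where R: "\<And>x. x \<notin> cball 0 (real R) \<Longrightarrow> f x = 0"
    using bounded_support_natural_radius[OF assms(2)] by blast
  have "bounded (f ` cball 0 (real R))"
    by (intro compact_imp_bounded compact_continuous_image continuous_on_subset[OF assms(1)]) auto
  then obtain K where K: "\<And>x. x \<in> cball 0 (real R) \<Longrightarrow> norm (f x) \<le> K" by (force simp: bounded_iff)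
  have "norm (f x) \<le> max K 0" for x using K[of x] R[of x] by (cases "x \<in> cball 0 (real R)") auto
  then show ?thesis by (rule that) simp
qed

lemma L2_loc_integral_inner:
  assumes y: "L2_loc_tendsto y u" and \<psi>: "square_integrable lebesgue \<psi>" "bounded {x. \<psi> x \<noteq> 0}"
  shows "(\<lambda>n. LINT x|lebesgue. y n x \<bullet> \<psi> x) \<longlonglongrightarrow> (LINT x|lebesgue. u x \<bullet> \<psi> x)"
proof -
  obtain R :: nat where R: "\<And>x. x \<notin> cball 0 (real R) \<Longrightarrow> \<psi> x = 0"
    using bounded_support_natural_radius[OF \<psi>(2)] by blast
  let ?i = "indicator (cball 0 (real R)) :: real^2 \<Rightarrow> real"
  have "(\<lambda>n. LINT x|lebesgue. (?i x *\<^sub>R y n x) \<bullet> \<psi> x) \<longlonglongrightarrow> (LINT x|lebesgue. (?i x *\<^sub>R u x) \<bullet> \<psi> x)"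
    using y by (intro L2_tendsto_integral_inner L2_tendsto_const \<psi>(1)) (simp add: L2_loc_tendsto_def)
  moreover have "(?i x *\<^sub>R v) \<bullet> \<psi> x = v \<bullet> \<psi> x" for v x using R[of x] by (auto simp: indicator_def)
  ultimately show ?thesis by (simp only:)
qed

text \<open>On the support of \<open>A\<close>, which lies in a ball, multiplication by the bounded
  field \<open>A\<close> preserves \<open>L2\<close> convergence, so both factors converge. This is
  the convection term after integration by parts.\<close>

lemma L2_loc_integral_quadratic:
  fixes A :: "real^2 \<Rightarrow> real^2^2"
  assumes y: "L2_loc_tendsto y u" and A: "continuous_on UNIV A" "bounded {x. A x \<noteq> 0}"
  shows "(\<lambda>n. LINT x|lebesgue. (A x *v y n x) \<bullet> y n x) \<longlonglongrightarrow> (LINT x|lebesgue. (A x *v u x) \<bullet> u x)"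
proof -
  obtain R :: nat where R: "\<And>x. x \<notin> cball 0 (real R) \<Longrightarrow> A x = 0"
    using bounded_support_natural_radius[OF A(2)] by blast
  obtain K where K: "\<And>x. norm (A x) \<le> K" "K \<ge> 0" using continuous_bounded_support_bounded[OF A] by blast
  let ?i = "indicator (cball 0 (real R)) :: real^2 \<Rightarrow> real"
  have lim: "L2_tendsto lebesgue (\<lambda>n x. ?i x *\<^sub>R y n x) (\<lambda>x. ?i x *\<^sub>R u x)"
    using y by (simp add: L2_loc_tendsto_def)
  note meas = square_integrableD(1)[OF L2_tendstoD(1)[OF lim]] square_integrableD(1)[OF L2_tendstoD(2)[OF lim]]
  have bound: "norm (A x *v v) \<le> K * norm v" for x v
    by (rule order_trans[OF norm_matrix_vector_mult_le mult_right_mono[OF K(1) norm_ge_zero]])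
  have "L2_tendsto lebesgue (\<lambda>n x. A x *v (?i x *\<^sub>R y n x)) (\<lambda>x. A x *v (?i x *\<^sub>R u x))"
  proof (rule L2_tendsto_norm_bounded[OF lim, where K = K])
    show "norm (A x *v (?i x *\<^sub>R y n x) - A x *v (?i x *\<^sub>R u x)) \<le> K * norm (?i x *\<^sub>R y n x - ?i x *\<^sub>R u x)" for n x
      by (subst matrix_vector_mult_diff_distrib[symmetric]) (rule bound)
  qed (intro bound borel_measurable_matrix_vector_mult continuous_borel_measurable_lebesgue[OF A(1)] meas)+
  then have "(\<lambda>n. LINT x|lebesgue. (A x *v (?i x *\<^sub>R y n x)) \<bullet> (?i x *\<^sub>R y n x))
      \<longlonglongrightarrow> (LINT x|lebesgue. (A x *v (?i x *\<^sub>R u x)) \<bullet> (?i x *\<^sub>R u x))"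
    by (rule L2_tendsto_integral_inner[OF _ lim])
  moreover have "(A x *v (?i x *\<^sub>R v)) \<bullet> (?i x *\<^sub>R v) = (A x *v v) \<bullet> v" for v x
    using R[of x] by (auto simp: indicator_def)
  ultimately show ?thesis by (simp only:)
qed

text \<open>The convection term in its original form: gradients converge strongly, and the tensor of
  the bounded test field with the velocity converges because the support lies in a ball.\<close>

lemma L2_loc_integral_convection:
  fixes G :: "real^2 \<Rightarrow> real^2^2"
  assumes y: "L2_loc_tendsto y u" and g: "L2_tendsto lebesgue g G"
    and \<phi>: "continuous_on UNIV \<phi>" "bounded {x. \<phi> x \<noteq> 0}"
  shows "(\<lambda>n. LINT x|lebesgue. (g n x *v y n x) \<bullet> \<phi> x) \<longlonglongrightarrow> (LINT x|lebesgue. (G x *v u x) \<bullet> \<phi> x)"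
proof -
  obtain R :: nat where R: "\<And>x. x \<notin> cball 0 (real R) \<Longrightarrow> \<phi> x = 0"
    using bounded_support_natural_radius[OF \<phi>(2)] by blast
  obtain K where K: "\<And>x. norm (\<phi> x) \<le> K" "K \<ge> 0" using continuous_bounded_support_bounded[OF \<phi>] by blast
  let ?i = "indicator (cball 0 (real R)) :: real^2 \<Rightarrow> real"
  have lim: "L2_tendsto lebesgue (\<lambda>n x. ?i x *\<^sub>R y n x) (\<lambda>x. ?i x *\<^sub>R u x)"
    using y by (simp add: L2_loc_tendsto_def)
  note meas = square_integrableD(1)[OF L2_tendstoD(1)[OF lim]] square_integrableD(1)[OF L2_tendstoD(2)[OF lim]]
  have bound: "norm (outer (\<phi> x) v) \<le> K * norm v" for x v
    unfolding norm_outer by (rule mult_right_mono[OF K(1) norm_ge_zero])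
  have "L2_tendsto lebesgue (\<lambda>n x. outer (\<phi> x) (?i x *\<^sub>R y n x)) (\<lambda>x. outer (\<phi> x) (?i x *\<^sub>R u x))"
  proof (rule L2_tendsto_norm_bounded[OF lim, where K = K])
    show "norm (outer (\<phi> x) (?i x *\<^sub>R y n x) - outer (\<phi> x) (?i x *\<^sub>R u x)) \<le> K * norm (?i x *\<^sub>R y n x - ?i x *\<^sub>R u x)" for n x
      by (subst outer_diff[symmetric]) (rule bound)
  qed (intro bound borel_measurable_outer continuous_borel_measurable_lebesgue[OF \<phi>(1)] meas)+
  then have "(\<lambda>n. LINT x|lebesgue. g n x \<bullet> outer (\<phi> x) (?i x *\<^sub>R y n x))
      \<longlonglongrightarrow> (LINT x|lebesgue. G x \<bullet> outer (\<phi> x) (?i x *\<^sub>R u x))"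
    by (rule L2_tendsto_integral_inner[OF g])
  moreover have "B \<bullet> outer (\<phi> x) (?i x *\<^sub>R v) = (B *v v) \<bullet> \<phi> x" for B x and v :: "real^2"
    unfolding inner_outer using R[of x] by (auto simp: indicator_def)
  ultimately show ?thesis by (simp only:)
qed

section \<open>Measurability and uniqueness of weak gradients\<close>

lemma locally_integrable_borel_measurable:
  assumes "locally_integrable f"
  shows "f \<in> borel_measurable lebesgue"
proof (rule borel_measurable_LIMSEQ_metric)
  show "(\<lambda>x. indicator (cball 0 (real n)) x *\<^sub>R f x) \<in> borel_measurable lebesgue" for n
  proof -
    have "set_integrable lebesgue (cball 0 (real n)) f" using assms by (simp add: locally_integrable_def)
    then show ?thesis unfolding set_integrable_def by (rule borel_measurable_integrable)
  qed
  show "(\<lambda>n. indicator (cball 0 (real n)) x *\<^sub>R f x) \<longlonglongrightarrow> f x" for x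
  proof (rule tendsto_eventually)
    obtain n0 :: nat where "norm x \<le> real n0" using real_arch_simple by blast
    then show "\<forall>\<^sub>F n in sequentially. indicator (cball 0 (real n)) x *\<^sub>R f x = f x"
      by (intro eventually_sequentiallyI[of n0]) (auto simp: indicator_def)
  qed
qed

lemma test_functionsD:
  assumes "\<phi> \<in> test_functions"
  shows "Ck k \<phi>" "continuous_on UNIV \<phi>" "bounded {x. \<phi> x \<noteq> 0}"
proof -
  show "Ck k \<phi>" for k using assms by (simp add: test_functions_def)
  then show "continuous_on UNIV \<phi>" by (rule Ck_continuous)
  show "bounded {x. \<phi> x \<noteq> 0}"
    using assms by (auto simp: test_functions_def intro: bounded_subset[OF compact_imp_bounded closure_subset])
qed

lemma integrable_component_mult_test_function:
  fixes G :: "real^2 \<Rightarrow> real^2^2"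
  assumes G: "locally_integrable G" and \<phi>: "continuous_on UNIV \<phi>" "bounded {x. \<phi> x \<noteq> 0}"
  shows "integrable lebesgue (\<lambda>x. G x $ i $ j * \<phi> x)"
proof -
  obtain R :: nat where R: "\<And>x. x \<notin> cball 0 (real R) \<Longrightarrow> \<phi> x = 0"
    using bounded_support_natural_radius[OF \<phi>(2)] by blast
  obtain K where K: "\<And>x. norm (\<phi> x) \<le> K" "K \<ge> 0" using continuous_bounded_support_bounded[OF \<phi>] by blast
  have [measurable]: "G \<in> borel_measurable lebesgue" by (rule locally_integrable_borel_measurable[OF G])
  have [measurable]: "\<phi> \<in> borel_measurable lebesgue" by (rule continuous_borel_measurable_lebesgue[OF \<phi>(1)])
  show ?thesis
  proof (rule Bochner_Integration.integrable_bound)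
    show "integrable lebesgue (\<lambda>x. K *\<^sub>R (indicator (cball 0 (real R)) x *\<^sub>R G x))"
      using G by (intro integrable_scaleR_right) (simp add: locally_integrable_def set_integrable_def)
    show "(\<lambda>x. G x $ i $ j * \<phi> x) \<in> borel_measurable lebesgue"
    proof -
      have "(\<lambda>x. G x $ i $ j) = (\<lambda>A. A $ i $ j) \<circ> G" by auto
      moreover have "(\<lambda>A :: real^2^2. A $ i $ j) \<in> borel_measurable borel"
        by (intro borel_measurable_continuous_onI continuous_intros)
      ultimately have [measurable]: "(\<lambda>x. G x $ i $ j) \<in> borel_measurable lebesgue"
        by (metis measurable_comp \<open>G \<in> borel_measurable lebesgue\<close>)
      show ?thesis by measurable
    qed
    show "AE x in lebesgue. norm (G x $ i $ j * \<phi> x) \<le> norm (K *\<^sub>R (indicator (cball 0 (real R)) x *\<^sub>R G x))"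
    proof (rule AE_I2)
      fix x
      show "norm (G x $ i $ j * \<phi> x) \<le> norm (K *\<^sub>R (indicator (cball 0 (real R)) x *\<^sub>R G x))"
      proof (cases "x \<in> cball 0 (real R)")
        case True
        have "\<bar>G x $ i $ j\<bar> \<le> norm (G x)"
          using component_le_norm_cart[of "G x $ i" j] Finite_Cartesian_Product.norm_nth_le[of "G x" i] by simp
        then have "\<bar>G x $ i $ j\<bar> * \<bar>\<phi> x\<bar> \<le> norm (G x) * K"
          using K by (intro mult_mono) auto
        then show ?thesis using True K(2) by (simp add: abs_mult mult.commute)
      qed (simp add: R)
    qed
  qed
qed

text \<open>The fundamental lemma for each entry of \<open>G - H\<close>. It links the
  representative chosen by \<open>weak_gradient\<close> to the limit constructed here.\<close>

lemma has_weak_gradient_unique: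
  assumes u: "has_weak_gradient u G" and v: "has_weak_gradient u H"
  shows "AE x in lebesgue. G x = H x"
proof -
  have loc: "locally_integrable G" "locally_integrable H" using u v by (auto simp: has_weak_gradient_def)
  have "AE x in lebesgue. G x $ i $ j - H x $ i $ j = 0" for i j
  proof (rule fundamental_lemma)
    fix K :: "(real^2) set" assume K: "compact K"
    have "integrable lebesgue (\<lambda>x. (indicator K x *\<^sub>R L x) $ i $ j)" if "locally_integrable L" for L :: "real^2 \<Rightarrow> real^2^2"
      using that K by (intro integrable_bounded_linear[OF bounded_linear_vec_nth])
        (simp add: locally_integrable_def set_integrable_def)
    from this[OF loc(1)] this[OF loc(2)]
    show "set_integrable lebesgue K (\<lambda>x. G x $ i $ j - H x $ i $ j)"
      by (simp add: set_integrable_def right_diff_distrib)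
  next
    fix \<phi> :: "real^2 \<Rightarrow> real" assume \<phi>: "\<phi> \<in> test_functions"
    have "(LINT x|lebesgue. G x $ i $ j * \<phi> x) = (LINT x|lebesgue. H x $ i $ j * \<phi> x)"
      using u v \<phi> by (simp add: has_weak_gradient_def)
    then show "(LINT x|lebesgue. (G x $ i $ j - H x $ i $ j) * \<phi> x) = 0"
      using integrable_component_mult_test_function[OF loc(1) test_functionsD(2,3)[OF \<phi>], of i j]
        integrable_component_mult_test_function[OF loc(2) test_functionsD(2,3)[OF \<phi>], of i j]
      by (simp add: left_diff_distrib)
  qed
  then have "AE x in lebesgue. \<forall>i j. G x $ i $ j - H x $ i $ j = 0"
    by (simp add: AE_all_countable)
  then show ?thesis by eventually_elim (simp add: vec_eq_iff)
qed

lemma weak_gradient_AE_eq: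
  assumes "has_weak_gradient u G"
  shows "AE x in lebesgue. weak_gradient u x = G x" "weak_gradient u \<in> borel_measurable lebesgue"
proof -
  have w: "has_weak_gradient u (weak_gradient u)"
    unfolding weak_gradient_def by (rule someI[where P = "has_weak_gradient u", OF assms])
  show "AE x in lebesgue. weak_gradient u x = G x" by (rule has_weak_gradient_unique[OF w assms])
  show "weak_gradient u \<in> borel_measurable lebesgue"
    using w by (auto simp: has_weak_gradient_def intro: locally_integrable_borel_measurable)
qed

section \<open>Passing to the limit in the equation and in the side conditions\<close>

lemma residual_integrated:
  assumes w: "w \<in> admissible" and \<phi>: "\<phi> \<in> solenoidal_test_functions"
  shows "residual F w \<phi> = - (LINT x|lebesgue. w x \<bullet> (\<Sum>j\<in>UNIV. partial_deriv j (partial_deriv j \<phi>) x))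
    - (LINT x|lebesgue. (gradient \<phi> x *v w x) \<bullet> w x) - (LINT x|lebesgue. F x \<bullet> gradient \<phi> x)"
  unfolding residual_def
    integral_gradient_inner_gradient[OF admissibleD(1)[OF w] solenoidal_test_functionsD(1,3)[OF \<phi>]]
    convection_antisymmetric[OF admissibleD(1,2)[OF w] admissibleD(1)[OF w] solenoidal_test_functionsD(1,3)[OF \<phi>]]
  by simp

text \<open>The limit involves \<open>u\<close> but neither \<open>y\<close> nor any derivative of
  \<open>u\<close>, so all sequences with the same local limit have the same limiting
  residual.\<close>

lemma residual_tendsto:
  assumes y: "L2_loc_tendsto y u" "\<And>n. y n \<in> admissible" and \<phi>: "\<phi> \<in> solenoidal_test_functions"
  shows "(\<lambda>n. residual F (y n) \<phi>) \<longlonglongrightarrow>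
    - (LINT x|lebesgue. u x \<bullet> (\<Sum>j\<in>UNIV. partial_deriv j (partial_deriv j \<phi>) x))
    - (LINT x|lebesgue. (gradient \<phi> x *v u x) \<bullet> u x) - (LINT x|lebesgue. F x \<bullet> gradient \<phi> x)"
proof -
  note D = solenoidal_test_functionsD[OF \<phi>]
  have C1: "Ck (Suc 0) (partial_deriv j \<phi>)" for j by (rule Ck_partial_deriv[OF D(1)])
  have "{x. (\<Sum>j\<in>UNIV. partial_deriv j (partial_deriv j \<phi>) x) \<noteq> 0} \<subseteq> (\<Union>j\<in>UNIV. {x. partial_deriv j (partial_deriv j \<phi>) x \<noteq> 0})"
    by (rule subsetI, rule ccontr) simp
  then have supp: "bounded {x. (\<Sum>j\<in>UNIV. partial_deriv j (partial_deriv j \<phi>) x) \<noteq> 0}"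
    using bounded_support_partial_deriv[OF bounded_support_partial_deriv[OF D(3)]]
    by (elim bounded_subset[rotated]) auto
  have sq: "square_integrable lebesgue (\<lambda>x. \<Sum>j\<in>UNIV. partial_deriv j (partial_deriv j \<phi>) x)"
    by (intro square_integrable_continuous_bounded_support supp continuous_on_sum partial_deriv_continuous[OF C1])
  show ?thesis
    unfolding residual_integrated[OF y(2) \<phi>]
    by (intro tendsto_diff tendsto_minus tendsto_const L2_loc_integral_inner[OF y(1) sq supp]
        L2_loc_integral_quadratic[OF y(1)] continuous_on_gradient[OF D(1)] bounded_support_gradient[OF D(3)])
qed

lemma L2_loc_limit_square_integrable:
  "L2_loc_tendsto y u \<Longrightarrow> square_integrable lebesgue (\<lambda>x. indicator (cball 0 (real R)) x *\<^sub>R u x)"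
  unfolding L2_loc_tendsto_def using L2_tendstoD(2) by blast

lemma locally_integrableI:
  fixes f :: "real^2 \<Rightarrow> 'b::euclidean_space"
  assumes "\<And>R::nat. square_integrable lebesgue (\<lambda>x. indicator (cball 0 (real R)) x *\<^sub>R f x)"
  shows "locally_integrable f" "bounded A \<Longrightarrow> A \<in> sets lebesgue \<Longrightarrow> set_integrable lebesgue A f"
proof -
  show *: "set_integrable lebesgue A f" if A: "bounded A" "A \<in> sets lebesgue" for A
  proof -
    obtain r where "\<forall>x\<in>A. norm x \<le> r" using A(1) by (auto simp: bounded_iff)
    moreover obtain R :: nat where "r \<le> real R" using real_arch_simple by blast
    ultimately have "A \<subseteq> cball 0 (real R)" by fastforce
    moreover have "set_integrable lebesgue (cball 0 (real R)) f"
      by (rule set_integrable_square_integrable[OF assms]) auto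
    ultimately show ?thesis using A(2) set_integrable_subset by blast
  qed
  show "locally_integrable f"
    unfolding locally_integrable_def using * compact_imp_bounded lmeasurable_compact fmeasurableD by blast
qed

lemma square_integrable_indicator:
  assumes f: "square_integrable M f" and A: "A \<in> sets M"
  shows "square_integrable M (\<lambda>x. indicator A x *\<^sub>R f x)"
proof (rule square_integrable_bound[OF f, where K = 1])
  show "(\<lambda>x. indicator A x *\<^sub>R f x) \<in> borel_measurable M"
    by (intro borel_measurable_scaleR borel_measurable_indicator A square_integrableD(1)[OF f])
qed (simp add: indicator_def)

text \<open>Both sides of the integration by parts formula for \<open>w n\<close> converge;
  multiplying the scalar test function by \<open>axis\<close> vectors extracts single
  entries.\<close>

lemma limit_has_weak_gradient:
  assumes w: "\<And>n. w n \<in> admissible" and u: "L2_loc_tendsto w u" and G: "L2_tendsto lebesgue (\<lambda>n. gradient (w n)) G"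
  shows "has_weak_gradient u G"
  unfolding has_weak_gradient_def
proof (intro conjI ballI allI)
  show "locally_integrable u" by (rule locally_integrableI(1)[OF L2_loc_limit_square_integrable[OF u]])
  show "locally_integrable G"
    by (rule locally_integrableI(1)[OF square_integrable_indicator[OF L2_tendstoD(2)[OF G]]]) simp
  fix \<phi> :: "real^2 \<Rightarrow> real" and i j assume \<phi>: "\<phi> \<in> test_functions"
  note D = test_functionsD[OF \<phi>]
  have supp: "bounded {x. partial_deriv j \<phi> x \<noteq> 0}" by (rule bounded_support_partial_deriv[OF D(3)])
  have "(\<lambda>n. LINT x|lebesgue. w n x \<bullet> (partial_deriv j \<phi> x *\<^sub>R axis i 1))
      \<longlonglongrightarrow> (LINT x|lebesgue. u x \<bullet> (partial_deriv j \<phi> x *\<^sub>R axis i 1))"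
    using supp
    by (intro L2_loc_integral_inner[OF u] square_integrable_continuous_bounded_support
        continuous_on_scaleR continuous_on_const partial_deriv_continuous[OF D(1)]) (auto elim: bounded_subset)
  then have 1: "(\<lambda>n. LINT x|lebesgue. w n x $ i * partial_deriv j \<phi> x) \<longlonglongrightarrow> (LINT x|lebesgue. u x $ i * partial_deriv j \<phi> x)"
    by (simp add: inner_axis mult.commute)
  have "square_integrable lebesgue (\<lambda>x. \<phi> x *\<^sub>R (axis i (axis j 1) :: real^2^2))"
    using D(3) by (intro square_integrable_continuous_bounded_support continuous_on_scaleR continuous_on_const D(2))
      (auto elim: bounded_subset)
  then have "(\<lambda>n. LINT x|lebesgue. gradient (w n) x \<bullet> (\<phi> x *\<^sub>R axis i (axis j 1)))
      \<longlonglongrightarrow> (LINT x|lebesgue. G x \<bullet> (\<phi> x *\<^sub>R axis i (axis j 1)))"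
    by (intro L2_tendsto_integral_inner[OF G] L2_tendsto_const)
  then have 2: "(\<lambda>n. LINT x|lebesgue. gradient (w n) x $ i $ j * \<phi> x) \<longlonglongrightarrow> (LINT x|lebesgue. G x $ i $ j * \<phi> x)"
    by (simp add: inner_axis mult.commute)
  have "(LINT x|lebesgue. w n x $ i * partial_deriv j \<phi> x) = - (LINT x|lebesgue. gradient (w n) x $ i $ j * \<phi> x)" for n
  proof -
    note C = admissibleD(1)[OF w]
    have "partial_deriv j (\<lambda>x. w n x $ i) x = gradient (w n) x $ i $ j" for x
      unfolding gradient_nth by (rule partial_deriv_component[OF Ck_differentiable[OF C]])
    then show ?thesis using integration_by_parts[OF Ck_component[OF C] D(1) D(3), of n i j] by simp
  qed
  with 1 have "(\<lambda>n. - (LINT x|lebesgue. gradient (w n) x $ i $ j * \<phi> x)) \<longlonglongrightarrow> (LINT x|lebesgue. u x $ i * partial_deriv j \<phi> x)"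
    by simp
  then show "(LINT x|lebesgue. u x $ i * partial_deriv j \<phi> x) = - (LINT x|lebesgue. G x $ i $ j * \<phi> x)"
    using tendsto_minus[OF 2] by (rule LIMSEQ_unique)
qed

text \<open>For \<open>w n\<close> the integrand is the divergence of the product of the field with
  the test function, because \<open>w n\<close> is divergence-free.\<close>

lemma limit_weakly_divergence_free:
  assumes w: "\<And>n. w n \<in> admissible" and u: "L2_loc_tendsto w u"
  shows "weakly_divergence_free u"
  unfolding weakly_divergence_free_def
proof
  fix \<phi> :: "real^2 \<Rightarrow> real" assume \<phi>: "\<phi> \<in> test_functions"
  note D = test_functionsD[OF \<phi>]
  let ?\<psi> = "\<lambda>x. (\<chi> j. partial_deriv j \<phi> x) :: real^2"
  have "{x. ?\<psi> x \<noteq> 0} \<subseteq> (\<Union>j\<in>UNIV. {x. partial_deriv j \<phi> x \<noteq> 0})" by (auto simp: vec_eq_iff)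
  then have supp: "bounded {x. ?\<psi> x \<noteq> 0}"
    using bounded_support_partial_deriv[OF D(3)] by (elim bounded_subset[rotated]) auto
  have "square_integrable lebesgue ?\<psi>"
    by (intro square_integrable_continuous_bounded_support supp continuous_on_vec_lambda partial_deriv_continuous[OF D(1)])
  from L2_loc_integral_inner[OF u this supp]
  have lim: "(\<lambda>n. LINT x|lebesgue. (\<Sum>j\<in>UNIV. w n x $ j * partial_deriv j \<phi> x))
      \<longlonglongrightarrow> (LINT x|lebesgue. (\<Sum>j\<in>UNIV. u x $ j * partial_deriv j \<phi> x))"
    by (simp add: inner_vec_def)
  have "(LINT x|lebesgue. (\<Sum>j\<in>UNIV. w n x $ j * partial_deriv j \<phi> x)) = 0" for n
  proof -
    note C = admissibleD(1)[OF w, of n]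
    let ?h = "\<lambda>j x. w n x $ j * \<phi> x"
    have "partial_deriv j (?h j) x = w n x $ j * partial_deriv j \<phi> x + partial_deriv j (w n) x $ j * \<phi> x" for j x
      using partial_deriv_mult[OF Ck_differentiable[OF Ck_component[OF C, of j]] Ck_differentiable[OF D(1)], of j x]
        partial_deriv_component[OF Ck_differentiable[OF C], of j j x] by simp
    then have "(\<Sum>j\<in>UNIV. partial_deriv j (?h j) x) = (\<Sum>j\<in>UNIV. w n x $ j * partial_deriv j \<phi> x)" for x
      using admissibleD(2)[OF w, of n x] by (simp add: sum.distrib divergence_eq flip: sum_distrib_right)
    moreover have "(LINT x|lebesgue. (\<Sum>j\<in>UNIV. partial_deriv j (?h j) x)) = 0"
      using D(3) by (intro integral_sum_partial_deriv_eq_0 Ck_mult Ck_component[OF C] D(1)) (auto elim: bounded_subset)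
    ultimately show ?thesis by simp
  qed
  with lim show "(LINT x|lebesgue. (\<Sum>j\<in>UNIV. u x $ j * partial_deriv j \<phi> x)) = 0"
    by (simp add: LIMSEQ_const_iff)
qed

text \<open>Pair the convergence on balls with the indicator of \<open>A\<close> times a vector
  \<open>b\<close>.\<close>

lemma limit_integral_eq:
  assumes u: "L2_loc_tendsto w u" and A: "bounded A" "A \<in> sets lebesgue"
    and c: "\<And>n. continuous_on UNIV (w n)" "\<And>n. (LINT x:A|lebesgue. w n x) = m"
  shows "(LINT x:A|lebesgue. u x) = m"
proof -
  have "(LINT x:A|lebesgue. u x) \<bullet> b = m \<bullet> b" for b
  proof -
    have *: "(LINT x|lebesgue. v x \<bullet> (indicator A x *\<^sub>R b)) = (LINT x:A|lebesgue. v x) \<bullet> b"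
      if "set_integrable lebesgue A v" for v :: "real^2 \<Rightarrow> real^2"
      using integral_inner_left[OF that[unfolded set_integrable_def], of b] by (simp add: set_lebesgue_integral_def)
    have "(\<lambda>n. LINT x|lebesgue. w n x \<bullet> (indicator A x *\<^sub>R b)) \<longlonglongrightarrow> (LINT x|lebesgue. u x \<bullet> (indicator A x *\<^sub>R b))"
      using A by (intro L2_loc_integral_inner[OF u] continuous_square_integrable_indicator continuous_on_const)
        (auto elim!: bounded_subset simp: indicator_def split: if_splits)
    then have "(\<lambda>n. (LINT x:A|lebesgue. w n x) \<bullet> b) \<longlonglongrightarrow> (LINT x:A|lebesgue. u x) \<bullet> b"
      by (simp only: *[OF continuous_set_integrable_bounded[OF c(1) A]]
          *[OF locally_integrableI(2)[OF L2_loc_limit_square_integrable[OF u] A]])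
    then show ?thesis by (simp add: c(2) LIMSEQ_const_iff)
  qed
  then show ?thesis using vector_eq_rdot by blast
qed

theorem theorem6:
  fixes \<omega> :: "(real^2) set" and F :: "real^2 \<Rightarrow> real^2^2" and \<mu> :: "real^2"
  assumes "bounded \<omega>" and "\<omega> \<in> sets lebesgue" and "measure lebesgue \<omega> > 0"
    and "F \<in> L2"
  shows "\<exists>u. weak_solution F u
    \<and> (1 / measure lebesgue \<omega>) *\<^sub>R (LINT x:\<omega>|lebesgue. u x) = \<mu>
    \<and> (L2_norm (weak_gradient u))\<^sup>2 \<le> L2_inner F (weak_gradient u)
    \<and> L2_norm (weak_gradient u) \<le> L2_norm F"
proof -
  have F: "square_integrable lebesgue F" using \<open>F \<in> L2\<close> by (simp add: L2_iff_square_integrable)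
  note \<omega> = assms(1-3)
  obtain a l where al: "\<And>\<phi> n. \<phi> \<in> solenoidal_test_functions \<Longrightarrow>
      \<exists>w\<in>tail_class F \<omega> \<mu> a l n. \<bar>residual F w \<phi>\<bar> \<le> 1 / real (Suc n)"
    using exists_limit_moments[OF F \<omega>] by blast
  have "tail_class F \<omega> \<mu> a l n \<noteq> {}" for n using al[OF zero_solenoidal_test_function] by blast
  then obtain w u G where w: "\<And>n. w n \<in> tail_class F \<omega> \<mu> a l n" and u: "u \<in> borel_measurable lebesgue"
    and G: "L2_tendsto lebesgue (\<lambda>n. gradient (w n)) G"
    and lim: "\<And>y. (\<And>n. y n \<in> tail_class F \<omega> \<mu> a l n) \<Longrightarrow> L2_loc_tendsto y u"
    using exists_limit[OF F \<omega>(1,2)] by blast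
  note adm = tail_classD(1)[OF w]
  note lw = lim[OF w]
  have sG: "square_integrable lebesgue G" by (rule L2_tendstoD(2)[OF G])
  have wg: "has_weak_gradient u G" by (rule limit_has_weak_gradient[OF adm lw G])
  define W where "W = weak_gradient u"
  have AE: "AE x in lebesgue. W x = G x" and mW: "W \<in> borel_measurable lebesgue"
    using weak_gradient_AE_eq[OF wg] by (simp_all add: W_def)
  note mG = square_integrableD(1)[OF sG]
  \<comment> \<open>\<open>weak_gradient u\<close> agrees with \<open>G\<close> only almost
    everywhere; this carries integrals from one to the other.\<close>
  have cong: "(LINT x|lebesgue. f x (W x)) = (LINT x|lebesgue. f x (G x))"
    if "(\<lambda>x. f x (W x)) \<in> borel_measurable lebesgue" "(\<lambda>x. f x (G x)) \<in> borel_measurable lebesgue" for f :: "_ \<Rightarrow> _ \<Rightarrow> real"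
    using AE by (intro integral_cong_AE that) auto
  have "u \<in> H1_dot_sigma"
    using wg sG limit_weakly_divergence_free[OF adm lw] L2_iff_square_integrable[of G]
    unfolding H1_dot_sigma_def H1_dot_def by (auto simp: has_weak_gradient_def)
  moreover have "L2_inner W (gradient \<phi>) + L2_inner (\<lambda>x. W x *v u x) \<phi> = L2_inner F (gradient \<phi>)"
    if \<phi>: "\<phi> \<in> solenoidal_test_functions" for \<phi>
  proof -
    note D = solenoidal_test_functionsD[OF \<phi>]
    have c\<phi>: "continuous_on UNIV \<phi>" by (rule Ck_continuous[OF D(1)])
    have mg: "gradient \<phi> \<in> borel_measurable lebesgue" "\<phi> \<in> borel_measurable lebesgue"
      by (intro continuous_borel_measurable_lebesgue continuous_on_gradient[OF D(1)] c\<phi>)+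
    \<comment> \<open>This sequence depends on \<open>\<phi>\<close>, and convergence of its
      gradients is not known; what it shares with \<open>w\<close> is the local limit
      \<open>u\<close>.\<close>
    have "\<exists>y. \<forall>n. y n \<in> tail_class F \<omega> \<mu> a l n \<and> \<bar>residual F (y n) \<phi>\<bar> \<le> 1 / real (Suc n)"
      using al[OF \<phi>] by (intro choice) blast
    then obtain y where y: "\<And>n. y n \<in> tail_class F \<omega> \<mu> a l n" "\<And>n. \<bar>residual F (y n) \<phi>\<bar> \<le> 1 / real (Suc n)"
      by blast
    have "(\<lambda>n. residual F (y n) \<phi>) \<longlonglongrightarrow> 0"
      by (rule Lim_null_comparison[OF always_eventually[OF allI] LIMSEQ_inverse_real_of_nat])
        (use y(2) in \<open>simp add: inverse_eq_divide\<close>)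
    from LIMSEQ_unique[OF residual_tendsto[OF lim[OF y(1)] tail_classD(1)[OF y(1)] \<phi>] this]
    have "(\<lambda>n. residual F (w n) \<phi>) \<longlonglongrightarrow> 0"
      using residual_tendsto[OF lw adm \<phi>, of F] by simp
    \<comment> \<open>The residuals of \<open>w\<close> once more, now in original form, where
      strong convergence of the gradients identifies the limit.\<close>
    moreover have "(\<lambda>n. residual F (w n) \<phi>) \<longlonglongrightarrow> (LINT x|lebesgue. G x \<bullet> gradient \<phi> x)
        + (LINT x|lebesgue. (G x *v u x) \<bullet> \<phi> x) - (LINT x|lebesgue. F x \<bullet> gradient \<phi> x)"
      unfolding residual_def
      by (intro tendsto_intros L2_tendsto_integral_inner[OF G] L2_tendsto_const L2_loc_integral_convection[OF lw G]
          c\<phi> D(3) square_integrable_continuous_bounded_support continuous_on_gradient[OF D(1)]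
          bounded_support_gradient[OF D(3)])
    ultimately have "(LINT x|lebesgue. G x \<bullet> gradient \<phi> x) + (LINT x|lebesgue. (G x *v u x) \<bullet> \<phi> x)
        - (LINT x|lebesgue. F x \<bullet> gradient \<phi> x) = 0"
      using LIMSEQ_unique by blast
    moreover have "(LINT x|lebesgue. W x \<bullet> gradient \<phi> x) = (LINT x|lebesgue. G x \<bullet> gradient \<phi> x)"
      by (rule cong) (intro borel_measurable_inner mW mG mg)+
    moreover have "(LINT x|lebesgue. (W x *v u x) \<bullet> \<phi> x) = (LINT x|lebesgue. (G x *v u x) \<bullet> \<phi> x)"
      by (rule cong[of "\<lambda>x A. (A *v u x) \<bullet> \<phi> x"])
        (intro borel_measurable_inner borel_measurable_matrix_vector_mult mW mG mg u)+
    ultimately show ?thesis by (simp add: L2_inner_def)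
  qed
  ultimately have "weak_solution F u" by (simp add: weak_solution_def W_def)
  moreover have "(1 / measure lebesgue \<omega>) *\<^sub>R (LINT x:\<omega>|lebesgue. u x) = \<mu>"
    using \<omega>(3) limit_integral_eq[OF lw \<omega>(1,2) Ck_continuous[OF admissibleD(1)[OF adm]] tail_classD(2)[OF w]] by simp
  moreover have energy: "(L2_norm W)\<^sup>2 \<le> L2_inner F W"
  proof -
    have small: "(\<lambda>n. 1 / real (Suc n)) \<longlonglongrightarrow> 0" using LIMSEQ_inverse_real_of_nat by (simp add: inverse_eq_divide)
    have "(\<lambda>n. (LINT x|lebesgue. F x \<bullet> gradient (w n) x) - l) \<longlonglongrightarrow> 0"
      by (rule Lim_null_comparison[OF always_eventually[OF allI] small]) (use tail_classD(4)[OF w] in simp)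
    moreover have "(\<lambda>n. (LINT x|lebesgue. F x \<bullet> gradient (w n) x) - l) \<longlonglongrightarrow> (LINT x|lebesgue. F x \<bullet> G x) - l"
      by (intro tendsto_intros L2_tendsto_integral_inner[OF L2_tendsto_const[OF F] G])
    \<comment> \<open>So far \<open>l\<close> was a limit of pairings along approximations; strong
      convergence makes it the pairing with \<open>G\<close>, which turns the bound by
      \<open>l\<close> into the energy inequality.\<close>
    ultimately have l: "(LINT x|lebesgue. F x \<bullet> G x) = l" using LIMSEQ_unique by fastforce
    have "(LINT x|lebesgue. (norm (G x))\<^sup>2) \<le> l + 0"
      by (rule LIMSEQ_le[OF L2_tendsto_integral_norm[OF G] tendsto_add[OF tendsto_const small]])
        (use tail_classD(5)[OF w] in blast)
    moreover have "(LINT x|lebesgue. (norm (W x))\<^sup>2) = (LINT x|lebesgue. (norm (G x))\<^sup>2)"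
    proof (rule cong[of "\<lambda>x A. (norm A)\<^sup>2"])
      note [measurable] = mW mG
      show "(\<lambda>x. (norm (W x))\<^sup>2) \<in> borel_measurable lebesgue" by measurable
      show "(\<lambda>x. (norm (G x))\<^sup>2) \<in> borel_measurable lebesgue" by measurable
    qed
    moreover have "(LINT x|lebesgue. F x \<bullet> W x) = (LINT x|lebesgue. F x \<bullet> G x)"
      by (rule cong) (intro borel_measurable_inner mW mG square_integrableD(1)[OF F])+
    ultimately show ?thesis
      by (simp add: L2_norm_def L2_inner_def l integral_norm_square_nonneg)
  qed
  moreover have "L2_norm W \<le> L2_norm F"
  proof -
    have sW: "square_integrable lebesgue W"
      unfolding square_integrable_def
    proof
      show "integrable lebesgue (\<lambda>x. (norm (W x))\<^sup>2)"
        using AE mW mG square_integrableD(2)[OF sG] by (subst integrable_cong_AE[where g = "\<lambda>x. (norm (G x))\<^sup>2"]) auto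
    qed (rule mW)
    \<comment> \<open>Cauchy-Schwarz on the right of the energy inequality; one factor is then
      cancelled unless it is 0.\<close>
    have "(L2_norm W)\<^sup>2 \<le> L2_norm F * L2_norm W"
      using energy Cauchy_Schwarz_integral_inner[OF F sW] unfolding L2_norm_def L2_inner_def by linarith
    moreover have "0 \<le> L2_norm W" "0 \<le> L2_norm F" by (simp_all add: L2_norm_def integral_norm_square_nonneg)
    ultimately show ?thesis
      by (cases "L2_norm W = 0") (auto simp: power2_eq_square)
  qed
  ultimately show ?thesis unfolding W_def by blast
qed

end
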